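(* Let $(M,\pi)$ be a smooth Poisson manifold. Then the Lie algebra structure on the de Rham cohomology $H^*(M)$ induced by the graded Koszul bracket $\{\,,\,\}$ on $\Omega^*(M)$ is trivial; that is, for all closed forms $\omega_1,\omega_2\in\Omega^*(M)$ the form $\{\omega_1,\omega_2\}$ is exact.
   Context: **Poisson manifold.** $\pi$ is a bivector field on $M$ whose Schouten square vanishes; equivalently $\{f,g\}=\pi(df,dg)$ is a Lie bracket on $C^\infty(M)$. The map $\pi^{\#}:T^*M\to TM$ is $\pi^{\#}\alpha=\pi(\alpha,\cdot)$. **Koszul bracket.** On 1-forms, $\{\alpha,\beta\}=-d\,\pi(\alpha,\beta)+\mathcal L_{\pi^{\#}\alpha}\beta-\mathcal L_{\pi^{\#}\beta}\alpha$, where $\mathcal L$ is the Lie derivative. Give a form $\omega$ of form-degree $|\omega|$ the degree $\deg\omega=|\omega|-1$, and write $d_i=\deg\omega_i$. The bracket extends uniquely to a bilinear bracket on all of $\Omega^*(M)$ of degree $0$ for this grading (so $\{\Omega^k,\Omega^l\}\subset\Omega^{k+l-1}$) by requiring: $\{f,g\}=0$ for two functions regarded as $0$-forms; $\{\alpha,f\}=\mathcal L_{\pi^{\#}\alpha}f$ for a 1-form $\alpha$ and a function $f$; the Leibniz rule $\{\omega_1,\omega_2\wedge\omega_3\}=\{\omega_1,\omega_2\}\wedge\omega_3+(-1)^{d_1(d_2+1)}\omega_2\wedge\{\omega_1,\omega_3\}$; and graded antisymmetry $\{\omega_1,\omega_2\}=-(-1)^{d_1d_2}\{\omega_2,\omega_1\}$.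 It satisfies the graded Jacobi identity and $d\{\omega_1,\omega_2\}=\{d\omega_1,\omega_2\}+(-1)^{d_1}\{\omega_1,d\omega_2\}$, so it induces a graded Lie bracket on $H^*(M)$ (with shifted degrees). *)

theory Defs
  imports "HOL-Analysis.Analysis" "HOL-Library.Function_Algebras"
begin

section \<open>Smooth manifolds\<close>

text \<open>
  \<open>\<real>\<^sup>n\<close> is the carrier of \<^const>\<open>Euclidean_space\<close>: sequences that vanish from index \<open>n\<close> on.  Its topology
  is the subspace topology of the product topology on \<^typ>\<open>nat \<Rightarrow> real\<close>.  The index \<open>n\<close> is a number and may be \<open>0\<close>.
\<close>

definition partial_deriv :: "nat \<Rightarrow> ((nat \<Rightarrow> real) \<Rightarrow> real) \<Rightarrow> (nat \<Rightarrow> real) \<Rightarrow> real" where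
  "partial_deriv i F x = deriv (\<lambda>t. F (x(i := t))) (x i)"

primrec C_k_on :: "nat \<Rightarrow> nat \<Rightarrow> (nat \<Rightarrow> real) set \<Rightarrow> ((nat \<Rightarrow> real) \<Rightarrow> real) \<Rightarrow> bool" where
  "C_k_on n 0 V F \<longleftrightarrow> continuous_on V F"
| "C_k_on n (Suc k) V F \<longleftrightarrow> continuous_on V F \<and>
     (\<forall>i<n. (\<forall>x\<in>V. (\<lambda>t. F (x(i := t))) differentiable (at (x i))) \<and> C_k_on n k V (partial_deriv i F))"

text \<open>Meant for sets \<open>V\<close> that are open in \<open>\<real>\<^sup>n\<close>.\<close>

definition smooth_on :: "nat \<Rightarrow> (nat \<Rightarrow> real) set \<Rightarrow> ((nat \<Rightarrow> real) \<Rightarrow> real) \<Rightarrow> bool" where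
  "smooth_on n V F \<longleftrightarrow> (\<forall>k. C_k_on n k V F)"

type_synonym 'm chart = "'m set \<times> ('m \<Rightarrow> nat \<Rightarrow> real)"

definition is_chart :: "nat \<Rightarrow> 'm::topological_space chart \<Rightarrow> bool" where
  "is_chart n c \<longleftrightarrow> (case c of (U, \<phi>) \<Rightarrow>
     open U \<and> openin (Euclidean_space n) (\<phi> ` U) \<and> homeomorphism U (\<phi> ` U) \<phi> (the_inv_into U \<phi>))"

text \<open>
  The manifold is the whole type \<open>'m\<close>.  The atlas need not be maximal; it determines the smooth structure.
\<close>

definition smooth_manifold ::
    "nat \<Rightarrow> 'm::{t2_space, second_countable_topology} chart set \<Rightarrow> bool" where
  "smooth_manifold n A \<longleftrightarrow>
     (\<forall>c\<in>A. is_chart n c) \<and> (\<Union>(U, \<phi>)\<in>A. U) = UNIV \<and>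
     (\<forall>(U, \<phi>)\<in>A. \<forall>(V, \<psi>)\<in>A. \<forall>i<n.
        smooth_on n (\<phi> ` (U \<inter> V)) (\<lambda>x. \<psi> (the_inv_into U \<phi> x) i))"

definition smooth_functions :: "nat \<Rightarrow> 'm::topological_space chart set \<Rightarrow> ('m \<Rightarrow> real) set" where
  "smooth_functions n A = {f. \<forall>(U, \<phi>)\<in>A. smooth_on n (\<phi> ` U) (f \<circ> the_inv_into U \<phi>)}"


section \<open>Vector fields and differential forms\<close>

text \<open>
  From here on \<open>C\<close> is the algebra of smooth functions of a manifold.  As in Helgason's
  \<^emph>\<open>Differential Geometry, Lie Groups, and Symmetric Spaces\<close>, a vector field is a derivation of \<open>C\<close>, and a
  \<open>k\<close>-form is an alternating \<open>C\<close>-multilinear map from \<open>k\<close>-tuples of vector fields to \<open>C\<close>.  Sums and products of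
  functions are pointwise (\<^theory>\<open>HOL-Library.Function_Algebras\<close>).

  Derivations are maps on all functions, forms are maps on all lists of maps.  They are set to \<open>0\<close>
  outside their proper domain, so that equality in HOL is equality of vector fields and of forms.
\<close>

type_synonym 'm vfield = "('m \<Rightarrow> real) \<Rightarrow> 'm \<Rightarrow> real"
type_synonym 'm form = "'m vfield list \<Rightarrow> 'm \<Rightarrow> real"

definition vector_fields :: "('m \<Rightarrow> real) set \<Rightarrow> 'm vfield set" where
  "vector_fields C = {X.
     (\<forall>f\<in>C. X f \<in> C) \<and>
     (\<forall>f\<in>C. \<forall>g\<in>C. X (f + g) = X f + X g) \<and>
     (\<forall>a. \<forall>f\<in>C. X (\<lambda>p. a * f p) = (\<lambda>p. a * X f p)) \<and>
     (\<forall>f\<in>C. \<forall>g\<in>C. X (f * g) = X f * g + f * X g) \<and>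
     (\<forall>f. f \<notin> C \<longrightarrow> X f = 0)}"

definition lie_bracket :: "'m vfield \<Rightarrow> 'm vfield \<Rightarrow> 'm vfield" where
  "lie_bracket X Y = (\<lambda>f. X (Y f) - Y (X f))"

text \<open>
  An element of the direct sum of all \<open>\<Omega>\<^sup>k\<close> is one map on lists of arbitrary length; its component of
  degree \<open>k\<close> is its restriction to lists of length \<open>k\<close>.
\<close>

definition forms :: "('m \<Rightarrow> real) set \<Rightarrow> 'm form set" where
  "forms C = {\<omega>.
     (\<forall>Xs. set Xs \<subseteq> vector_fields C \<longrightarrow> \<omega> Xs \<in> C) \<and>
     (\<forall>Xs. \<not> set Xs \<subseteq> vector_fields C \<longrightarrow> \<omega> Xs = 0) \<and>
     (\<forall>Xs Ys X Y. set Xs \<union> set Ys \<union> {X, Y} \<subseteq> vector_fields C \<longrightarrow>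
        \<omega> (Xs @ (X + Y) # Ys) = \<omega> (Xs @ X # Ys) + \<omega> (Xs @ Y # Ys)) \<and>
     (\<forall>Xs Ys X f. set Xs \<union> set Ys \<union> {X} \<subseteq> vector_fields C \<and> f \<in> C \<longrightarrow>
        \<omega> (Xs @ (\<lambda>g. f * X g) # Ys) = f * \<omega> (Xs @ X # Ys)) \<and>
     (\<forall>Xs. \<not> distinct Xs \<longrightarrow> \<omega> Xs = 0) \<and>
     (\<exists>N. \<forall>Xs. length Xs > N \<longrightarrow> \<omega> Xs = 0)}"

definition forms_deg :: "('m \<Rightarrow> real) set \<Rightarrow> nat \<Rightarrow> 'm form set" where
  "forms_deg C k = {\<omega> \<in> forms C. \<forall>Xs. length Xs \<noteq> k \<longrightarrow> \<omega> Xs = 0}"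

definition scale_form :: "real \<Rightarrow> 'm form \<Rightarrow> 'm form" where
  "scale_form a \<omega> = (\<lambda>Xs p. a * \<omega> Xs p)"

definition zero_form :: "('m \<Rightarrow> real) \<Rightarrow> 'm form" where
  "zero_form f = (\<lambda>Xs. if Xs = [] then f else 0)"

definition fun_times_form :: "('m \<Rightarrow> real) \<Rightarrow> 'm form \<Rightarrow> 'm form" where
  "fun_times_form f \<omega> = (\<lambda>Xs. f * \<omega> Xs)"

text \<open>
  The wedge product is a sum over all shuffles \<open>(S, {..<m} - S)\<close> without a factorial factor, so that
  \<open>(\<alpha> \<and> \<beta>)(X, Y) = \<alpha>(X) \<beta>(Y) - \<alpha>(Y) \<beta>(X)\<close> for 1-forms.  The sign is the parity of the number of inversions.
\<close>

definition shuffle_sign :: "nat \<Rightarrow> nat set \<Rightarrow> real" where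
  "shuffle_sign m S = (-1) ^ card {(i, j). i < j \<and> j < m \<and> i \<notin> S \<and> j \<in> S}"

definition wedge :: "'m form \<Rightarrow> 'm form \<Rightarrow> 'm form" where
  "wedge \<omega> \<eta> = (\<lambda>Xs p. \<Sum>S\<in>Pow {..<length Xs}.
     shuffle_sign (length Xs) S * \<omega> (nths Xs S) p * \<eta> (nths Xs (- S)) p)"

definition ext_d :: "('m \<Rightarrow> real) set \<Rightarrow> 'm form \<Rightarrow> 'm form" where
  "ext_d C \<omega> = (\<lambda>Xs p. if set Xs \<subseteq> vector_fields C then
       (\<Sum>i<length Xs. (-1) ^ i * (Xs ! i) (\<omega> (nths Xs (- {i}))) p)
     + (\<Sum>j<length Xs. \<Sum>i<j. (-1) ^ (i + j) *
          \<omega> (lie_bracket (Xs ! i) (Xs ! j) # nths Xs (- {i, j})) p)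
     else 0)"

definition lie_derivative :: "('m \<Rightarrow> real) set \<Rightarrow> 'm vfield \<Rightarrow> 'm form \<Rightarrow> 'm form" where
  "lie_derivative C X \<omega> = (\<lambda>Xs p. if set Xs \<subseteq> vector_fields C then
       X (\<omega> Xs) p - (\<Sum>i<length Xs. \<omega> (Xs[i := lie_bracket X (Xs ! i)]) p)
     else 0)"

definition closed_form :: "('m \<Rightarrow> real) set \<Rightarrow> 'm form \<Rightarrow> bool" where
  "closed_form C \<omega> \<longleftrightarrow> \<omega> \<in> forms C \<and> ext_d C \<omega> = 0"

definition exact_form :: "('m \<Rightarrow> real) set \<Rightarrow> 'm form \<Rightarrow> bool" where
  "exact_form C \<omega> \<longleftrightarrow> (\<exists>\<eta>\<in>forms C. \<omega> = ext_d C \<eta>)"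


section \<open>Poisson structures and the Koszul bracket\<close>

text \<open>A bivector field as an alternating \<open>C\<close>-bilinear pairing of 1-forms.\<close>

definition bivector_field ::
    "('m \<Rightarrow> real) set \<Rightarrow> ('m form \<Rightarrow> 'm form \<Rightarrow> 'm \<Rightarrow> real) \<Rightarrow> bool" where
  "bivector_field C \<pi> \<longleftrightarrow>
     (\<forall>\<alpha>\<in>forms_deg C 1. \<forall>\<beta>\<in>forms_deg C 1. \<pi> \<alpha> \<beta> \<in> C \<and> \<pi> \<alpha> \<beta> = - \<pi> \<beta> \<alpha>) \<and>
     (\<forall>\<alpha>\<in>forms_deg C 1. \<forall>\<beta>\<in>forms_deg C 1. \<forall>\<gamma>\<in>forms_deg C 1. \<pi> (\<alpha> + \<beta>) \<gamma> = \<pi> \<alpha> \<gamma> + \<pi> \<beta> \<gamma>) \<and>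
     (\<forall>f\<in>C. \<forall>\<alpha>\<in>forms_deg C 1. \<forall>\<beta>\<in>forms_deg C 1. \<pi> (fun_times_form f \<alpha>) \<beta> = f * \<pi> \<alpha> \<beta>)"

definition poisson_bracket :: "('m \<Rightarrow> real) set \<Rightarrow> ('m form \<Rightarrow> 'm form \<Rightarrow> 'm \<Rightarrow> real) \<Rightarrow>
    ('m \<Rightarrow> real) \<Rightarrow> ('m \<Rightarrow> real) \<Rightarrow> 'm \<Rightarrow> real" where
  "poisson_bracket C \<pi> f g = \<pi> (ext_d C (zero_form f)) (ext_d C (zero_form g))"

text \<open>Bilinearity and antisymmetry of the bracket of functions come from \<open>\<pi>\<close>; only the Jacobi identity is a condition.\<close>

definition poisson_structure ::
    "('m \<Rightarrow> real) set \<Rightarrow> ('m form \<Rightarrow> 'm form \<Rightarrow> 'm \<Rightarrow> real) \<Rightarrow> bool" where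
  "poisson_structure C \<pi> \<longleftrightarrow> bivector_field C \<pi> \<and>
     (\<forall>f\<in>C. \<forall>g\<in>C. \<forall>h\<in>C.
        poisson_bracket C \<pi> f (poisson_bracket C \<pi> g h) +
        poisson_bracket C \<pi> g (poisson_bracket C \<pi> h f) +
        poisson_bracket C \<pi> h (poisson_bracket C \<pi> f g) = 0)"

text \<open>
  The vector field \<open>\<pi>(\<alpha>, \<cdot>)\<close> as a derivation: a vector field \<open>X\<close> acts on functions by \<open>X f = df(X)\<close>.
\<close>

definition sharp ::
    "('m \<Rightarrow> real) set \<Rightarrow> ('m form \<Rightarrow> 'm form \<Rightarrow> 'm \<Rightarrow> real) \<Rightarrow> 'm form \<Rightarrow> 'm vfield" where
  "sharp C \<pi> \<alpha> = (\<lambda>f. if f \<in> C then \<pi> \<alpha> (ext_d C (zero_form f)) else 0)"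

definition shifted_deg :: "nat \<Rightarrow> int" where
  "shifted_deg k = int k - 1"

text \<open>
  The properties that characterize the graded Koszul bracket uniquely on \<^term>\<open>forms C\<close>.  Values of \<open>B\<close> outside
  \<^term>\<open>forms C\<close> are irrelevant.  In the degree clause the case \<open>k = l = 0\<close> is covered by the clause for functions.
\<close>

definition koszul_bracket ::
    "('m \<Rightarrow> real) set \<Rightarrow> ('m form \<Rightarrow> 'm form \<Rightarrow> 'm \<Rightarrow> real) \<Rightarrow> ('m form \<Rightarrow> 'm form \<Rightarrow> 'm form) \<Rightarrow> bool" where
  "koszul_bracket C \<pi> B \<longleftrightarrow>
     (\<forall>\<omega>\<in>forms C. \<forall>\<eta>\<in>forms C. B \<omega> \<eta> \<in> forms C) \<and>
     (\<forall>\<omega>\<in>forms C. \<forall>\<omega>'\<in>forms C. \<forall>\<eta>\<in>forms C.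
        B (\<omega> + \<omega>') \<eta> = B \<omega> \<eta> + B \<omega>' \<eta> \<and> B \<eta> (\<omega> + \<omega>') = B \<eta> \<omega> + B \<eta> \<omega>') \<and>
     (\<forall>a. \<forall>\<omega>\<in>forms C. \<forall>\<eta>\<in>forms C.
        B (scale_form a \<omega>) \<eta> = scale_form a (B \<omega> \<eta>) \<and> B \<omega> (scale_form a \<eta>) = scale_form a (B \<omega> \<eta>)) \<and>
     (\<forall>k l. \<forall>\<omega>\<in>forms_deg C k. \<forall>\<eta>\<in>forms_deg C l. k + l \<ge> 1 \<longrightarrow> B \<omega> \<eta> \<in> forms_deg C (k + l - 1)) \<and>
     (\<forall>f\<in>C. \<forall>g\<in>C. B (zero_form f) (zero_form g) = 0) \<and>
     (\<forall>\<alpha>\<in>forms_deg C 1. \<forall>f\<in>C.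
        B \<alpha> (zero_form f) = lie_derivative C (sharp C \<pi> \<alpha>) (zero_form f)) \<and>
     (\<forall>\<alpha>\<in>forms_deg C 1. \<forall>\<beta>\<in>forms_deg C 1.
        B \<alpha> \<beta> = - ext_d C (zero_form (\<pi> \<alpha> \<beta>))
          + lie_derivative C (sharp C \<pi> \<alpha>) \<beta> - lie_derivative C (sharp C \<pi> \<beta>) \<alpha>) \<and>
     (\<forall>k1 k2 k3. \<forall>\<omega>1\<in>forms_deg C k1. \<forall>\<omega>2\<in>forms_deg C k2. \<forall>\<omega>3\<in>forms_deg C k3.
        B \<omega>1 (wedge \<omega>2 \<omega>3) = wedge (B \<omega>1 \<omega>2) \<omega>3
          + scale_form ((-1) powi (shifted_deg k1 * (shifted_deg k2 + 1))) (wedge \<omega>2 (B \<omega>1 \<omega>3))) \<and>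
     (\<forall>k1 k2. \<forall>\<omega>1\<in>forms_deg C k1. \<forall>\<omega>2\<in>forms_deg C k2.
        B \<omega>1 \<omega>2 = - scale_form ((-1) powi (shifted_deg k1 * shifted_deg k2)) (B \<omega>2 \<omega>1))"

end

theory Submission
  imports Defs
begin

text \<open>
  On closed forms the Koszul bracket has an explicit global primitive.  For a form \<open>\<sigma>\<close> of degree \<open>k\<close>, let
  \<open>P = P\<^sub>\<sigma>\<close> be the operator on forms that contracts the bivector field with one slot of \<open>\<sigma>\<close> and one slot of
  its argument (\<open>pairing\<close>).  It inserts a vector-valued form and is therefore a derivation of the wedge
  product, and so is its graded commutator \<open>[d, P]\<close> with the exterior derivative.  If \<open>\<sigma>\<close> is closed, then
  \<open>{\<sigma>, \<cdot>} = [d, P]\<close>.  For a closed \<open>\<omega>\<close> this says \<open>{\<sigma>, \<omega>} = d P \<omega>\<close>, which is exact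
  (\<open>bracket_closed_homogeneous\<close>).

  To prove \<open>{\<sigma>, \<cdot>} = [d, P]\<close> it suffices to compare two derivations on functions and on differentials of
  functions (\<open>derivation_like_unique\<close>).  Let \<open>X\<^sub>f\<close> be the vector field \<open>\<pi>(df, \<cdot>)\<close>.  The same uniqueness
  principle first identifies \<open>{f, \<cdot>}\<close> with the interior product by \<open>X\<^sub>f\<close> and \<open>{df, \<cdot>}\<close> with the Lie derivative
  along \<open>X\<^sub>f\<close> (\<open>bracket_function\<close>, \<open>bracket_differential\<close>).  By antisymmetry this gives the values of
  \<open>{\<sigma>, \<cdot>}\<close> on \<open>f\<close> and \<open>df\<close>, and Cartan's formula together with \<open>d\<sigma> = 0\<close> shows that they are the values
  of \<open>[d, P]\<close>.

  Uniqueness of derivations is a local matter, but forms are global objects here.  The link is a frame near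
  a given point: functions \<open>x\<^sub>i\<close>, vector fields \<open>E\<^sub>i\<close> and a function \<open>\<rho>\<close> that does not vanish at the point,
  with \<open>\<rho> X f = \<Sum>\<^sub>i X(x\<^sub>i) E\<^sub>i f\<close> for all vector fields \<open>X\<close> and functions \<open>f\<close>.  It implies
  \<open>\<Sum>\<^sub>i dx\<^sub>i \<and> \<iota>\<^bsub>E\<^sub>i\<^esub> \<omega> = k \<rho> \<omega>\<close> for \<open>\<omega>\<close> of degree \<open>k\<close>, which reduces forms of degree \<open>k\<close> to forms of
  degree \<open>k - 1\<close> without any choice of a basis.  On a manifold a frame is obtained from a chart by means of
  a bump function and Hadamard's lemma (\<open>frame_in_chart\<close>).

  The identities for wedge product, Lie derivative, exterior derivative and \<open>P\<close> are all proved in the same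
  way: each operation is described by the effect of contracting its value with one vector field, and
  the identity follows by induction over the list of arguments.
\<close>

section \<open>The wedge product by recursion over the arguments\<close>

text \<open>
  As simplification rules the pointwise laws also rewrite a sum or a zero that is not applied to
  anything, into a \<open>\<lambda>\<close>-term that no law about forms matches any more.  They are therefore used only on
  request; \<open>form_apply\<close> evaluates a form on a list without touching the resulting functions.
\<close>

lemmas fun_apply = plus_fun_apply times_fun_apply zero_fun_apply one_fun_apply uminus_apply minus_apply
declare fun_apply [simp del]

lemma form_apply:
  fixes \<alpha> \<beta> :: "'m form"
  shows "(\<alpha> + \<beta>) Xs = \<alpha> Xs + \<beta> Xs" "(\<alpha> - \<beta>) Xs = \<alpha> Xs - \<beta> Xs" "(- \<alpha>) Xs = - \<alpha> Xs" "(0 :: 'm form) Xs = 0"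
  by (rule fun_apply)+

text \<open>
  The interior product.  Almost every identity below is proved by induction over the list of vector
  fields, with the contraction by the first one as the induction step.
\<close>

definition contract :: "'m vfield \<Rightarrow> 'm form \<Rightarrow> 'm form" where
  "contract X \<omega> = (\<lambda>Xs. \<omega> (X # Xs))"

lemma contract_apply: "contract X \<omega> Xs = \<omega> (X # Xs)"
  by (simp add: contract_def)

text \<open>
  \<open>s\<close> is the constant function \<open>1\<close> or \<open>-1\<close>.  Signs are kept as elements of the ring of functions, so that
  sign rules become ring identities.
\<close>

definition has_parity :: "('m \<Rightarrow> real) \<Rightarrow> 'm form \<Rightarrow> bool" where
  "has_parity s \<omega> \<longleftrightarrow> (\<forall>Xs. \<omega> Xs \<noteq> 0 \<longrightarrow> s = (- 1) ^ length Xs)"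

lemma has_parity_contract: "has_parity s \<omega> \<Longrightarrow> has_parity (- s) (contract X \<omega>)"
  by (fastforce simp: has_parity_def contract_def)

text \<open>
  The Leibniz rule of the interior product, turned into a definition.  Here \<open>s\<close> stands for \<open>(-1)\<^sup>k\<close> where
  \<open>k\<close> is the degree of \<open>\<alpha>\<close>; contracting \<open>\<alpha>\<close> changes its parity, hence the \<open>- s\<close>.
\<close>

fun swedge :: "('m \<Rightarrow> real) \<Rightarrow> 'm form \<Rightarrow> 'm form \<Rightarrow> 'm form" where
  "swedge s \<alpha> \<beta> [] = \<alpha> [] * \<beta> []"
| "swedge s \<alpha> \<beta> (X # Xs) = swedge (- s) (contract X \<alpha>) \<beta> Xs + s * swedge s \<alpha> (contract X \<beta>) Xs"

lemma contract_swedge: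
  "contract X (swedge s \<alpha> \<beta>) =
     swedge (- s) (contract X \<alpha>) \<beta> + fun_times_form s (swedge s \<alpha> (contract X \<beta>))"
  by (auto simp: contract_def fun_times_form_def fun_eq_iff fun_apply)

text \<open>
  Splits the shuffles of \<open>X # Xs\<close> according to the factor that receives \<open>X\<close>.
\<close>

lemma Pow_lessThan_Suc_shift:
  "Pow {..<Suc m} = (\<lambda>S. insert 0 (Suc ` S)) ` Pow {..<m} \<union> (\<lambda>S. Suc ` S) ` Pow {..<m}"
proof -
  have "Pow (Suc ` {..<m}) = (\<lambda>S. Suc ` S) ` Pow {..<m}"
    by (metis image_Pow_surj)
  then show ?thesis
    by (simp only: lessThan_Suc_eq_insert_0 Pow_insert image_image Un_commute)
qed

lemma shuffle_sign_insert_0: "shuffle_sign (Suc m) (insert 0 (Suc ` S)) = shuffle_sign m S"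
proof -
  have "{(i, j). i < j \<and> j < Suc m \<and> i \<notin> insert 0 (Suc ` S) \<and> j \<in> insert 0 (Suc ` S)} =
        (\<lambda>(i, j). (Suc i, Suc j)) ` {(i, j). i < j \<and> j < m \<and> i \<notin> S \<and> j \<in> S}"
    apply (auto simp: image_iff)
    by (metis Suc_less_eq gr0_implies_Suc not_less0)
  moreover have "inj_on (\<lambda>(i, j). (Suc i, Suc j)) {(i, j). i < j \<and> j < m \<and> i \<notin> S \<and> j \<in> S}"
    by (auto simp: inj_on_def)
  ultimately show ?thesis
    by (simp add: shuffle_sign_def card_image)
qed

text \<open>
  When the first argument goes to the right factor, it is inverted with each of the \<open>card S\<close> arguments of
  the left factor.
\<close>

lemma shuffle_sign_Suc:
  assumes "S \<subseteq> {..<m}"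
  shows "shuffle_sign (Suc m) (Suc ` S) = (- 1) ^ card S * shuffle_sign m S"
proof -
  let ?I = "{(i, j). i < j \<and> j < m \<and> i \<notin> S \<and> j \<in> S}"
  have eq: "{(i, j). i < j \<and> j < Suc m \<and> i \<notin> Suc ` S \<and> j \<in> Suc ` S} =
        (\<lambda>(i, j). (Suc i, Suc j)) ` ?I \<union> (\<lambda>j. (0, Suc j)) ` S"
    using assms
    apply (auto simp: image_iff)
    by (metis gr0_implies_Suc Suc_less_eq not_gr0)
  have "?I \<subseteq> {..<m} \<times> {..<m}"
    by auto
  then have fin: "finite ?I" "finite S"
    using assms finite_subset[of ?I "{..<m} \<times> {..<m}"] finite_subset[of S "{..<m}"] by blast+
  have "card ((\<lambda>(i, j). (Suc i, Suc j)) ` ?I \<union> (\<lambda>j. (0::nat, Suc j)) ` S) = card ?I + card S"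
    by (subst card_Un_disjoint) (auto simp: fin card_image inj_on_def)
  then show ?thesis
    unfolding shuffle_sign_def eq by (simp add: power_add)
qed

lemma wedge_Cons:
  assumes "has_parity s \<alpha>"
  shows "wedge \<alpha> \<beta> (X # Xs) = wedge (contract X \<alpha>) \<beta> Xs + s * wedge \<alpha> (contract X \<beta>) Xs"
proof
  fix p
  let ?m = "length Xs"
  have inj: "inj_on (\<lambda>S. insert 0 (Suc ` S)) (Pow {..<?m})" "inj_on (\<lambda>S. Suc ` S) (Pow {..<?m})"
    by (auto simp: inj_on_def inj_image_eq_iff insert_eq_iff)
  have disj: "(\<lambda>S. insert 0 (Suc ` S)) ` Pow {..<?m} \<inter> (\<lambda>S. Suc ` S) ` Pow {..<?m} = {}"
    by auto
  let ?F = "\<lambda>S. shuffle_sign (Suc ?m) S * \<alpha> (nths (X # Xs) S) p * \<beta> (nths (X # Xs) (- S)) p"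
  have compl: "{j. Suc j \<in> - Suc ` S} = - S" "{j. Suc j \<in> insert 0 (Suc ` S)} = S"
       "{j. Suc j \<in> - insert 0 (Suc ` S)} = - S" "{j. Suc j \<in> Suc ` S} = S"
      "{j. Suc j \<notin> Suc ` S} = - S" for S
    by auto
  \<comment> \<open>the first argument goes to \<open>\<alpha>\<close> or to \<open>\<beta>\<close>\<close>
  have 1: "?F (insert 0 (Suc ` S)) = shuffle_sign ?m S * contract X \<alpha> (nths Xs S) p * \<beta> (nths Xs (- S)) p" for S
    by (simp add: nths_Cons compl shuffle_sign_insert_0 contract_def)
  have 2: "?F (Suc ` S) = s p * (shuffle_sign ?m S * \<alpha> (nths Xs S) p * contract X \<beta> (nths Xs (- S)) p)"
    if "S \<in> Pow {..<?m}" for S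
  proof (cases "\<alpha> (nths Xs S) = 0")
    case False
    then have "s = (- 1) ^ length (nths Xs S)"
      using assms by (auto simp: has_parity_def)
    moreover have "{i. i < length Xs \<and> i \<in> S} = S"
      using that by auto
    ultimately have s: "s = (- 1) ^ card S"
      by (simp add: length_nths)
    have "((- 1) ^ k) p = (- 1 :: real) ^ k" for k
      by (induction k) (auto simp: fun_apply)
    then have "s p = (- 1) ^ card S"
      by (simp add: s)
    then show ?thesis
      using that by (simp add: nths_Cons compl shuffle_sign_Suc contract_def mult_ac)
  qed (simp add: nths_Cons compl fun_apply)
  have "wedge \<alpha> \<beta> (X # Xs) p = sum ?F (Pow {..<Suc ?m})"
    by (simp add: wedge_def)
  also have "\<dots> = (\<Sum>S\<in>Pow {..<?m}. ?F (insert 0 (Suc ` S))) + (\<Sum>S\<in>Pow {..<?m}. ?F (Suc ` S))"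
    unfolding Pow_lessThan_Suc_shift
    by (subst sum.union_disjoint[OF _ _ disj]) (simp_all only: finite_imageI finite_Pow_iff finite_lessThan
        sum.reindex[OF inj(1)] sum.reindex[OF inj(2)] o_def)
  also have "\<dots> = wedge (contract X \<alpha>) \<beta> Xs p + s p * wedge \<alpha> (contract X \<beta>) Xs p"
    by (simp only: 1 2 cong: sum.cong) (simp add: wedge_def sum_distrib_left)
  finally show "wedge \<alpha> \<beta> (X # Xs) p =
      (wedge (contract X \<alpha>) \<beta> Xs + s * wedge \<alpha> (contract X \<beta>) Xs) p"
    by (simp add: fun_apply)
qed

text \<open>
  Only for a left factor of definite parity is the number of arguments that \<open>X\<close> has to pass, and hence its
  sign, the same in all shuffles that contribute.
\<close>

lemma wedge_eq_swedge:
  assumes "has_parity s \<alpha>"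
  shows "wedge \<alpha> \<beta> = swedge s \<alpha> \<beta>"
proof
  show "wedge \<alpha> \<beta> Xs = swedge s \<alpha> \<beta> Xs" for Xs
    using assms
  proof (induction Xs arbitrary: s \<alpha> \<beta>)
    case Nil
    show ?case by (simp add: wedge_def shuffle_sign_def times_fun_def)
  next
    case (Cons X Xs)
    show ?case
      by (simp add: wedge_Cons[OF Cons.prems] Cons.IH[OF Cons.prems]
          Cons.IH[OF has_parity_contract[OF Cons.prems]])
  qed
qed

lemma contract_linear:
  "contract X (\<alpha> + \<beta>) = contract X \<alpha> + contract X \<beta>"
  "contract X (- \<alpha>) = - contract X \<alpha>"
  "contract X (fun_times_form f \<alpha>) = fun_times_form f (contract X \<alpha>)"
  "contract X 0 = 0"
  by (auto simp: contract_def fun_times_form_def fun_eq_iff fun_apply)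

lemma swedge_add:
  "swedge s (\<alpha> + \<alpha>') \<beta> Xs = swedge s \<alpha> \<beta> Xs + swedge s \<alpha>' \<beta> Xs"
  "swedge s \<alpha> (\<beta> + \<beta>') Xs = swedge s \<alpha> \<beta> Xs + swedge s \<alpha> \<beta>' Xs"
  by (induction Xs arbitrary: s \<alpha> \<alpha>' \<beta> \<beta>')
     (simp_all add: contract_linear fun_apply(1) algebra_simps)

lemma swedge_fun_times_form:
  "swedge s (fun_times_form f \<alpha>) \<beta> Xs = f * swedge s \<alpha> \<beta> Xs"
  "swedge s \<alpha> (fun_times_form f \<beta>) Xs = f * swedge s \<alpha> \<beta> Xs"
  by (induction Xs arbitrary: s \<alpha> \<beta>)
     (simp_all add: contract_linear algebra_simps, simp_all add: fun_times_form_def mult_ac)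

lemma fun_times_form_simps:
  "fun_times_form 0 \<omega> = 0" "fun_times_form (- 1) \<omega> = - \<omega>" "fun_times_form 1 \<omega> = \<omega>"
  "fun_times_form f 0 = 0"
  by (simp_all add: fun_times_form_def fun_eq_iff fun_apply)

lemma swedge_uminus:
  "swedge s (- \<alpha>) \<beta> Xs = - swedge s \<alpha> \<beta> Xs"
  "swedge s \<alpha> (- \<beta>) Xs = - swedge s \<alpha> \<beta> Xs"
  using swedge_fun_times_form[where f = "-1"]
  by (simp_all add: fun_times_form_simps)

lemma swedge_zero:
  "swedge s 0 \<beta> Xs = 0" "swedge s \<alpha> 0 Xs = 0"
  using swedge_fun_times_form(1)[where f = 0 and \<alpha> = 0] swedge_fun_times_form(2)[where f = 0 and \<beta> = 0]
  by (simp_all add: fun_times_form_simps)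

lemma swedge_zero_eq: "swedge s 0 \<beta> = 0" "swedge s \<alpha> 0 = 0"
  by (rule ext, simp only: swedge_zero form_apply)+

lemmas swedge_linear = swedge_add swedge_uminus swedge_zero

lemma swedge_cong:
  assumes "\<And>Ys. set Ys \<subseteq> set Xs \<Longrightarrow> \<alpha> Ys = \<alpha>' Ys" "\<And>Ys. set Ys \<subseteq> set Xs \<Longrightarrow> \<beta> Ys = \<beta>' Ys"
  shows "swedge s \<alpha> \<beta> Xs = swedge s \<alpha>' \<beta>' Xs"
  using assms
proof (induction Xs arbitrary: s \<alpha> \<alpha>' \<beta> \<beta>')
  case (Cons X Xs)
  have 1: "swedge (- s) (contract X \<alpha>) \<beta> Xs = swedge (- s) (contract X \<alpha>') \<beta>' Xs"
    by (rule Cons.IH) (auto simp: contract_def intro!: Cons.prems)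
  have 2: "swedge s \<alpha> (contract X \<beta>) Xs = swedge s \<alpha>' (contract X \<beta>') Xs"
    by (rule Cons.IH) (auto simp: contract_def intro!: Cons.prems)
  show ?case by (simp add: 1 2)
qed simp

definition homogeneous_part :: "nat \<Rightarrow> 'm form \<Rightarrow> 'm form" where
  "homogeneous_part k \<omega> = (\<lambda>Xs. if length Xs = k then \<omega> Xs else 0)"

lemma contract_zero_form: "contract X (zero_form f) = 0"
  by (rule ext) (simp add: contract_def zero_form_def form_apply)

lemma contract_homogeneous_part:
  "contract X (homogeneous_part 0 \<omega>) = 0"
  "contract X (homogeneous_part (Suc k) \<omega>) = homogeneous_part k (contract X \<omega>)"
  by (rule ext, simp add: contract_def homogeneous_part_def form_apply)+

lemma swedge_zero_form: "swedge 1 (zero_form f) \<omega> = fun_times_form f \<omega>"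
proof
  show "swedge 1 (zero_form f) \<omega> Xs = fun_times_form f \<omega> Xs" for Xs
  proof (induction Xs arbitrary: \<omega>)
    case (Cons X Xs)
    show ?case
      by (simp add: contract_zero_form swedge_linear Cons.IH) (simp add: fun_times_form_def contract_def)
  qed (simp add: zero_form_def fun_times_form_def)
qed

lemma has_parity_zero_form: "has_parity 1 (zero_form f)"
  by (simp add: has_parity_def zero_form_def)

lemma forms_deg_has_parity: "\<omega> \<in> forms_deg C k \<Longrightarrow> has_parity ((- 1) ^ k) \<omega>"
  by (auto simp: forms_deg_def has_parity_def)

lemma wedge_forms_deg: "\<omega> \<in> forms_deg C k \<Longrightarrow> wedge \<omega> \<eta> = swedge ((- 1) ^ k) \<omega> \<eta>"
  by (intro wedge_eq_swedge forms_deg_has_parity)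

lemma sum_form_apply: "(\<Sum>i\<in>I. (F i :: 'm form)) Xs = (\<Sum>i\<in>I. F i Xs)"
  by (induction I rule: infinite_finite_induct) (simp_all add: form_apply(1) form_apply(4)[of Xs])

lemma sum_vfield_apply: "(\<Sum>i\<in>I. (X i :: 'm vfield)) f = (\<Sum>i\<in>I. X i f)"
  by (induction I rule: infinite_finite_induct) (simp_all add: fun_apply(1) zero_fun_apply[of f])

lemma sum_fun_apply: "(\<Sum>i\<in>I. (f i :: 'm \<Rightarrow> real)) p = (\<Sum>i\<in>I. f i p)"
  by (induction I rule: infinite_finite_induct) (simp_all add: fun_apply)

lemma sign_uminus: "(s :: 'm \<Rightarrow> real) = 1 \<or> s = - 1 \<Longrightarrow> - s = 1 \<or> - s = - 1"
  by auto

lemma nths_delete: "nths Xs (- {k}) = take k Xs @ drop (Suc k) Xs"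
proof (induction Xs arbitrary: k)
  case (Cons X Xs)
  have "{j. Suc j \<noteq> k} = (if k = 0 then UNIV else - {k - 1})"
    by auto
  then show ?case
    using Cons.IH[of "k - 1"] by (cases k) (simp_all add: nths_Cons nths_all)
qed simp

lemma nths_Cons_delete:
  "nths (X # Xs) (- {0}) = Xs" "nths (X # Xs) (- {Suc k}) = X # nths Xs (- {k})"
  "nths (X # Xs) (- {0, Suc k}) = nths Xs (- {k})"
  "nths (X # Xs) (- {Suc l, Suc k}) = X # nths Xs (- {l, k})"
proof -
  have "{j. Suc j \<noteq> Suc k \<and> Suc j \<noteq> Suc l} = - {k, l}" for k l
    by auto
  moreover have "{j. Suc j \<in> - {Suc l, Suc k}} = - {l, k}" "{j. Suc j \<in> - {0, Suc k}} = - {k}"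
     "{j. Suc j \<in> - {Suc k}} = - {k}"
    by auto
  ultimately show "nths (X # Xs) (- {0}) = Xs" "nths (X # Xs) (- {Suc k}) = X # nths Xs (- {k})"
    "nths (X # Xs) (- {0, Suc k}) = nths Xs (- {k})"
    "nths (X # Xs) (- {Suc l, Suc k}) = X # nths Xs (- {l, k})"
    unfolding nths_Cons by (simp_all add: nths_all del: Compl_insert)
qed

lemma minus_one_power_apply: "((- 1) ^ k) p = (- 1 :: real) ^ k"
  by (induction k) (simp_all add: fun_apply)

lemma homogeneous_part_linear:
  "homogeneous_part k (\<alpha> + \<beta>) = homogeneous_part k \<alpha> + homogeneous_part k \<beta>"
  "homogeneous_part k (fun_times_form f \<alpha>) = fun_times_form f (homogeneous_part k \<alpha>)"
  by (simp_all add: fun_eq_iff homogeneous_part_def fun_times_form_def fun_apply)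

section \<open>Alternating multilinear maps\<close>

text \<open>
  Multilinearity in all slots and antisymmetry follow from linearity in the first slot and antisymmetry in
  the first two, provided that all iterated contractions have the same properties.  The counter \<open>n\<close> bounds
  the number of contractions, which makes this a definition by recursion; closure of the class under an
  operation then takes one induction over \<open>n\<close> and uses only the contraction rule of that operation.
\<close>

fun alternating_upto :: "('m \<Rightarrow> real) set \<Rightarrow> nat \<Rightarrow> 'm form \<Rightarrow> bool" where
  "alternating_upto C 0 \<omega> \<longleftrightarrow> \<omega> [] \<in> C"
| "alternating_upto C (Suc n) \<omega> \<longleftrightarrow> \<omega> [] \<in> C \<and>
     (\<forall>X. X \<notin> vector_fields C \<longrightarrow> contract X \<omega> = 0) \<and>
     (\<forall>X\<in>vector_fields C. alternating_upto C n (contract X \<omega>)) \<and>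
     (\<forall>X\<in>vector_fields C. \<forall>Y\<in>vector_fields C.
        contract (X + Y) \<omega> = contract X \<omega> + contract Y \<omega>) \<and>
     (\<forall>X\<in>vector_fields C. \<forall>f\<in>C.
        contract (\<lambda>g. f * X g) \<omega> = fun_times_form f (contract X \<omega>)) \<and>
     (\<forall>X Y. contract X (contract Y \<omega>) = - contract Y (contract X \<omega>))"

definition alternating :: "('m \<Rightarrow> real) set \<Rightarrow> 'm form \<Rightarrow> bool" where
  "alternating C \<omega> \<longleftrightarrow> (\<forall>n. alternating_upto C n \<omega>)"

lemma alternating_uptoD:
  "alternating_upto C (Suc n) \<omega> \<Longrightarrow> \<omega> [] \<in> C"
  "alternating_upto C (Suc n) \<omega> \<Longrightarrow> X \<notin> vector_fields C \<Longrightarrow> contract X \<omega> = 0"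
  "alternating_upto C (Suc n) \<omega> \<Longrightarrow> X \<in> vector_fields C \<Longrightarrow> alternating_upto C n (contract X \<omega>)"
  "alternating_upto C (Suc n) \<omega> \<Longrightarrow> X \<in> vector_fields C \<Longrightarrow> Y \<in> vector_fields C \<Longrightarrow>
        contract (X + Y) \<omega> = contract X \<omega> + contract Y \<omega>"
  "alternating_upto C (Suc n) \<omega> \<Longrightarrow> X \<in> vector_fields C \<Longrightarrow> f \<in> C \<Longrightarrow>
        contract (\<lambda>g. f * X g) \<omega> = fun_times_form f (contract X \<omega>)"
  "alternating_upto C (Suc n) \<omega> \<Longrightarrow> contract X (contract Y \<omega>) = - contract Y (contract X \<omega>)"
  unfolding alternating_upto.simps by blast+

lemma alternating_upto_Suc: "alternating_upto C (Suc n) \<omega> \<Longrightarrow> alternating_upto C n \<omega>"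
proof (induction n arbitrary: \<omega>)
  case (Suc n)
  note D = alternating_uptoD[OF Suc.prems]
  show ?case
    unfolding alternating_upto.simps(2)[of C n] using D(1,2,4,5,6) Suc.IH[OF D(3)] by blast
next
  case 0
  then show ?case unfolding alternating_upto.simps by blast
qed

lemma alternatingD:
  assumes "alternating C \<omega>"
  shows "\<omega> [] \<in> C"
    and "X \<notin> vector_fields C \<Longrightarrow> contract X \<omega> = 0"
    and "X \<in> vector_fields C \<Longrightarrow> alternating C (contract X \<omega>)"
    and "X \<in> vector_fields C \<Longrightarrow> Y \<in> vector_fields C \<Longrightarrow>
        contract (X + Y) \<omega> = contract X \<omega> + contract Y \<omega>"
    and "X \<in> vector_fields C \<Longrightarrow> f \<in> C \<Longrightarrow>
        contract (\<lambda>g. f * X g) \<omega> = fun_times_form f (contract X \<omega>)"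
    and "contract X (contract Y \<omega>) = - contract Y (contract X \<omega>)"
  using alternating_uptoD[of C _ \<omega>] assms unfolding alternating_def by blast+

text \<open>
  Everything up to the calculus on coordinate space is algebra over a ring of functions; smoothness enters
  only through the existence of local frames.
\<close>

locale function_algebra =
  fixes C :: "('m \<Rightarrow> real) set"
  assumes const_mem: "(\<lambda>_. a) \<in> C"
    and add_mem: "f \<in> C \<Longrightarrow> g \<in> C \<Longrightarrow> f + g \<in> C"
    and mult_mem: "f \<in> C \<Longrightarrow> g \<in> C \<Longrightarrow> f * g \<in> C"
begin

abbreviation "VF \<equiv> vector_fields C"

lemma zero_mem: "0 \<in> C" and one_mem: "1 \<in> C"
  using const_mem[of 0] const_mem[of 1] by (simp_all add: zero_fun_def one_fun_def)

lemma uminus_mem: "f \<in> C \<Longrightarrow> - f \<in> C"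
  using mult_mem[OF const_mem[of "-1"], of f] by (simp add: times_fun_def fun_Compl_def)

lemma diff_mem: "f \<in> C \<Longrightarrow> g \<in> C \<Longrightarrow> f - g \<in> C"
  using add_mem[OF _ uminus_mem, of f g] by simp

lemma sum_mem: "(\<And>i. i \<in> I \<Longrightarrow> f i \<in> C) \<Longrightarrow> sum f I \<in> C"
  by (induction I rule: infinite_finite_induct) (simp_all add: zero_mem add_mem)

lemma scale_mem: "f \<in> C \<Longrightarrow> (\<lambda>p. a * f p) \<in> C"
  using mult_mem[OF const_mem[of a], of f] by (simp add: times_fun_def)

lemma sign_mem: "s = 1 \<or> s = - 1 \<Longrightarrow> s \<in> C"
  using one_mem uminus_mem by auto

lemmas mem = zero_mem one_mem add_mem mult_mem uminus_mem diff_mem scale_mem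

lemma vector_field_mem: "X \<in> VF \<Longrightarrow> X f \<in> C"
  by (cases "f \<in> C") (simp_all add: vector_fields_def zero_mem)

lemma vector_field_add: "X \<in> VF \<Longrightarrow> f \<in> C \<Longrightarrow> g \<in> C \<Longrightarrow> X (f + g) = X f + X g"
  and vector_field_scale: "X \<in> VF \<Longrightarrow> f \<in> C \<Longrightarrow> X (\<lambda>p. a * f p) = (\<lambda>p. a * X f p)"
  and vector_field_mult: "X \<in> VF \<Longrightarrow> f \<in> C \<Longrightarrow> g \<in> C \<Longrightarrow> X (f * g) = X f * g + f * X g"
  and vector_field_off: "X \<in> VF \<Longrightarrow> f \<notin> C \<Longrightarrow> X f = 0"
  by (simp_all add: vector_fields_def)

lemma vector_field_uminus: "X \<in> VF \<Longrightarrow> f \<in> C \<Longrightarrow> X (- f) = - X f"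
  using vector_field_scale[of X f "-1"] by (simp add: fun_Compl_def)

lemma vector_field_zero: "X \<in> VF \<Longrightarrow> X 0 = 0"
  using vector_field_add[of X 0 0] by (simp add: zero_mem)

lemma vector_field_sign: "X \<in> VF \<Longrightarrow> f \<in> C \<Longrightarrow> s = 1 \<or> s = - 1 \<Longrightarrow> X (s * f) = s * X f"
  by (auto simp: vector_field_uminus)

lemma vector_field_const: "X \<in> VF \<Longrightarrow> X (\<lambda>_. a) = 0"
proof -
  assume X: "X \<in> VF"
  have "X 1 = 0"
    using vector_field_mult[OF X one_mem one_mem] by simp
  then show ?thesis
    using vector_field_scale[OF X one_mem, of a] by (simp add: fun_apply zero_fun_def)
qed

lemma vector_fieldI:
  assumes "\<And>f. f \<in> C \<Longrightarrow> X f \<in> C" "\<And>f g. f \<in> C \<Longrightarrow> g \<in> C \<Longrightarrow> X (f + g) = X f + X g"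
    "\<And>a f. f \<in> C \<Longrightarrow> X (\<lambda>p. a * f p) = (\<lambda>p. a * X f p)"
    "\<And>f g. f \<in> C \<Longrightarrow> g \<in> C \<Longrightarrow> X (f * g) = X f * g + f * X g" "\<And>f. f \<notin> C \<Longrightarrow> X f = 0"
  shows "X \<in> VF"
  using assms by (simp add: vector_fields_def)

lemma VF_add: "X \<in> VF \<Longrightarrow> Y \<in> VF \<Longrightarrow> X + Y \<in> VF"
  by (rule vector_fieldI)
     (simp_all add: fun_apply(1) mem vector_field_mem vector_field_add vector_field_scale vector_field_mult
        vector_field_off algebra_simps, simp_all add: fun_eq_iff fun_apply algebra_simps)

lemma VF_smult: "f \<in> C \<Longrightarrow> X \<in> VF \<Longrightarrow> (\<lambda>g. f * X g) \<in> VF"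
  by (rule vector_fieldI)
     (simp_all add: mem vector_field_mem vector_field_add vector_field_scale vector_field_mult
        vector_field_off algebra_simps, simp add: fun_eq_iff fun_apply algebra_simps)

lemma VF_uminus: "X \<in> VF \<Longrightarrow> - X \<in> VF"
proof -
  have "- X = (\<lambda>g. (- 1) * X g)"
    by (simp add: fun_Compl_def[of X])
  then show "X \<in> VF \<Longrightarrow> - X \<in> VF"
    using VF_smult[of "- 1" X] by (simp add: mem)
qed

lemma VF_zero: "0 \<in> VF"
  by (rule vector_fieldI) (simp_all add: fun_apply zero_mem, simp add: fun_eq_iff fun_apply)

lemma VF_lie_bracket:
  assumes X: "X \<in> VF" and Y: "Y \<in> VF"
  shows "lie_bracket X Y \<in> VF"
proof (rule vector_fieldI)
  fix a f assume f: "f \<in> C"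
  show "lie_bracket X Y (\<lambda>p. a * f p) = (\<lambda>p. a * lie_bracket X Y f p)"
    using X Y f by (simp add: lie_bracket_def vector_field_scale vector_field_mem)
      (simp add: fun_eq_iff fun_apply algebra_simps)
qed (use X Y in \<open>simp_all add: lie_bracket_def mem vector_field_mem vector_field_add vector_field_mult
    vector_field_off vector_field_zero algebra_simps\<close>)

abbreviation "alt \<equiv> alternating C"

lemma alternating_upto_zero: "alternating_upto C n 0"
  by (induction n) (simp_all add: contract_linear form_apply(4)[of "[]"] zero_mem fun_times_form_simps)

lemma alternating_zero: "alt 0"
  by (simp add: alternating_def alternating_upto_zero)

lemma alternating_contract: "alt \<omega> \<Longrightarrow> alt (contract X \<omega>)"
  by (cases "X \<in> VF") (simp_all add: alternatingD(2,3) alternating_zero)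

lemma alternating_swap: "alt \<omega> \<Longrightarrow> \<omega> (Y # X # Xs) = - \<omega> (X # Y # Xs)"
  using fun_cong[OF alternatingD(6)[of C \<omega> X Y], of Xs]
  by (simp add: contract_def fun_apply)

lemma alternating_value: "alt \<omega> \<Longrightarrow> \<omega> Xs \<in> C"
proof (induction Xs arbitrary: \<omega>)
  case (Cons X Xs)
  show ?case
    using Cons.IH[OF alternating_contract[OF Cons.prems], of X] by (simp add: contract_def)
qed (rule alternatingD(1))

lemma alternating_off: "alt \<omega> \<Longrightarrow> \<not> set Xs \<subseteq> VF \<Longrightarrow> \<omega> Xs = 0"
proof (induction Xs arbitrary: \<omega>)
  case (Cons X Xs)
  then have "contract X \<omega> Xs = 0"
    using Cons.IH[OF alternating_contract[OF Cons.prems(1)], of X]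
    by (cases "X \<in> VF") (simp_all add: alternatingD(2) form_apply)
  then show ?case by (simp add: contract_def)
qed simp

lemma alternating_add_head:
  "alt \<omega> \<Longrightarrow> X \<in> VF \<Longrightarrow> Y \<in> VF \<Longrightarrow> \<omega> ((X + Y) # Xs) = \<omega> (X # Xs) + \<omega> (Y # Xs)"
  using fun_cong[OF alternatingD(4)[of C \<omega> X Y], of Xs] by (simp add: contract_def fun_apply)

lemma alternating_smult_head:
  "alt \<omega> \<Longrightarrow> X \<in> VF \<Longrightarrow> f \<in> C \<Longrightarrow> \<omega> ((\<lambda>g. f * X g) # Xs) = f * \<omega> (X # Xs)"
  using fun_cong[OF alternatingD(5)[of C \<omega> X f], of Xs] by (simp add: contract_def fun_times_form_def)

lemma alternating_zero_head: "alt \<omega> \<Longrightarrow> \<omega> (0 # Xs) = 0"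
proof -
  have "(\<lambda>g. 0 * 0 g) = (0 :: 'm vfield)"
    by (simp add: fun_eq_iff fun_apply)
  then show "alt \<omega> \<Longrightarrow> \<omega> (0 # Xs) = 0"
    using alternating_smult_head[of \<omega> 0 0 Xs] by (simp add: mem VF_zero)
qed

lemma alternating_sum_head:
  assumes "alt \<omega>" "\<And>i. i \<in> I \<Longrightarrow> X i \<in> VF"
  shows "sum X I \<in> VF \<and> \<omega> (sum X I # Xs) = (\<Sum>i\<in>I. \<omega> (X i # Xs))"
  using assms(2)
  by (induction I rule: infinite_finite_induct)
     (simp_all add: assms(1) VF_zero VF_add alternating_zero_head alternating_add_head)

text \<open>
  A linear combination in one statement, for a single induction; sums, scalings and negatives are the
  special cases \<open>h = 1\<close>, \<open>\<beta> = 0\<close> and \<open>h = -1\<close>.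
\<close>

lemma alternating_upto_linear:
  assumes "alternating_upto C n \<alpha>" "alternating_upto C n \<beta>" "h \<in> C"
  shows "alternating_upto C n (fun_times_form h \<alpha> + \<beta>)"
  using assms(1,2)
proof (induction n arbitrary: \<alpha> \<beta>)
  case (Suc n)
  note A = alternating_uptoD[OF Suc.prems(1)] and B = alternating_uptoD[OF Suc.prems(2)]
  have IP: "contract X (fun_times_form h \<alpha> + \<beta>) =
      fun_times_form h (contract X \<alpha>) + contract X \<beta>" for X
    by (simp add: contract_linear)
  show ?case
    unfolding alternating_upto.simps(2)[of C n] IP
  proof (intro conjI allI impI ballI)
    show "(fun_times_form h \<alpha> + \<beta>) [] \<in> C"
      using A(1) B(1) assms(3) by (simp add: fun_times_form_def fun_apply mem)
    fix X assume "X \<in> VF"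
    then show "alternating_upto C n (fun_times_form h (contract X \<alpha>) + contract X \<beta>)"
      using Suc.IH A(3) B(3) by blast
  next
    fix X assume "X \<notin> VF"
    then show "fun_times_form h (contract X \<alpha>) + contract X \<beta> = 0"
      using A(2) B(2) by (simp add: fun_times_form_def fun_apply fun_eq_iff)
  next
    fix X Y assume "X \<in> VF" "Y \<in> VF"
    then show "fun_times_form h (contract (X + Y) \<alpha>) + contract (X + Y) \<beta> =
      fun_times_form h (contract X \<alpha>) + contract X \<beta> +
      (fun_times_form h (contract Y \<alpha>) + contract Y \<beta>)"
      using A(4) B(4) by (simp add: fun_times_form_def fun_apply fun_eq_iff algebra_simps)
  next
    fix X f assume "X \<in> VF" "f \<in> C"
    then show "fun_times_form h (contract (\<lambda>g. f * X g) \<alpha>) + contract (\<lambda>g. f * X g) \<beta> =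
      fun_times_form f (fun_times_form h (contract X \<alpha>) + contract X \<beta>)"
      using A(5) B(5) by (simp add: fun_times_form_def fun_apply fun_eq_iff algebra_simps)
  next
    fix X Y
    have swap: "contract X (contract Y \<alpha>) = - contract Y (contract X \<alpha>)"
      "contract X (contract Y \<beta>) = - contract Y (contract X \<beta>)"
      by (rule A(6) B(6))+
    show "contract X (fun_times_form h (contract Y \<alpha>) + contract Y \<beta>) =
      - contract Y (fun_times_form h (contract X \<alpha>) + contract X \<beta>)"
      by (simp only: contract_linear swap) (simp add: fun_times_form_def fun_apply fun_eq_iff)
  qed
qed (simp add: fun_times_form_def fun_apply mem assms(3))

lemma alternating_add: "alt \<alpha> \<Longrightarrow> alt \<beta> \<Longrightarrow> alt (\<alpha> + \<beta>)"
  using alternating_upto_linear[of _ \<alpha> \<beta> 1] by (simp add: alternating_def one_mem fun_times_form_simps)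

lemma alternating_fun_times_form: "h \<in> C \<Longrightarrow> alt \<alpha> \<Longrightarrow> alt (fun_times_form h \<alpha>)"
  using alternating_upto_linear[of _ \<alpha> 0 h] by (simp add: alternating_def alternating_upto_zero)

lemma alternating_upto_swedge:
  assumes "alternating_upto C n \<alpha>" "alternating_upto C n \<beta>" "s = 1 \<or> s = - 1"
  shows "alternating_upto C n (swedge s \<alpha> \<beta>)"
  using assms
proof (induction n arbitrary: s \<alpha> \<beta>)
  case (Suc n)
  note A = alternating_uptoD[OF Suc.prems(1)] and B = alternating_uptoD[OF Suc.prems(2)]
  note s = Suc.prems(3)
  show ?case
    unfolding alternating_upto.simps(2)[of C n]
  proof (intro conjI allI impI ballI)
    show "swedge s \<alpha> \<beta> [] \<in> C"
      using A(1) B(1) by (simp add: mult_mem)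
    fix X assume X: "X \<in> VF"
    have "alternating_upto C n (fun_times_form s (swedge s \<alpha> (contract X \<beta>)) +
        swedge (- s) (contract X \<alpha>) \<beta>)"
      using s by (intro alternating_upto_linear Suc.IH A(3) B(3) X Suc.prems(1,2)[THEN alternating_upto_Suc] sign_mem) auto
    then show "alternating_upto C n (contract X (swedge s \<alpha> \<beta>))"
      by (simp add: contract_swedge add.commute)
  next
    fix X assume "X \<notin> VF"
    then show "contract X (swedge s \<alpha> \<beta>) = 0"
      using A(2) B(2) by (simp add: contract_swedge swedge_zero_eq fun_times_form_simps)
  next
    fix X Y assume "X \<in> VF" "Y \<in> VF"
    then show "contract (X + Y) (swedge s \<alpha> \<beta>) =
        contract X (swedge s \<alpha> \<beta>) + contract Y (swedge s \<alpha> \<beta>)"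
      by (simp add: contract_swedge A(4) B(4))
         (simp add: fun_eq_iff fun_apply swedge_linear fun_times_form_def algebra_simps)
  next
    fix X f assume "X \<in> VF" "f \<in> C"
    then show "contract (\<lambda>g. f * X g) (swedge s \<alpha> \<beta>) = fun_times_form f (contract X (swedge s \<alpha> \<beta>))"
      by (simp only: contract_swedge A(5) B(5))
         (rule ext, simp only: form_apply fun_times_form_def[of _ "swedge _ _ _"] swedge_fun_times_form
            fun_times_form_def[of f "_ + _"], simp add: algebra_simps)
  next
    fix X Y
    have swap: "contract X (contract Y \<alpha>) = - contract Y (contract X \<alpha>)"
      "contract X (contract Y \<beta>) = - contract Y (contract X \<beta>)"
      by (rule A(6) B(6))+
    show "contract X (contract Y (swedge s \<alpha> \<beta>)) = - contract Y (contract X (swedge s \<alpha> \<beta>))"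
      by (simp only: contract_swedge contract_linear swap)
         (simp add: fun_eq_iff fun_apply fun_times_form_def swedge_linear algebra_simps)
  qed
qed (simp add: mult_mem)

lemma alternating_swedge: "alt \<alpha> \<Longrightarrow> alt \<beta> \<Longrightarrow> s = 1 \<or> s = - 1 \<Longrightarrow> alt (swedge s \<alpha> \<beta>)"
  by (simp add: alternating_def alternating_upto_swedge)

text \<open>
  The conditions on a form other than the bound on the degree, which is treated separately.
\<close>

definition multilinear_form :: "'m form \<Rightarrow> bool" where
  "multilinear_form \<omega> \<longleftrightarrow> (\<forall>Xs. set Xs \<subseteq> VF \<longrightarrow> \<omega> Xs \<in> C) \<and>
     (\<forall>Xs. \<not> set Xs \<subseteq> VF \<longrightarrow> \<omega> Xs = 0) \<and>
     (\<forall>Xs Ys X Y. set Xs \<union> set Ys \<union> {X, Y} \<subseteq> VF \<longrightarrow>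
        \<omega> (Xs @ (X + Y) # Ys) = \<omega> (Xs @ X # Ys) + \<omega> (Xs @ Y # Ys)) \<and>
     (\<forall>Xs Ys X f. set Xs \<union> set Ys \<union> {X} \<subseteq> VF \<and> f \<in> C \<longrightarrow>
        \<omega> (Xs @ (\<lambda>g. f * X g) # Ys) = f * \<omega> (Xs @ X # Ys)) \<and>
     (\<forall>Xs. \<not> distinct Xs \<longrightarrow> \<omega> Xs = 0)"

lemma forms_iff_multilinear_form:
  "\<omega> \<in> forms C \<longleftrightarrow> multilinear_form \<omega> \<and> (\<exists>N. \<forall>Xs. length Xs > N \<longrightarrow> \<omega> Xs = 0)"
  by (auto simp: forms_def multilinear_form_def)

lemma multilinear_form_contract:
  assumes \<omega>: "multilinear_form \<omega>" and X: "X \<in> VF"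
  shows "multilinear_form (contract X \<omega>)"
proof -
  note M = \<omega>[unfolded multilinear_form_def]
  show ?thesis
    unfolding multilinear_form_def contract_def
  proof (intro conjI allI impI)
    fix Xs Ys Y Z assume "set Xs \<union> set Ys \<union> {Y, Z} \<subseteq> VF"
    then have "set (X # Xs) \<union> set Ys \<union> {Y, Z} \<subseteq> VF"
      using X by simp
    then have "\<omega> ((X # Xs) @ (Y + Z) # Ys) = \<omega> ((X # Xs) @ Y # Ys) + \<omega> ((X # Xs) @ Z # Ys)"
      using M by blast
    then show "\<omega> (X # Xs @ (Y + Z) # Ys) = \<omega> (X # Xs @ Y # Ys) + \<omega> (X # Xs @ Z # Ys)"
      by simp
  next
    fix Xs Ys Y f assume *: "set Xs \<union> set Ys \<union> {Y} \<subseteq> VF \<and> f \<in> C"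
    then have "set (X # Xs) \<union> set Ys \<union> {Y} \<subseteq> VF \<and> f \<in> C"
      using X by simp
    then have "\<omega> ((X # Xs) @ (\<lambda>g. f * Y g) # Ys) = f * \<omega> ((X # Xs) @ Y # Ys)"
      using M by blast
    then show "\<omega> (X # Xs @ (\<lambda>g. f * Y g) # Ys) = f * \<omega> (X # Xs @ Y # Ys)"
      by simp
  next
    fix Xs :: "'m vfield list" assume "\<not> distinct Xs"
    then have "\<not> distinct (X # Xs)" by simp
    then show "\<omega> (X # Xs) = 0" using M by blast
  next
    fix Xs assume "set Xs \<subseteq> VF"
    then have "set (X # Xs) \<subseteq> VF" using X by simp
    then show "\<omega> (X # Xs) \<in> C" using M by blast
  next
    fix Xs assume "\<not> set Xs \<subseteq> VF"
    then have "\<not> set (X # Xs) \<subseteq> VF" by simp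
    then show "\<omega> (X # Xs) = 0" using M by blast
  qed
qed

text \<open>
  Expanding \<open>\<omega>(X + Y, X + Y, \<dots>) = 0\<close> turns vanishing on repeated arguments into antisymmetry.
\<close>

lemma multilinear_form_alternating:
  assumes "multilinear_form \<omega>"
  shows "alt \<omega>"
proof -
  have "alternating_upto C n \<omega>" for n
    using assms
  proof (induction n arbitrary: \<omega>)
    case (Suc n)
    note M = Suc.prems[unfolded multilinear_form_def]
    have off: "\<omega> Xs = 0" if "\<not> set Xs \<subseteq> VF" for Xs
      using M that by blast
    show ?case
      unfolding alternating_upto.simps(2)[of C n]
    proof (intro conjI allI impI ballI)
      show "\<omega> [] \<in> C"
        using M by auto
      fix X assume "X \<in> VF"
      then show "alternating_upto C n (contract X \<omega>)"
        by (intro Suc.IH multilinear_form_contract Suc.prems)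
    next
      fix X assume "X \<notin> VF"
      then show "contract X \<omega> = 0"
        by (auto simp: contract_def fun_eq_iff fun_apply off)
    next
      fix X Y assume XY: "X \<in> VF" "Y \<in> VF"
      have "\<omega> ((X + Y) # Xs) = \<omega> (X # Xs) + \<omega> (Y # Xs)" for Xs
      proof (cases "set Xs \<subseteq> VF")
        case True
        then have "set [] \<union> set Xs \<union> {X, Y} \<subseteq> VF" using XY by simp
        then have "\<omega> ([] @ (X + Y) # Xs) = \<omega> ([] @ X # Xs) + \<omega> ([] @ Y # Xs)"
          using M by blast
        then show ?thesis by simp
      qed (simp add: off)
      then show "contract (X + Y) \<omega> = contract X \<omega> + contract Y \<omega>"
        by (simp add: contract_def fun_eq_iff fun_apply)
    next
      fix X f assume Xf: "X \<in> VF" "f \<in> C"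
      have "\<omega> ((\<lambda>g. f * X g) # Xs) = f * \<omega> (X # Xs)" for Xs
      proof (cases "set Xs \<subseteq> VF")
        case True
        then have "set [] \<union> set Xs \<union> {X} \<subseteq> VF \<and> f \<in> C" using Xf by simp
        then have "\<omega> ([] @ (\<lambda>g. f * X g) # Xs) = f * \<omega> ([] @ X # Xs)"
          using M by blast
        then show ?thesis by simp
      qed (simp add: off)
      then show "contract (\<lambda>g. f * X g) \<omega> = fun_times_form f (contract X \<omega>)"
        by (simp add: contract_def fun_eq_iff fun_times_form_def)
    next
      fix X Y
      have "\<omega> (Y # X # Xs) = - \<omega> (X # Y # Xs)" for Xs
      proof (cases "set (X # Y # Xs) \<subseteq> VF")
        case True
        have add: "\<omega> (Zs @ (X + Y) # Ws) = \<omega> (Zs @ X # Ws) + \<omega> (Zs @ Y # Ws)"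
          if "set Zs \<union> set Ws \<union> {X, Y} \<subseteq> VF" for Zs Ws
          using M that by blast
        have nd: "\<omega> Ws = 0" if "\<not> distinct Ws" for Ws
          using M that by blast
        have "0 = \<omega> ((X + Y) # (X + Y) # Xs)"
          by (rule nd[symmetric]) simp
        also have "\<dots> = \<omega> (X # (X + Y) # Xs) + \<omega> (Y # (X + Y) # Xs)"
          using add[of "[]" "(X + Y) # Xs"] True VF_add by simp
        also have "\<dots> = \<omega> (X # Y # Xs) + \<omega> (Y # X # Xs)"
          using add[of "[X]" Xs] add[of "[Y]" Xs] True by (simp add: nd)
        finally show ?thesis
          by (simp add: eq_neg_iff_add_eq_0 add.commute)
      qed (auto simp: off)
      then show "contract X (contract Y \<omega>) = - contract Y (contract X \<omega>)"
        by (simp add: contract_def fun_eq_iff fun_apply)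
    qed
  qed (use assms in \<open>simp add: multilinear_form_def\<close>)
  then show ?thesis by (simp add: alternating_def)
qed

lemma forms_alternating: "\<omega> \<in> forms C \<Longrightarrow> alt \<omega>"
  by (simp add: forms_iff_multilinear_form multilinear_form_alternating)

lemma alternating_move_to_front:
  assumes "alt \<omega>"
  shows "\<omega> (Ys @ Z # Zs) = (- 1) ^ length Ys * \<omega> (Z # Ys @ Zs)"
  using assms
proof (induction Ys arbitrary: \<omega>)
  case (Cons Y Ys)
  show ?case
    using Cons.IH[OF alternating_contract[OF Cons.prems], of Y] alternating_swap[OF Cons.prems, of Y Z]
    by (simp add: contract_def)
qed simp

text \<open>
  Antisymmetry brings any slot to the front, where linearity is known, and brings two equal arguments next
  to each other; a real function that equals its negative vanishes.
\<close>

lemma alternating_multilinear_form: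
  assumes "alt \<omega>"
  shows "multilinear_form \<omega>"
  unfolding multilinear_form_def
proof (intro conjI allI impI)
  fix Xs Ys X Y assume "set Xs \<union> set Ys \<union> {X, Y} \<subseteq> VF"
  then show "\<omega> (Xs @ (X + Y) # Ys) = \<omega> (Xs @ X # Ys) + \<omega> (Xs @ Y # Ys)"
    by (simp add: alternating_move_to_front[OF assms, of Xs] alternating_add_head[OF assms] algebra_simps)
next
  fix Xs Ys X f assume "set Xs \<union> set Ys \<union> {X} \<subseteq> VF \<and> f \<in> C"
  then show "\<omega> (Xs @ (\<lambda>g. f * X g) # Ys) = f * \<omega> (Xs @ X # Ys)"
    by (simp add: alternating_move_to_front[OF assms, of Xs] alternating_smult_head[OF assms] algebra_simps)
next
  fix Xs :: "'m vfield list" assume "\<not> distinct Xs"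
  then obtain As Bs Cs Z where Xs: "Xs = As @ [Z] @ Bs @ [Z] @ Cs"
    using not_distinct_decomp by blast
  have "\<omega> (Z # Z # Ws) = 0" for Ws
    using alternating_swap[OF assms, of Z Z Ws] by (simp add: fun_eq_iff fun_apply)
  then show "\<omega> Xs = 0"
    using alternating_move_to_front[OF assms, of As Z "Bs @ Z # Cs"]
      alternating_move_to_front[OF assms, of "Z # As @ Bs" Z Cs] alternating_swap[OF assms, of Z Z]
    by (simp add: Xs)
qed (simp_all add: assms alternating_value alternating_off)

lemma alternating_forms:
  "alt \<omega> \<Longrightarrow> (\<And>Xs. length Xs > N \<Longrightarrow> \<omega> Xs = 0) \<Longrightarrow> \<omega> \<in> forms C"
  by (auto simp: forms_iff_multilinear_form alternating_multilinear_form)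

section \<open>Lie derivative and exterior derivative\<close>

lemma lie_derivative_off: "\<not> set Xs \<subseteq> VF \<Longrightarrow> lie_derivative C X \<omega> Xs = 0"
  by (simp add: lie_derivative_def zero_fun_def)

lemma lie_derivative_Nil: "lie_derivative C X \<omega> [] = X (\<omega> [])"
  by (simp add: lie_derivative_def)

text \<open>
  The commutation rule \<open>\<iota>\<^sub>Y L\<^sub>X = L\<^sub>X \<iota>\<^sub>Y - \<iota>\<^bsub>[X,Y]\<^esub>\<close>.
\<close>

lemma lie_derivative_Cons:
  assumes "alt \<omega>" "Y \<in> VF"
  shows "lie_derivative C X \<omega> (Y # Ys) =
    lie_derivative C X (contract Y \<omega>) Ys - \<omega> (lie_bracket X Y # Ys)"
proof (cases "set Ys \<subseteq> VF")
  case True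
  show ?thesis
    using True assms(2)
    by (simp add: fun_eq_iff lie_derivative_def contract_def sum.lessThan_Suc_shift fun_apply
        del: sum.lessThan_Suc)
next
  case False
  then show ?thesis
    by (simp add: lie_derivative_off alternating_off[OF assms(1)])
qed

lemma contract_lie_derivative:
  "alt \<omega> \<Longrightarrow> Y \<in> VF \<Longrightarrow> contract Y (lie_derivative C X \<omega>) =
    lie_derivative C X (contract Y \<omega>) + - contract (lie_bracket X Y) \<omega>"
  by (rule ext) (simp add: contract_def lie_derivative_Cons form_apply)

lemma lie_derivative_mem: "alt \<omega> \<Longrightarrow> X \<in> VF \<Longrightarrow> lie_derivative C X \<omega> Xs \<in> C"
proof (induction Xs arbitrary: \<omega>)
  case (Cons Y Ys)
  then show ?case
    by (cases "Y \<in> VF")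
       (simp_all add: lie_derivative_Cons lie_derivative_off alternating_contract mem alternating_value)
qed (simp add: lie_derivative_Nil vector_field_mem)

lemma lie_derivative_add:
  assumes "alt \<alpha>" "alt \<beta>" "X \<in> VF"
  shows "lie_derivative C X (\<alpha> + \<beta>) Xs = lie_derivative C X \<alpha> Xs + lie_derivative C X \<beta> Xs"
  using assms
  by (simp add: lie_derivative_def fun_eq_iff form_apply vector_field_add alternating_value)
     (simp add: fun_apply sum.distrib)

lemma lie_derivative_sign:
  assumes "alt \<alpha>" "X \<in> VF" "s = 1 \<or> s = - 1"
  shows "lie_derivative C X (fun_times_form s \<alpha>) Xs = s * lie_derivative C X \<alpha> Xs"
  using assms
  by (simp add: lie_derivative_def fun_eq_iff fun_times_form_def vector_field_sign alternating_value)
     (simp add: fun_apply sum_distrib_left algebra_simps)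

lemma lie_derivative_parity:
  assumes "has_parity s \<omega>" "X \<in> VF" "lie_derivative C X \<omega> Xs \<noteq> 0"
  shows "s = (- 1) ^ length Xs"
proof (rule ccontr)
  assume "s \<noteq> (- 1) ^ length Xs"
  then have z: "\<omega> Ys = 0" if "length Ys = length Xs" for Ys
    using assms(1) that by (metis has_parity_def)
  have "lie_derivative C X \<omega> Xs = 0"
    by (rule ext) (simp add: lie_derivative_def z vector_field_zero[OF assms(2)] fun_apply)
  with assms(3) show False by simp
qed

text \<open>
  By induction over the arguments: contraction with \<open>Y\<close> turns the claim into the same claim for the pairs
  \<open>(\<iota>\<^sub>Y \<alpha>, \<beta>)\<close> and \<open>(\<alpha>, \<iota>\<^sub>Y \<beta>)\<close>, up to the terms with \<open>[X,Y]\<close>, which cancel.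
\<close>

lemma lie_derivative_swedge:
  assumes "alt \<alpha>" "alt \<beta>" "X \<in> VF" "s = 1 \<or> s = - 1" "set Xs \<subseteq> VF"
  shows "lie_derivative C X (swedge s \<alpha> \<beta>) Xs =
    swedge s (lie_derivative C X \<alpha>) \<beta> Xs + swedge s \<alpha> (lie_derivative C X \<beta>) Xs"
  using assms
proof (induction Xs arbitrary: s \<alpha> \<beta>)
  case Nil
  then show ?case
    by (simp add: lie_derivative_Nil vector_field_mult alternating_value)
next
  case (Cons Y Ys)
  note p = Cons.prems
  have Y: "Y \<in> VF" "set Ys \<subseteq> VF"
    using p(5) by simp_all
  note ip = alternating_contract
  have sw: "alt (swedge (- s) (contract Y \<alpha>) \<beta>)"
    by (intro alternating_swedge ip p sign_uminus)
  have "lie_derivative C X (swedge s \<alpha> \<beta>) (Y # Ys) =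
      lie_derivative C X (swedge (- s) (contract Y \<alpha>) \<beta> +
        fun_times_form s (swedge s \<alpha> (contract Y \<beta>))) Ys
      - (swedge (- s) (contract (lie_bracket X Y) \<alpha>) \<beta> Ys
         + s * swedge s \<alpha> (contract (lie_bracket X Y) \<beta>) Ys)"
    by (subst lie_derivative_Cons) (simp_all add: p Y alternating_swedge contract_swedge)
  also have "lie_derivative C X (swedge (- s) (contract Y \<alpha>) \<beta> +
        fun_times_form s (swedge s \<alpha> (contract Y \<beta>))) Ys =
      lie_derivative C X (swedge (- s) (contract Y \<alpha>) \<beta>) Ys +
      s * lie_derivative C X (swedge s \<alpha> (contract Y \<beta>)) Ys"
    by (subst lie_derivative_add)
       (simp_all add: p ip sw sign_mem alternating_swedge alternating_fun_times_form lie_derivative_sign)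
  also have "lie_derivative C X (swedge (- s) (contract Y \<alpha>) \<beta>) Ys =
      swedge (- s) (lie_derivative C X (contract Y \<alpha>)) \<beta> Ys +
      swedge (- s) (contract Y \<alpha>) (lie_derivative C X \<beta>) Ys"
    by (rule Cons.IH) (simp_all only: p ip sign_uminus Y)
  also have "lie_derivative C X (swedge s \<alpha> (contract Y \<beta>)) Ys =
      swedge s (lie_derivative C X \<alpha>) (contract Y \<beta>) Ys +
      swedge s \<alpha> (lie_derivative C X (contract Y \<beta>)) Ys"
    by (rule Cons.IH) (simp_all only: p ip Y)
  finally show ?case
    by (simp only: swedge.simps contract_lie_derivative p Y swedge_linear) (simp add: algebra_simps)
qed

lemma alternating_list_update:
  assumes "alt \<omega>" "k < length Xs"
  shows "\<omega> (Xs[k := Z]) = (- 1) ^ k * \<omega> (Z # nths Xs (- {k}))"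
  using alternating_move_to_front[OF assms(1), of "take k Xs" Z "drop (Suc k) Xs"] assms(2)
  by (simp add: upd_conv_take_nth_drop nths_delete)

lemma ext_d_off: "\<not> set Xs \<subseteq> VF \<Longrightarrow> ext_d C \<omega> Xs = 0"
  by (simp add: ext_d_def zero_fun_def)

lemma ext_d_Nil: "ext_d C \<omega> [] = 0"
  by (simp add: ext_d_def zero_fun_def)

text \<open>
  Cartan's formula \<open>\<iota>\<^sub>X d = L\<^sub>X - d \<iota>\<^sub>X\<close>, read as a recursion for \<open>d\<close>.  Among the terms of \<open>d\<omega>(X, Xs)\<close>,
  those in which \<open>X\<close> differentiates or enters a Lie bracket make up \<open>L\<^sub>X \<omega>\<close> once the bracket is moved back
  to its slot; the others make up \<open>- d(\<iota>\<^sub>X \<omega>)\<close>.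
\<close>

lemma ext_d_Cons:
  assumes "alt \<omega>" "X \<in> VF"
  shows "ext_d C \<omega> (X # Xs) = lie_derivative C X \<omega> Xs - ext_d C (contract X \<omega>) Xs"
proof (cases "set Xs \<subseteq> VF")
  case True
  let ?n = "length Xs"
  have upd: "(\<Sum>k<?n. \<omega> (Xs[k := lie_bracket X (Xs ! k)]) p) =
      (\<Sum>k<?n. (- 1) ^ k * \<omega> (lie_bracket X (Xs ! k) # nths Xs (- {k})) p)" for p
    by (rule sum.cong) (simp_all add: alternating_list_update assms fun_apply minus_one_power_apply)
  have swap: "\<omega> (Y # X # Ys) p = - contract X \<omega> (Y # Ys) p" for Y Ys p
    using alternating_swap[OF assms(1), of Y X Ys] by (simp add: contract_def fun_apply)
  have "ext_d C \<omega> (X # Xs) p = (lie_derivative C X \<omega> Xs - ext_d C (contract X \<omega>) Xs) p" for p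
  proof -
    have "ext_d C \<omega> (X # Xs) p =
       (X (\<omega> Xs) p + (\<Sum>i<?n. - ((- 1) ^ i * (Xs ! i) (contract X \<omega> (nths Xs (- {i}))) p)))
       + (\<Sum>j<?n. - ((- 1) ^ j * \<omega> (lie_bracket X (Xs ! j) # nths Xs (- {j})) p)
          + (\<Sum>i<j. - ((- 1) ^ (i + j) * contract X \<omega> (lie_bracket (Xs ! i) (Xs ! j) # nths Xs (- {i, j})) p)))"
      using True assms(2)
      by (simp add: ext_d_def sum.lessThan_Suc_shift nths_Cons_delete swap
          del: sum.lessThan_Suc Compl_insert) (simp add: contract_def)
    also have "\<dots> = (lie_derivative C X \<omega> Xs - ext_d C (contract X \<omega>) Xs) p"
      using True by (simp add: fun_apply lie_derivative_def ext_d_def upd sum.distrib sum_negf sum_subtractf)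
    finally show ?thesis .
  qed
  then show ?thesis by blast
qed (simp add: ext_d_off lie_derivative_off)

lemma contract_ext_d:
  "alt \<omega> \<Longrightarrow> X \<in> VF \<Longrightarrow>
   contract X (ext_d C \<omega>) = lie_derivative C X \<omega> + - ext_d C (contract X \<omega>)"
  by (rule ext) (simp add: contract_def[of X "ext_d C \<omega>"] ext_d_Cons form_apply)

lemma ext_d_mem: "alt \<omega> \<Longrightarrow> ext_d C \<omega> Xs \<in> C"
proof (induction Xs arbitrary: \<omega>)
  case (Cons Y Ys)
  then show ?case
    by (cases "Y \<in> VF")
       (simp_all add: ext_d_Cons ext_d_off alternating_contract mem lie_derivative_mem)
qed (simp add: ext_d_Nil mem)

lemma ext_d_add:
  "alt \<alpha> \<Longrightarrow> alt \<beta> \<Longrightarrow> ext_d C (\<alpha> + \<beta>) Xs = ext_d C \<alpha> Xs + ext_d C \<beta> Xs"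
proof (induction Xs arbitrary: \<alpha> \<beta>)
  case (Cons Y Ys)
  show ?case
  proof (cases "Y \<in> VF")
    case True
    then show ?thesis
      using Cons.prems
      by (simp add: ext_d_Cons alternating_add lie_derivative_add contract_linear Cons.IH
          alternating_contract algebra_simps)
  qed (simp add: ext_d_off)
qed (simp add: ext_d_Nil)

lemma ext_d_sign:
  "alt \<alpha> \<Longrightarrow> s = 1 \<or> s = - 1 \<Longrightarrow> ext_d C (fun_times_form s \<alpha>) Xs = s * ext_d C \<alpha> Xs"
proof (induction Xs arbitrary: \<alpha>)
  case (Cons Y Ys)
  show ?case
  proof (cases "Y \<in> VF")
    case True
    have "ext_d C (fun_times_form s \<alpha>) (Y # Ys) = lie_derivative C Y (fun_times_form s \<alpha>) Ys -
        ext_d C (fun_times_form s (contract Y \<alpha>)) Ys"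
      using Cons.prems True
      by (simp only: ext_d_Cons alternating_fun_times_form sign_mem contract_linear)
    also have "\<dots> = s * lie_derivative C Y \<alpha> Ys - s * ext_d C (contract Y \<alpha>) Ys"
      using Cons.prems True
      by (simp only: lie_derivative_sign Cons.IH alternating_contract)
    also have "\<dots> = s * ext_d C \<alpha> (Y # Ys)"
      using Cons.prems True by (simp only: ext_d_Cons algebra_simps)
    finally show ?thesis .
  qed (simp add: ext_d_off)
qed (simp add: ext_d_Nil)

lemma ext_d_uminus: "alt \<alpha> \<Longrightarrow> ext_d C (- \<alpha>) Xs = - ext_d C \<alpha> Xs"
  using ext_d_sign[of \<alpha> "- 1" Xs] by (simp add: fun_times_form_simps)

lemma ext_d_zero: "ext_d C 0 = 0"
  using ext_d_add[of 0 0] by (intro ext[of "ext_d C 0"]) (simp add: alternating_zero form_apply(4))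

lemma has_parity_ext_d:
  assumes "alt \<omega>" "has_parity s \<omega>"
  shows "has_parity (- s) (ext_d C \<omega>)"
proof -
  have "- s = (- 1) ^ length Xs" if "ext_d C \<omega> Xs \<noteq> 0" for Xs
    using that assms
  proof (induction Xs arbitrary: \<omega> s)
    case Nil
    then show ?case by (simp add: ext_d_Nil)
  next
    case (Cons X Xs)
    have X: "X \<in> VF"
      using Cons.prems(1) ext_d_off[of "X # Xs"] by auto
    have "lie_derivative C X \<omega> Xs \<noteq> 0 \<or> ext_d C (contract X \<omega>) Xs \<noteq> 0"
      using Cons.prems X by (auto simp: ext_d_Cons)
    then show ?case
    proof
      assume "lie_derivative C X \<omega> Xs \<noteq> 0"
      then show ?thesis
        using lie_derivative_parity Cons.prems(3) X by fastforce
    next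
      assume "ext_d C (contract X \<omega>) Xs \<noteq> 0"
      then show ?thesis
        using Cons.IH[of "contract X \<omega>" "- s"] Cons.prems
        by (simp add: alternating_contract has_parity_contract)
    qed
  qed
  then show ?thesis by (simp add: has_parity_def)
qed

text \<open>
  The Leibniz rule of \<open>d\<close> follows from those of \<open>L\<^sub>X\<close> and \<open>\<iota>\<^sub>X\<close> through Cartan's formula.
\<close>

lemma ext_d_swedge:
  assumes "alt \<alpha>" "alt \<beta>" "s = 1 \<or> s = - 1" "set Xs \<subseteq> VF"
  shows "ext_d C (swedge s \<alpha> \<beta>) Xs =
    swedge (- s) (ext_d C \<alpha>) \<beta> Xs + s * swedge s \<alpha> (ext_d C \<beta>) Xs"
  using assms
proof (induction Xs arbitrary: s \<alpha> \<beta>)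
  case Nil
  then show ?case
    by (simp add: ext_d_Nil)
next
  case (Cons Y Ys)
  note p = Cons.prems
  have Y: "Y \<in> VF" "set Ys \<subseteq> VF"
    using p(4) by simp_all
  note ip = alternating_contract
  have sw: "alt (swedge (- s) (contract Y \<alpha>) \<beta>)"
    by (intro alternating_swedge ip p sign_uminus)
  have ss: "s * (s * f) = f" for f
    using p(3) by auto
  have "ext_d C (swedge s \<alpha> \<beta>) (Y # Ys) =
      (swedge s (lie_derivative C Y \<alpha>) \<beta> Ys + swedge s \<alpha> (lie_derivative C Y \<beta>) Ys) -
      ext_d C (swedge (- s) (contract Y \<alpha>) \<beta> + fun_times_form s (swedge s \<alpha> (contract Y \<beta>))) Ys"
    by (subst ext_d_Cons) (simp_all add: p Y alternating_swedge lie_derivative_swedge contract_swedge)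
  also have "ext_d C (swedge (- s) (contract Y \<alpha>) \<beta> + fun_times_form s (swedge s \<alpha> (contract Y \<beta>))) Ys =
      ext_d C (swedge (- s) (contract Y \<alpha>) \<beta>) Ys + s * ext_d C (swedge s \<alpha> (contract Y \<beta>)) Ys"
    by (subst ext_d_add)
       (simp_all add: p ip sw sign_mem alternating_swedge alternating_fun_times_form ext_d_sign)
  also have "ext_d C (swedge (- s) (contract Y \<alpha>) \<beta>) Ys =
      swedge (- (- s)) (ext_d C (contract Y \<alpha>)) \<beta> Ys +
      (- s) * swedge (- s) (contract Y \<alpha>) (ext_d C \<beta>) Ys"
    by (rule Cons.IH) (simp_all only: p ip sign_uminus Y)
  also have "ext_d C (swedge s \<alpha> (contract Y \<beta>)) Ys =
      swedge (- s) (ext_d C \<alpha>) (contract Y \<beta>) Ys +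
      s * swedge s \<alpha> (ext_d C (contract Y \<beta>)) Ys"
    by (rule Cons.IH) (simp_all only: p ip Y)
  finally show ?case
    by (simp only: swedge.simps contract_ext_d p Y swedge_linear) (simp add: ss algebra_simps)
qed

section \<open>Functions, differentials and homogeneous parts\<close>

abbreviation differential :: "('m \<Rightarrow> real) \<Rightarrow> 'm form" where
  "differential f \<equiv> ext_d C (zero_form f)"

lemma forms_degD:
  "\<omega> \<in> forms_deg C k \<Longrightarrow> alt \<omega>" "\<omega> \<in> forms_deg C k \<Longrightarrow> length Xs \<noteq> k \<Longrightarrow> \<omega> Xs = 0"
  "\<omega> \<in> forms_deg C k \<Longrightarrow> \<omega> \<in> forms C"
  by (auto simp: forms_deg_def forms_alternating)

lemma forms_degI: "alt \<omega> \<Longrightarrow> (\<And>Xs. length Xs \<noteq> k \<Longrightarrow> \<omega> Xs = 0) \<Longrightarrow> \<omega> \<in> forms_deg C k"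
  using alternating_forms[of \<omega> k] by (auto simp: forms_deg_def)

lemma forms_deg_zero: "0 \<in> forms_deg C k"
  by (rule forms_degI) (simp_all add: alternating_zero form_apply(4))

lemma forms_deg_add: "\<omega> \<in> forms_deg C k \<Longrightarrow> \<eta> \<in> forms_deg C k \<Longrightarrow> \<omega> + \<eta> \<in> forms_deg C k"
  by (rule forms_degI) (simp_all add: alternating_add form_apply forms_degD)

lemma forms_deg_fun_times_form: "f \<in> C \<Longrightarrow> \<omega> \<in> forms_deg C k \<Longrightarrow> fun_times_form f \<omega> \<in> forms_deg C k"
  by (rule forms_degI) (simp_all add: alternating_fun_times_form forms_degD, simp add: fun_times_form_def forms_degD)

lemma forms_deg_sum: "(\<And>i. i \<in> I \<Longrightarrow> F i \<in> forms_deg C k) \<Longrightarrow> sum F I \<in> forms_deg C k"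
  by (induction I rule: infinite_finite_induct) (simp_all add: forms_deg_zero forms_deg_add)

lemma forms_deg_contract: "\<omega> \<in> forms_deg C (Suc k) \<Longrightarrow> contract X \<omega> \<in> forms_deg C k"
  by (rule forms_degI) (simp_all add: alternating_contract forms_degD contract_apply)

lemma alternating_zero_form: "f \<in> C \<Longrightarrow> alt (zero_form f)"
proof -
  assume f: "f \<in> C"
  have "alternating_upto C n (zero_form f)" for n
    by (cases n) (simp_all add: contract_zero_form contract_linear fun_times_form_simps
        alternating_upto_zero f, simp_all add: zero_form_def f)
  then show ?thesis by (simp add: alternating_def)
qed

lemma forms_deg_zero_form: "f \<in> C \<Longrightarrow> zero_form f \<in> forms_deg C 0"
  by (rule forms_degI) (simp_all add: alternating_zero_form, simp add: zero_form_def)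

lemma forms_deg_0_eq: "\<omega> \<in> forms_deg C 0 \<Longrightarrow> \<omega> = zero_form (\<omega> []) \<and> \<omega> [] \<in> C"
  using alternating_value[OF forms_degD(1), of \<omega> 0 "[]"]
  by (auto simp: zero_form_def forms_deg_def)

lemma lie_derivative_zero: "X \<in> VF \<Longrightarrow> lie_derivative C X 0 = 0"
  using lie_derivative_add[of 0 0 X]
  by (intro ext[of "lie_derivative C X 0"]) (simp add: alternating_zero form_apply(4))

lemma lie_derivative_zero_form:
  assumes "f \<in> C" "X \<in> VF"
  shows "lie_derivative C X (zero_form f) = zero_form (X f)"
proof
  fix Xs show "lie_derivative C X (zero_form f) Xs = zero_form (X f) Xs"
  proof (cases Xs)
    case Nil
    then show ?thesis by (simp add: lie_derivative_Nil zero_form_def)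
  next
    case (Cons Y Ys)
    show ?thesis
    proof (cases "Y \<in> VF")
      case True
      then show ?thesis
        using assms Cons
        by (simp add: lie_derivative_Cons alternating_zero_form contract_zero_form lie_derivative_zero
            form_apply(4)[of Ys]) (simp add: zero_form_def)
    next
      case False
      then show ?thesis
        using Cons by (simp add: lie_derivative_off) (simp add: zero_form_def)
    qed
  qed
qed

lemma contract_differential:
  assumes "f \<in> C"
  shows "contract X (differential f) = (if X \<in> VF then zero_form (X f) else 0)"
proof (cases "X \<in> VF")
  case True
  then show ?thesis
    using assms
    by (simp add: contract_ext_d alternating_zero_form lie_derivative_zero_form
        contract_zero_form ext_d_zero)
next
  case False
  then show ?thesis
    by (simp add: fun_eq_iff[of _ "0 :: 'm form"] form_apply(4) contract_def ext_d_off)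
qed

lemma differential_apply:
  assumes "f \<in> C"
  shows "differential f Xs = (case Xs of [X] \<Rightarrow> if X \<in> VF then X f else 0 | _ \<Rightarrow> 0)"
proof (cases Xs)
  case (Cons X Ys)
  have "differential f (X # Ys) = contract X (differential f) Ys"
    by (simp add: contract_apply)
  also have "\<dots> = (if X \<in> VF then zero_form (X f) Ys else 0)"
    by (simp add: contract_differential[OF assms] form_apply(4)[of Ys])
  finally show ?thesis
    using Cons by (auto simp: zero_form_def split: list.split)
qed (simp add: ext_d_Nil)

lemma zero_form_linear:
  "zero_form (f + g) = zero_form f + zero_form g" "zero_form (f * g) = fun_times_form f (zero_form g)"
  by (simp_all add: fun_eq_iff zero_form_def fun_times_form_def fun_apply)

lemma alternating_differential:
  assumes "f \<in> C"
  shows "alt (differential f)"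
proof -
  have "alternating_upto C n (differential f)" for n
  proof (cases n)
    case (Suc m)
    have z: "alternating_upto C m (zero_form g)" if "g \<in> C" for g
      using alternating_zero_form[OF that] by (simp add: alternating_def)
    show ?thesis
      using assms unfolding Suc alternating_upto.simps(2)[of C m]
      by (simp add: ext_d_mem alternating_zero_form contract_differential vector_field_mem VF_add VF_smult
          zero_form_linear[symmetric] fun_apply(1) z) (simp add: contract_zero_form contract_linear)
  qed (simp add: assms ext_d_mem alternating_zero_form)
  then show ?thesis by (simp add: alternating_def)
qed

lemma forms_deg_differential: "f \<in> C \<Longrightarrow> differential f \<in> forms_deg C 1"
  by (rule forms_degI) (auto simp: alternating_differential differential_apply split: list.split)

text \<open>
  With Cartan's formula this is \<open>L\<^sub>X df = d(X f)\<close>, which in turn is the definition of \<open>[X,Y]\<close>.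
\<close>

lemma ext_d_differential:
  assumes f: "f \<in> C"
  shows "ext_d C (differential f) = 0"
proof -
  have L: "lie_derivative C X (differential f) = differential (X f)" if X: "X \<in> VF" for X
  proof
    fix Xs show "lie_derivative C X (differential f) Xs = differential (X f) Xs"
    proof (cases Xs)
      case Nil
      then show ?thesis by (simp add: lie_derivative_Nil ext_d_Nil vector_field_zero X)
    next
      case (Cons Y Ys)
      show ?thesis
      proof (cases "Y \<in> VF")
        case True
        have "lie_derivative C X (differential f) (Y # Ys) =
            zero_form (X (Y f)) Ys - zero_form (lie_bracket X Y f) Ys"
          using X f True
          by (simp add: contract_lie_derivative alternating_differential contract_differential
              lie_derivative_zero_form vector_field_mem VF_lie_bracket form_apply(1,2,3) flip: contract_apply)
        also have "\<dots> = differential (X f) (Y # Ys)"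
          using X f True
          by (simp add: contract_differential vector_field_mem flip: contract_apply)
             (simp add: zero_form_def lie_bracket_def)
        finally show ?thesis using Cons by simp
      qed (simp add: Cons lie_derivative_off ext_d_off)
    qed
  qed
  show ?thesis
  proof
    fix Xs show "ext_d C (differential f) Xs = 0 Xs"
    proof (cases Xs)
      case (Cons X Ys)
      show ?thesis
      proof (cases "X \<in> VF")
        case True
        then show ?thesis
          using f Cons by (simp add: ext_d_Cons alternating_differential contract_differential L form_apply(4))
      qed (simp add: Cons ext_d_off form_apply(4))
    qed (simp add: ext_d_Nil form_apply(4))
  qed
qed

lemma multilinear_form_homogeneous_part:
  assumes "multilinear_form \<omega>"
  shows "multilinear_form (homogeneous_part k \<omega>)"
proof -
  note M = assms
  have add: "\<omega> (Xs @ (X + Y) # Ys) = \<omega> (Xs @ X # Ys) + \<omega> (Xs @ Y # Ys)"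
    if "set Xs \<union> set Ys \<union> {X, Y} \<subseteq> VF" for Xs Ys X Y
    using M that unfolding multilinear_form_def by blast
  have smult: "\<omega> (Xs @ (\<lambda>g. f * X g) # Ys) = f * \<omega> (Xs @ X # Ys)"
    if "set Xs \<union> set Ys \<union> {X} \<subseteq> VF \<and> f \<in> C" for Xs Ys X f
    using M that unfolding multilinear_form_def by blast
  have other: "set Xs \<subseteq> VF \<Longrightarrow> \<omega> Xs \<in> C" "\<not> set Xs \<subseteq> VF \<Longrightarrow> \<omega> Xs = 0"
    "\<not> distinct Xs \<Longrightarrow> \<omega> Xs = 0" for Xs
    using M unfolding multilinear_form_def by blast+
  show ?thesis
    unfolding multilinear_form_def
  proof (intro conjI allI impI)
    fix Xs Ys X Y assume "set Xs \<union> set Ys \<union> {X, Y} \<subseteq> VF"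
    note add[OF this]
    then show "homogeneous_part k \<omega> (Xs @ (X + Y) # Ys) =
        homogeneous_part k \<omega> (Xs @ X # Ys) + homogeneous_part k \<omega> (Xs @ Y # Ys)"
      by (simp only: homogeneous_part_def length_append length_Cons split: if_splits) simp
  next
    fix Xs Ys X f assume "set Xs \<union> set Ys \<union> {X} \<subseteq> VF \<and> f \<in> C"
    note smult[OF this]
    then show "homogeneous_part k \<omega> (Xs @ (\<lambda>g. f * X g) # Ys) = f * homogeneous_part k \<omega> (Xs @ X # Ys)"
      by (simp only: homogeneous_part_def length_append length_Cons split: if_splits) simp
  qed (simp_all add: homogeneous_part_def other zero_mem)
qed

lemma forms_deg_homogeneous_part: "alt \<omega> \<Longrightarrow> homogeneous_part k \<omega> \<in> forms_deg C k"
  by (rule forms_degI[OF multilinear_form_alternating[OF multilinear_form_homogeneous_part[OF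
          alternating_multilinear_form]]]) (simp_all add: homogeneous_part_def)

lemma lie_derivative_homogeneous_part:
  "X \<in> VF \<Longrightarrow> lie_derivative C X (homogeneous_part k \<omega>) Xs = (if length Xs = k then lie_derivative C X \<omega> Xs else 0)"
  by (auto simp: lie_derivative_def homogeneous_part_def vector_field_zero fun_eq_iff fun_apply)

lemma ext_d_homogeneous_part:
  "alt \<omega> \<Longrightarrow> ext_d C (homogeneous_part k \<omega>) Xs = (if length Xs = Suc k then ext_d C \<omega> Xs else 0)"
proof (induction Xs arbitrary: \<omega> k)
  case (Cons X Xs)
  show ?case
  proof (cases "X \<in> VF")
    case True
    have "ext_d C (contract X (homogeneous_part k \<omega>)) Xs =
        (if length Xs = k then ext_d C (contract X \<omega>) Xs else 0)"
      using Cons.IH[OF alternating_contract[OF Cons.prems], of "k - 1" X]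
      by (cases k) (auto simp: contract_homogeneous_part ext_d_zero form_apply(4)[of Xs] ext_d_Nil)
    then show ?thesis
      using Cons.prems True
      by (simp add: ext_d_Cons forms_degD(1)[OF forms_deg_homogeneous_part] lie_derivative_homogeneous_part)
  qed (simp add: ext_d_off)
qed (simp add: ext_d_Nil)

lemma exact_form_add: "exact_form C \<alpha> \<Longrightarrow> exact_form C \<beta> \<Longrightarrow> exact_form C (\<alpha> + \<beta>)"
proof -
  assume "exact_form C \<alpha>" "exact_form C \<beta>"
  then obtain \<alpha>' \<beta>' where ab: "\<alpha>' \<in> forms C" "\<beta>' \<in> forms C" "\<alpha> = ext_d C \<alpha>'" "\<beta> = ext_d C \<beta>'"
    by (auto simp: exact_form_def)
  then obtain M N where MN: "\<And>Xs. length Xs > M \<Longrightarrow> \<alpha>' Xs = 0" "\<And>Xs. length Xs > N \<Longrightarrow> \<beta>' Xs = 0"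
    unfolding forms_iff_multilinear_form by blast
  have "\<alpha>' + \<beta>' \<in> forms C"
    by (rule alternating_forms[of _ "max M N"])
       (simp_all add: ab forms_alternating alternating_add form_apply(1) MN)
  moreover have "\<alpha> + \<beta> = ext_d C (\<alpha>' + \<beta>')"
    by (rule ext) (simp add: ab ext_d_add forms_alternating form_apply(1))
  ultimately show ?thesis by (auto simp: exact_form_def)
qed

lemma exact_form_zero: "exact_form C 0"
proof -
  have "0 \<in> forms C"
    using forms_deg_zero forms_degD(3) by blast
  then show ?thesis
    using ext_d_zero by (metis exact_form_def)
qed

text \<open>
  The bracket rules speak about homogeneous forms.  The exterior derivative is homogeneous of degree 1, so
  the homogeneous parts of a closed form are closed.
\<close>

lemma closed_form_decompose:
  assumes "closed_form C \<omega>"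
  obtains N where "\<omega> = (\<Sum>k<(N::nat). homogeneous_part k \<omega>)"
    and "\<And>k. homogeneous_part k \<omega> \<in> forms_deg C k" "\<And>k. ext_d C (homogeneous_part k \<omega>) = 0"
proof -
  have \<omega>: "\<omega> \<in> forms C" "ext_d C \<omega> = 0"
    using assms by (auto simp: closed_form_def)
  then obtain N where N: "\<And>Xs. length Xs > N \<Longrightarrow> \<omega> Xs = 0"
    unfolding forms_iff_multilinear_form by blast
  have "\<omega> Xs = (\<Sum>k<Suc N. homogeneous_part k \<omega> Xs)" for Xs
    using N[of Xs] by (simp add: homogeneous_part_def sum.delta' del: sum.lessThan_Suc)
  then have 1: "\<omega> = (\<Sum>k<Suc N. homogeneous_part k \<omega>)"
    by (intro ext[of \<omega>]) (simp only: sum_form_apply)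
  have 2: "homogeneous_part k \<omega> \<in> forms_deg C k" for k
    by (rule forms_deg_homogeneous_part[OF forms_alternating[OF \<omega>(1)]])
  have "ext_d C (homogeneous_part k \<omega>) Xs = 0" for k Xs
    by (simp add: ext_d_homogeneous_part forms_alternating \<omega> form_apply(4)[of Xs])
  then have 3: "ext_d C (homogeneous_part k \<omega>) = 0" for k
    by (intro ext[of "ext_d C (homogeneous_part k \<omega>)"]) (simp only: form_apply(4))
  show ?thesis
    using that[OF 1 2 3] .
qed

lemma forms_sum: "(\<And>i. i \<in> I \<Longrightarrow> F i \<in> forms_deg C (k i)) \<Longrightarrow> finite I \<Longrightarrow> sum F I \<in> forms C"
proof -
  assume F: "\<And>i. i \<in> I \<Longrightarrow> F i \<in> forms_deg C (k i)" and "finite I"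
  have "alt (sum F I)"
    using F by (induction I rule: infinite_finite_induct)
      (simp_all add: alternating_zero, metis alternating_add forms_degD(1))
  moreover have "sum F I Xs = 0" if "length Xs > Max (insert 0 (k ` I))" for Xs
  proof -
    have "F i Xs = 0" if "i \<in> I" for i
    proof (rule forms_degD(2)[OF F[OF that]])
      have "k i \<le> Max (insert 0 (k ` I))"
        using \<open>finite I\<close> that by (intro Max_ge) auto
      then show "length Xs \<noteq> k i"
        using \<open>length Xs > _\<close> by linarith
    qed
    then show ?thesis by (simp add: sum_form_apply)
  qed
  ultimately show ?thesis by (rule alternating_forms)
qed

end

section \<open>Derivations of forms and local frames\<close>

text \<open>
  What a chart contributes to the proof.  On the set where \<open>\<rho>\<close> does not vanish the differentials \<open>dx\<^sub>i\<close> span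
  the 1-forms, with coefficients obtained by evaluation on the \<open>E\<^sub>i\<close>.  The factor \<open>\<rho>\<close> allows the \<open>x\<^sub>i\<close> and
  \<open>E\<^sub>i\<close> to be defined globally, and the \<open>x\<^sub>i\<close> need not be independent.
\<close>

locale framed_function_algebra = function_algebra C for C :: "('m \<Rightarrow> real) set" +
  assumes frame: "\<exists>\<rho>\<in>C. \<rho> p \<noteq> 0 \<and> (\<exists>N x E. (\<forall>i<N. x i \<in> C \<and> E i \<in> vector_fields C) \<and>
    (\<forall>X\<in>vector_fields C. \<forall>f\<in>C. \<rho> * X f = (\<Sum>i<(N::nat). X (x i) * E i f)))"
begin

lemma frame_expansion:
  assumes \<rho>: "\<rho> \<in> C" and xE: "\<And>i. i < N \<Longrightarrow> x i \<in> C \<and> E i \<in> VF"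
    and fr: "\<And>X f. X \<in> VF \<Longrightarrow> f \<in> C \<Longrightarrow> \<rho> * X f = (\<Sum>i<(N::nat). X (x i) * E i f)"
    and \<omega>: "alt \<omega>" and X: "X \<in> VF"
  shows "\<rho> * \<omega> (X # Xs) = (\<Sum>i<N. X (x i) * \<omega> (E i # Xs))"
proof -
  have "(\<lambda>f. \<rho> * X f) = (\<Sum>i<N. (\<lambda>f. X (x i) * E i f))"
  proof
    fix f show "\<rho> * X f = (\<Sum>i<N. (\<lambda>f. X (x i) * E i f)) f"
      using fr[OF X] X xE by (cases "f \<in> C") (simp_all add: sum_vfield_apply vector_field_off)
  qed
  moreover have "\<omega> ((\<Sum>i<N. (\<lambda>f. X (x i) * E i f)) # Xs) = (\<Sum>i<N. \<omega> ((\<lambda>f. X (x i) * E i f) # Xs))"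
    using alternating_sum_head[OF \<omega>, of "{..<N}" "\<lambda>i f. X (x i) * E i f" Xs] xE X
    by (simp add: VF_smult vector_field_mem)
  ultimately show ?thesis
    using alternating_smult_head[OF \<omega> X \<rho>, of Xs] alternating_smult_head[OF \<omega> _ vector_field_mem[OF X]] xE
    by simp
qed

text \<open>
  \<open>\<Sum>\<^sub>i dx\<^sub>i \<and> \<iota>\<^bsub>E\<^sub>i\<^esub>\<close> is the derivation that acts on 1-forms as multiplication by \<open>\<rho>\<close>.  It counts the
  degree of a form, like the Euler operator on polynomials.
\<close>

lemma frame_Euler:
  assumes \<rho>: "\<rho> \<in> C" and xE: "\<And>i. i < N \<Longrightarrow> x i \<in> C \<and> E i \<in> VF"
    and fr: "\<And>X f. X \<in> VF \<Longrightarrow> f \<in> C \<Longrightarrow> \<rho> * X f = (\<Sum>i<(N::nat). X (x i) * E i f)"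
    and \<omega>: "alt \<omega>" and Xs: "set Xs \<subseteq> VF"
  shows "(\<Sum>i<N. swedge (- 1) (differential (x i)) (contract (E i) \<omega>) Xs) = of_nat (length Xs) * \<rho> * \<omega> Xs"
  using \<omega> Xs
proof (induction Xs arbitrary: \<omega>)
  case Nil
  then show ?case by (simp add: ext_d_Nil)
next
  case (Cons X Xs)
  then have X: "X \<in> VF" "set Xs \<subseteq> VF" by simp_all
  have "(\<Sum>i<N. swedge (- 1) (differential (x i)) (contract (E i) \<omega>) (X # Xs)) =
      (\<Sum>i<N. X (x i) * \<omega> (E i # Xs) +
        swedge (- 1) (differential (x i)) (contract (E i) (contract X \<omega>)) Xs)"
  proof (rule sum.cong)
    fix i assume "i \<in> {..<N}"
    then show "swedge (- 1) (differential (x i)) (contract (E i) \<omega>) (X # Xs) =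
        X (x i) * \<omega> (E i # Xs) + swedge (- 1) (differential (x i)) (contract (E i) (contract X \<omega>)) Xs"
      using xE[of i] X alternatingD(6)[OF Cons.prems(1), of X "E i"]
      by (simp add: contract_differential swedge_zero_form swedge_linear)
         (simp add: fun_times_form_def contract_apply)
  qed simp
  also have "\<dots> = \<rho> * \<omega> (X # Xs) + of_nat (length Xs) * \<rho> * \<omega> (X # Xs)"
    using Cons.IH[OF alternating_contract[OF Cons.prems(1)] X(2), of X]
      frame_expansion[OF \<rho> xE fr Cons.prems(1) X(1), of Xs]
    by (simp add: sum.distrib contract_apply[of X \<omega> Xs] del: of_nat_fun_apply)
  finally show ?case
    by (simp add: algebra_simps)
qed

text \<open>
  A graded derivation of parity \<open>c\<close>, with the Leibniz rule required only for those left factors that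
  generate the algebra locally: functions and differentials of functions.
\<close>

definition derivation_like :: "('m \<Rightarrow> real) \<Rightarrow> ('m form \<Rightarrow> 'm form) \<Rightarrow> bool" where
  "derivation_like c D \<longleftrightarrow>
     (\<forall>k. \<forall>\<omega>\<in>forms_deg C k. \<forall>\<eta>\<in>forms_deg C k. \<forall>Xs. set Xs \<subseteq> VF \<longrightarrow> D (\<omega> + \<eta>) Xs = D \<omega> Xs + D \<eta> Xs) \<and>
     (\<forall>k. \<forall>\<omega>\<in>forms_deg C k. \<forall>f\<in>C. \<forall>Xs. set Xs \<subseteq> VF \<longrightarrow>
        D (fun_times_form f \<omega>) Xs = swedge c (D (zero_form f)) \<omega> Xs + f * D \<omega> Xs) \<and>
     (\<forall>k. \<forall>\<omega>\<in>forms_deg C k. \<forall>f\<in>C. \<forall>Xs. set Xs \<subseteq> VF \<longrightarrow>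
        D (swedge (- 1) (differential f) \<omega>) Xs =
          swedge (- c) (D (differential f)) \<omega> Xs + c * swedge (- 1) (differential f) (D \<omega>) Xs)"

lemma derivation_likeD:
  assumes "derivation_like c D" "\<omega> \<in> forms_deg C k" "set Xs \<subseteq> VF"
  shows "\<eta> \<in> forms_deg C k \<Longrightarrow> D (\<omega> + \<eta>) Xs = D \<omega> Xs + D \<eta> Xs"
    and "f \<in> C \<Longrightarrow> D (fun_times_form f \<omega>) Xs = swedge c (D (zero_form f)) \<omega> Xs + f * D \<omega> Xs"
    and "f \<in> C \<Longrightarrow> D (swedge (- 1) (differential f) \<omega>) Xs =
          swedge (- c) (D (differential f)) \<omega> Xs + c * swedge (- 1) (differential f) (D \<omega>) Xs"
  using assms unfolding derivation_like_def by blast+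

lemma forms_deg_swedge_differential:
  assumes f: "f \<in> C" and \<omega>: "\<omega> \<in> forms_deg C k"
  shows "swedge (- 1) (differential f) \<omega> \<in> forms_deg C (Suc k)"
proof (rule forms_degI)
  show "alt (swedge (- 1) (differential f) \<omega>)"
    using assms by (simp add: alternating_swedge alternating_differential forms_degD)
  have zero: "swedge (- 1) (differential f) \<omega> Xs = 0" if "length Xs \<noteq> Suc k" "alt \<omega>"
    "\<And>Xs. length Xs \<noteq> k \<Longrightarrow> \<omega> Xs = 0" for Xs :: "'m vfield list" and \<omega> k
    using that
  proof (induction Xs arbitrary: k \<omega>)
    case (Cons X Xs)
    have "fun_times_form h \<omega> Xs = 0" for h
      using Cons.prems by (simp add: fun_times_form_def)
    then have 1: "swedge 1 (contract X (differential f)) \<omega> Xs = 0"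
      by (simp add: contract_differential[OF f] swedge_zero_form swedge_linear)
    have 2: "swedge (- 1) (differential f) (contract X \<omega>) Xs = 0"
    proof (cases k)
      case 0
      then have "contract X \<omega> = 0"
        using Cons.prems(3) by (intro ext[of "contract X \<omega>"]) (simp add: contract_apply form_apply(4))
      then show ?thesis by (simp add: swedge_linear)
    next
      case (Suc l)
      show ?thesis
        by (rule Cons.IH[of l, OF _ alternating_contract[OF Cons.prems(2)]])
           (use Cons.prems Suc in \<open>simp_all add: contract_apply\<close>)
    qed
    show ?case by (simp add: 1 2)
  qed (simp add: ext_d_Nil)
  fix Xs :: "'m vfield list" assume "length Xs \<noteq> Suc k"
  then show "swedge (- 1) (differential f) \<omega> Xs = 0"
    using zero forms_degD(1,2)[OF \<omega>] by blast
qed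

lemma derivation_like_sum:
  assumes D: "derivation_like c D" and "\<And>i. i \<in> I \<Longrightarrow> F i \<in> forms_deg C k" and Xs: "set Xs \<subseteq> VF"
  shows "D (sum F I) Xs = (\<Sum>i\<in>I. D (F i) Xs)"
proof -
  have add: "D (\<omega> + \<eta>) Xs = D \<omega> Xs + D \<eta> Xs" if "\<omega> \<in> forms_deg C k" "\<eta> \<in> forms_deg C k" for \<omega> \<eta>
    using derivation_likeD(1)[OF D _ Xs] that by blast
  have "D 0 Xs = 0"
    using add[OF forms_deg_zero forms_deg_zero] by simp
  then show ?thesis
    using assms(2)
    by (induction I rule: infinite_finite_induct) (simp_all add: add forms_deg_sum)
qed

lemma derivation_like_contract:
  "X \<in> VF \<Longrightarrow> derivation_like (- 1) (contract X)"
  unfolding derivation_like_def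
  by (simp add: contract_linear form_apply(1) contract_swedge contract_zero_form swedge_linear)
     (simp add: fun_times_form_def)

lemma derivation_like_lie_derivative:
  assumes X: "X \<in> VF"
  shows "derivation_like 1 (lie_derivative C X)"
  unfolding derivation_like_def
proof (intro conjI allI ballI impI)
  fix l \<omega> f and Xs :: "'m vfield list"
  assume a: "\<omega> \<in> forms_deg C l" "f \<in> C" "set Xs \<subseteq> VF"
  show "lie_derivative C X (fun_times_form f \<omega>) Xs =
      swedge 1 (lie_derivative C X (zero_form f)) \<omega> Xs + f * lie_derivative C X \<omega> Xs"
    using lie_derivative_swedge[OF alternating_zero_form[OF a(2)] forms_degD(1)[OF a(1)] X _ a(3), of 1]
    by (simp add: swedge_zero_form) (simp add: fun_times_form_def)
  show "lie_derivative C X (swedge (- 1) (differential f) \<omega>) Xs =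
       swedge (- 1) (lie_derivative C X (differential f)) \<omega> Xs +
       1 * swedge (- 1) (differential f) (lie_derivative C X \<omega>) Xs"
    using lie_derivative_swedge[OF alternating_differential[OF a(2)] forms_degD(1)[OF a(1)] X _ a(3), of "- 1"]
    by simp
qed (use X in \<open>auto simp: lie_derivative_add forms_degD\<close>)

text \<open>
  A derivation is determined by its values on functions and their differentials.  By the Euler identity,
  \<open>k \<rho> \<omega> = \<Sum>\<^sub>i dx\<^sub>i \<and> \<iota>\<^bsub>E\<^sub>i\<^esub> \<omega>\<close> for \<open>\<omega>\<close> of degree \<open>k\<close>, and by induction the values on the right
  side are determined.  On the left side the Leibniz rule splits off the factor \<open>k \<rho>\<close>, which can be cancelled
  at the given point.
\<close>

theorem derivation_like_unique:
  assumes D: "derivation_like c D" and D': "derivation_like c D'"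
    and fn: "\<And>f Xs. f \<in> C \<Longrightarrow> set Xs \<subseteq> VF \<Longrightarrow> D (zero_form f) Xs = D' (zero_form f) Xs"
    and df: "\<And>f Xs. f \<in> C \<Longrightarrow> set Xs \<subseteq> VF \<Longrightarrow> D (differential f) Xs = D' (differential f) Xs"
    and \<omega>: "\<omega> \<in> forms_deg C k" and Xs: "set Xs \<subseteq> VF"
  shows "D \<omega> Xs = D' \<omega> Xs"
  using \<omega> Xs
proof (induction k arbitrary: \<omega> Xs)
  case 0
  then show ?case
    using forms_deg_0_eq[of \<omega>] fn[of "\<omega> []" Xs] by simp
next
  case (Suc k)
  show ?case
  proof
    fix p
    obtain \<rho> N x E where \<rho>: "\<rho> \<in> C" "\<rho> p \<noteq> 0" and xE: "\<And>i. i < (N::nat) \<Longrightarrow> x i \<in> C \<and> E i \<in> VF"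
      and fr: "\<And>X f. X \<in> VF \<Longrightarrow> f \<in> C \<Longrightarrow> \<rho> * X f = (\<Sum>i<N. X (x i) * E i f)"
      using frame[of p] by blast
    \<comment> \<open>the factor in the Euler identity for degree \<open>Suc k\<close>; it is invertible at \<open>p\<close>\<close>
    define h where "h = of_nat (Suc k) * \<rho>"
    have n: "of_nat m \<in> C" for m
      using const_mem[of "of_nat m"] by (simp add: of_nat_fun)
    have h: "h \<in> C" "h p \<noteq> 0"
      using \<rho> n[of "Suc k"] by (simp_all only: h_def mult_mem) (simp add: fun_apply del: of_nat_Suc)
    let ?\<eta> = "\<lambda>i. contract (E i) \<omega>"
    let ?\<theta> = "\<lambda>i. swedge (- 1) (differential (x i)) (?\<eta> i)"
    have \<eta>: "?\<eta> i \<in> forms_deg C k" for i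
      by (rule forms_deg_contract[OF Suc.prems(1)])
    have \<theta>: "i < N \<Longrightarrow> ?\<theta> i \<in> forms_deg C (Suc k)" for i
      using xE \<eta> by (intro forms_deg_swedge_differential) auto
    have "fun_times_form h \<omega> = (\<Sum>i<N. ?\<theta> i)"
    proof
      fix Ys
      have "(\<Sum>i<N. ?\<theta> i) \<in> forms_deg C (Suc k)"
        by (rule forms_deg_sum) (simp add: \<theta>)
      note S = forms_degD(1,2)[OF this]
      note O = forms_degD(1,2)[OF Suc.prems(1)]
      show "fun_times_form h \<omega> Ys = (\<Sum>i<N. ?\<theta> i) Ys"
      proof (cases "set Ys \<subseteq> VF \<and> length Ys = Suc k")
        case True
        then show ?thesis
          using frame_Euler[OF \<rho>(1) xE fr O(1), of Ys]
          by (simp add: sum_form_apply fun_times_form_def h_def del: of_nat_Suc)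
      next
        case False
        then have "(\<Sum>i<N. ?\<theta> i) Ys = 0" "\<omega> Ys = 0"
          using S(2) O(2) alternating_off[OF S(1), of Ys] alternating_off[OF O(1), of Ys] by blast+
        then show ?thesis
          by (simp add: fun_times_form_def)
      qed
    qed
    then have key: "swedge c (F (zero_form h)) \<omega> Xs + h * F \<omega> Xs =
        (\<Sum>i<N. swedge (- c) (F (differential (x i))) (?\<eta> i) Xs +
          c * swedge (- 1) (differential (x i)) (F (?\<eta> i)) Xs)" if F: "derivation_like c F" for F
    proof -
      assume eq: "fun_times_form h \<omega> = (\<Sum>i<N. ?\<theta> i)"
      have "swedge c (F (zero_form h)) \<omega> Xs + h * F \<omega> Xs = F (fun_times_form h \<omega>) Xs"
        by (rule derivation_likeD(2)[OF F Suc.prems h(1), symmetric])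
      also have "\<dots> = (\<Sum>i<N. F (?\<theta> i) Xs)"
        unfolding eq using \<theta> Suc.prems by (intro derivation_like_sum[OF F]) auto
      also have "\<dots> = (\<Sum>i<N. swedge (- c) (F (differential (x i))) (?\<eta> i) Xs +
          c * swedge (- 1) (differential (x i)) (F (?\<eta> i)) Xs)"
        using xE by (intro sum.cong derivation_likeD(3)[OF F \<eta> Suc.prems(2)]) auto
      finally show ?thesis .
    qed
    have sub: "set Ys \<subseteq> VF" if "set Ys \<subseteq> set Xs" for Ys
      using that Suc.prems(2) by blast
    have summand: "swedge (- c) (D (differential (x i))) (?\<eta> i) Xs = swedge (- c) (D' (differential (x i))) (?\<eta> i) Xs"
       "swedge (- 1) (differential (x i)) (D (?\<eta> i)) Xs = swedge (- 1) (differential (x i)) (D' (?\<eta> i)) Xs"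
      if "i < N" for i
      by (rule swedge_cong; simp add: df xE that sub Suc.IH \<eta>)+
    have "swedge c (D (zero_form h)) \<omega> Xs = swedge c (D' (zero_form h)) \<omega> Xs"
      by (rule swedge_cong) (simp_all add: fn h sub)
    moreover have "(\<Sum>i<N. swedge (- c) (D (differential (x i))) (?\<eta> i) Xs + c * swedge (- 1) (differential (x i)) (D (?\<eta> i)) Xs) =
        (\<Sum>i<N. swedge (- c) (D' (differential (x i))) (?\<eta> i) Xs + c * swedge (- 1) (differential (x i)) (D' (?\<eta> i)) Xs)"
      by (rule sum.cong) (simp_all add: summand)
    ultimately have "h * D \<omega> Xs = h * D' \<omega> Xs"
      using key[OF D] key[OF D'] by (metis add_left_cancel)
    then show "D \<omega> Xs p = D' \<omega> Xs p"
      using h(2) by (metis mult_cancel_left times_fun_apply)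
  qed
qed

end

section \<open>Contraction of two forms with a bivector field\<close>

locale poisson_algebra = framed_function_algebra C for C :: "('m \<Rightarrow> real) set" +
  fixes \<pi> :: "'m form \<Rightarrow> 'm form \<Rightarrow> 'm \<Rightarrow> real"
  assumes bivector: "bivector_field C \<pi>"
begin

lemma bivector_mem: "\<alpha> \<in> forms_deg C 1 \<Longrightarrow> \<beta> \<in> forms_deg C 1 \<Longrightarrow> \<pi> \<alpha> \<beta> \<in> C"
  and bivector_antisym: "\<alpha> \<in> forms_deg C 1 \<Longrightarrow> \<beta> \<in> forms_deg C 1 \<Longrightarrow> \<pi> \<alpha> \<beta> = - \<pi> \<beta> \<alpha>"
  and bivector_add_left: "\<alpha> \<in> forms_deg C 1 \<Longrightarrow> \<beta> \<in> forms_deg C 1 \<Longrightarrow> \<gamma> \<in> forms_deg C 1 \<Longrightarrow>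
        \<pi> (\<alpha> + \<beta>) \<gamma> = \<pi> \<alpha> \<gamma> + \<pi> \<beta> \<gamma>"
  and bivector_smult_left: "f \<in> C \<Longrightarrow> \<alpha> \<in> forms_deg C 1 \<Longrightarrow> \<beta> \<in> forms_deg C 1 \<Longrightarrow>
        \<pi> (fun_times_form f \<alpha>) \<beta> = f * \<pi> \<alpha> \<beta>"
  using bivector unfolding bivector_field_def by blast+

lemma bivector_add_right:
  assumes "\<alpha> \<in> forms_deg C 1" "\<beta> \<in> forms_deg C 1" "\<gamma> \<in> forms_deg C 1"
  shows "\<pi> \<gamma> (\<alpha> + \<beta>) = \<pi> \<gamma> \<alpha> + \<pi> \<gamma> \<beta>"
  using bivector_antisym[OF assms(3) forms_deg_add[OF assms(1,2)]] bivector_antisym[OF assms(3,1)]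
    bivector_antisym[OF assms(3,2)] bivector_add_left[OF assms] by simp

lemma bivector_smult_right:
  assumes "f \<in> C" "\<alpha> \<in> forms_deg C 1" "\<beta> \<in> forms_deg C 1"
  shows "\<pi> \<beta> (fun_times_form f \<alpha>) = f * \<pi> \<beta> \<alpha>"
  using bivector_antisym[OF assms(3) forms_deg_fun_times_form[OF assms(1,2)]] bivector_antisym[OF assms(3,2)]
    bivector_smult_left[OF assms] by simp

lemma bivector_zero_right: "\<alpha> \<in> forms_deg C 1 \<Longrightarrow> \<pi> \<alpha> 0 = 0"
  using bivector_add_right[OF forms_deg_zero forms_deg_zero, of \<alpha>] by simp

lemma bivector_sum_right:
  assumes "\<alpha> \<in> forms_deg C 1" "\<And>i. i \<in> I \<Longrightarrow> \<beta> i \<in> forms_deg C 1"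
  shows "\<pi> \<alpha> (sum \<beta> I) = (\<Sum>i\<in>I. \<pi> \<alpha> (\<beta> i))"
  using assms(2)
  by (induction I rule: infinite_finite_induct)
     (simp_all add: assms(1) bivector_zero_right bivector_add_right forms_deg_sum del: One_nat_def)

lemma differential_add: "f \<in> C \<Longrightarrow> g \<in> C \<Longrightarrow> differential (f + g) = differential f + differential g"
  by (rule ext) (simp add: zero_form_linear ext_d_add alternating_zero_form form_apply)

lemma differential_scale: "f \<in> C \<Longrightarrow> differential (\<lambda>p. a * f p) = fun_times_form (\<lambda>_. a) (differential f)"
  by (rule ext)
     (auto simp: differential_apply fun_times_form_def scale_mem vector_field_scale times_fun_def split: list.split,
      simp_all add: fun_eq_iff fun_apply)

lemma differential_mult:
  "f \<in> C \<Longrightarrow> g \<in> C \<Longrightarrow>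
    differential (f * g) = fun_times_form g (differential f) + fun_times_form f (differential g)"
  by (rule ext)
     (auto simp: differential_apply fun_times_form_def form_apply mult_mem vector_field_mult algebra_simps
       split: list.split)

lemma sharp_vector_field:
  assumes \<alpha>: "\<alpha> \<in> forms_deg C 1"
  shows "sharp C \<pi> \<alpha> \<in> VF"
proof (rule vector_fieldI)
  note d = forms_deg_differential
  show "f \<in> C \<Longrightarrow> sharp C \<pi> \<alpha> f \<in> C" for f
    by (simp add: sharp_def bivector_mem \<alpha> d del: One_nat_def)
  show "f \<in> C \<Longrightarrow> g \<in> C \<Longrightarrow> sharp C \<pi> \<alpha> (f + g) = sharp C \<pi> \<alpha> f + sharp C \<pi> \<alpha> g" for f g
    by (simp add: sharp_def add_mem differential_add bivector_add_right \<alpha> d del: One_nat_def)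
  show "f \<in> C \<Longrightarrow> sharp C \<pi> \<alpha> (\<lambda>p. a * f p) = (\<lambda>p. a * sharp C \<pi> \<alpha> f p)" for a f
    by (simp add: sharp_def scale_mem differential_scale bivector_smult_right \<alpha> d const_mem del: One_nat_def)
       (simp add: times_fun_def)
  show "f \<in> C \<Longrightarrow> g \<in> C \<Longrightarrow> sharp C \<pi> \<alpha> (f * g) = sharp C \<pi> \<alpha> f * g + f * sharp C \<pi> \<alpha> g" for f g
    by (simp add: sharp_def mult_mem differential_mult bivector_add_right bivector_smult_right
        forms_deg_fun_times_form \<alpha> d mult.commute del: One_nat_def)
  show "f \<notin> C \<Longrightarrow> sharp C \<pi> \<alpha> f = 0" for f
    by (simp add: sharp_def)
qed

lemma sharp_add:
  "\<alpha> \<in> forms_deg C 1 \<Longrightarrow> \<beta> \<in> forms_deg C 1 \<Longrightarrow> sharp C \<pi> (\<alpha> + \<beta>) = sharp C \<pi> \<alpha> + sharp C \<pi> \<beta>"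
  by (rule ext) (simp add: sharp_def bivector_add_left forms_deg_differential fun_apply(1) del: One_nat_def)

lemma sharp_smult:
  "f \<in> C \<Longrightarrow> \<alpha> \<in> forms_deg C 1 \<Longrightarrow> sharp C \<pi> (fun_times_form f \<alpha>) = (\<lambda>g. f * sharp C \<pi> \<alpha> g)"
  by (rule ext) (simp add: sharp_def bivector_smult_left forms_deg_differential del: One_nat_def)

abbreviation hamiltonian :: "('m \<Rightarrow> real) \<Rightarrow> 'm vfield" where
  "hamiltonian f \<equiv> sharp C \<pi> (differential f)"

text \<open>
  \<open>\<pi>\<close> is known on differentials through the derivation \<open>sharp\<close>; in a frame every 1-form is a
  combination of differentials, so this determines \<open>\<pi>(dg, \<alpha>)\<close>.
\<close>

lemma bivector_differential:
  assumes g: "g \<in> C" and \<alpha>: "\<alpha> \<in> forms_deg C 1"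
  shows "\<pi> (differential g) \<alpha> = \<alpha> [hamiltonian g]"
proof
  fix p
  obtain \<rho> N x E where \<rho>: "\<rho> \<in> C" "\<rho> p \<noteq> 0" and xE: "\<And>i. i < (N::nat) \<Longrightarrow> x i \<in> C \<and> E i \<in> VF"
    and fr: "\<And>X f. X \<in> VF \<Longrightarrow> f \<in> C \<Longrightarrow> \<rho> * X f = (\<Sum>i<N. X (x i) * E i f)"
    using frame[of p] by blast
  note d = forms_deg_differential and a = forms_degD(1,2)[OF \<alpha>]
  have val: "\<alpha> [E i] \<in> C" for i
    by (rule alternating_value[OF a(1)])
  let ?\<theta> = "\<lambda>i. fun_times_form (\<alpha> [E i]) (differential (x i))"
  have "fun_times_form \<rho> \<alpha> = (\<Sum>i<N. ?\<theta> i)"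
  proof
    fix Ys :: "'m vfield list"
    show "fun_times_form \<rho> \<alpha> Ys = (\<Sum>i<N. ?\<theta> i) Ys"
    proof (cases "\<exists>X. Ys = [X] \<and> X \<in> VF")
      case True
      then obtain X where X: "Ys = [X]" "X \<in> VF" by blast
      have "(\<Sum>i<N. ?\<theta> i Ys) = (\<Sum>i<N. X (x i) * \<alpha> [E i])"
        using xE X by (intro sum.cong) (simp_all add: fun_times_form_def differential_apply mult.commute)
      also have "\<dots> = \<rho> * \<alpha> [X]"
        by (rule frame_expansion[OF \<rho>(1) xE fr a(1) X(2), symmetric])
      finally show ?thesis
        by (simp only: sum_form_apply) (simp add: fun_times_form_def X)
    next
      case False
      have "differential (x i) Ys = 0" if "i < N" for i
        using False xE[OF that] by (auto simp: differential_apply split: list.split)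
      then have "(\<Sum>i<N. ?\<theta> i Ys) = 0"
        by (intro sum.neutral) (simp add: fun_times_form_def)
      moreover have "\<alpha> Ys = 0"
        using False a(2)[of Ys] alternating_off[OF a(1), of Ys] by (cases Ys) auto
      ultimately show ?thesis
        by (simp only: sum_form_apply) (simp add: fun_times_form_def)
    qed
  qed
  then have "\<pi> (differential g) (fun_times_form \<rho> \<alpha>) = (\<Sum>i<N. \<pi> (differential g) (?\<theta> i))"
    using xE val by (simp only:) (intro bivector_sum_right d g forms_deg_fun_times_form, simp_all)
  also have "\<dots> = (\<Sum>i<N. hamiltonian g (x i) * \<alpha> [E i])"
    using xE val by (intro sum.cong) (simp_all add: bivector_smult_right d g sharp_def mult.commute del: One_nat_def)
  also have "\<dots> = \<rho> * \<alpha> [hamiltonian g]"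
    using frame_expansion[OF \<rho>(1) xE fr a(1) sharp_vector_field[OF d[OF g]], of "[]"] by simp
  finally have "\<rho> * \<pi> (differential g) \<alpha> = \<rho> * \<alpha> [hamiltonian g]"
    by (simp add: bivector_smult_right \<rho>(1) \<alpha> d g del: One_nat_def)
  then show "\<pi> (differential g) \<alpha> p = \<alpha> [hamiltonian g] p"
    using \<rho>(2) by (metis mult_cancel_left times_fun_apply)
qed

text \<open>
  The contraction of \<open>\<pi>\<close> with one slot of \<open>\<sigma>\<close> and one slot of \<open>\<omega>\<close>, antisymmetrized in the remaining
  arguments.  In other words, it inserts the vector-valued form \<open>\<pi>\<^sup>#\<sigma>\<close> into \<open>\<omega>\<close>.  Here \<open>r = (-1)\<^sup>k\<close> for
  \<open>\<sigma>\<close> of degree \<open>k\<close>.  The signs are those for which the contraction refers to the first slot of both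
  forms: an argument \<open>X\<close> of \<open>\<sigma>\<close> is moved in front of the contracted slot (sign \<open>-1\<close>); an argument of \<open>\<omega>\<close> is
  moved in front of its contracted slot and past the \<open>k - 1\<close> remaining slots of \<open>\<sigma>\<close> (sign \<open>- (-1)\<^sup>k\<^sup>-\<^sup>1 = r\<close>).
\<close>

fun pairing :: "('m \<Rightarrow> real) \<Rightarrow> 'm form \<Rightarrow> 'm form \<Rightarrow> 'm form" where
  "pairing r \<sigma> \<omega> [] = \<omega> [sharp C \<pi> (homogeneous_part 1 \<sigma>)]"
| "pairing r \<sigma> \<omega> (X # Xs) =
     - pairing (- r) (contract X \<sigma>) \<omega> Xs + r * pairing r \<sigma> (contract X \<omega>) Xs"

lemma contract_pairing:
  "contract X (pairing r \<sigma> \<omega>) =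
    - pairing (- r) (contract X \<sigma>) \<omega> + fun_times_form r (pairing r \<sigma> (contract X \<omega>))"
  by (rule ext) (simp add: form_apply, simp add: contract_def fun_times_form_def)

lemma pairing_add_right:
  "pairing r \<sigma> (\<alpha> + \<beta>) Xs = pairing r \<sigma> \<alpha> Xs + pairing r \<sigma> \<beta> Xs"
  by (induction Xs arbitrary: r \<sigma> \<alpha> \<beta>) (simp_all add: form_apply contract_linear algebra_simps)

lemma pairing_smult_right:
  "pairing r \<sigma> (fun_times_form f \<alpha>) Xs = f * pairing r \<sigma> \<alpha> Xs"
  by (induction Xs arbitrary: r \<sigma> \<alpha>)
     (simp_all add: contract_linear algebra_simps, simp add: fun_times_form_def)

lemma pairing_uminus_right: "pairing r \<sigma> (- \<alpha>) Xs = - pairing r \<sigma> \<alpha> Xs"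
  using pairing_smult_right[of r \<sigma> "- 1" \<alpha> Xs] by (simp add: fun_times_form_simps)

lemma pairing_zero_right: "pairing r \<sigma> 0 = 0"
  by (rule ext) (use pairing_smult_right[of r \<sigma> 0 0] in
      \<open>simp add: fun_times_form_simps form_apply(4)\<close>)

lemma pairing_add_left:
  assumes "alt \<sigma>" "alt \<sigma>'" "alt \<omega>"
  shows "pairing r (\<sigma> + \<sigma>') \<omega> Xs = pairing r \<sigma> \<omega> Xs + pairing r \<sigma>' \<omega> Xs"
  using assms
  by (induction Xs arbitrary: r \<sigma> \<sigma>' \<omega>)
     (simp_all add: homogeneous_part_linear sharp_add forms_deg_homogeneous_part alternating_add_head
        sharp_vector_field contract_linear alternating_contract algebra_simps)

lemma pairing_smult_left:
  assumes "alt \<sigma>" "f \<in> C" "alt \<omega>"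
  shows "pairing r (fun_times_form f \<sigma>) \<omega> Xs = f * pairing r \<sigma> \<omega> Xs"
  using assms
  by (induction Xs arbitrary: r \<sigma> \<omega>)
     (simp_all add: homogeneous_part_linear sharp_smult forms_deg_homogeneous_part alternating_smult_head
        sharp_vector_field contract_linear alternating_contract algebra_simps)

lemma pairing_uminus_left:
  "alt \<sigma> \<Longrightarrow> alt \<omega> \<Longrightarrow> pairing r (- \<sigma>) \<omega> Xs = - pairing r \<sigma> \<omega> Xs"
  using pairing_smult_left[of \<sigma> "- 1" \<omega> r Xs] by (simp add: fun_times_form_simps mem)

lemma pairing_zero_left: "alt \<omega> \<Longrightarrow> pairing r 0 \<omega> = 0"
  by (rule ext) (use pairing_smult_left[of 0 0 \<omega> r] in
      \<open>simp add: fun_times_form_simps form_apply(4) mem alternating_zero\<close>)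

lemma alternating_upto_pairing:
  assumes "alt \<sigma>" "alt \<omega>" "r = 1 \<or> r = - 1"
  shows "alternating_upto C n (pairing r \<sigma> \<omega>)"
  using assms
proof (induction n arbitrary: r \<sigma> \<omega>)
  case 0
  then show ?case
    by (simp add: alternating_value)
next
  case (Suc n)
  note p = Suc.prems
  note ip = alternating_contract[OF p(1)] alternating_contract[OF p(2)]
  show ?case
    unfolding alternating_upto.simps(2)[of C n]
  proof (intro conjI allI impI ballI)
    show "pairing r \<sigma> \<omega> [] \<in> C"
      using p by (simp add: alternating_value)
    fix X assume X: "X \<in> VF"
    have "alternating_upto C n (fun_times_form (- 1) (pairing (- r) (contract X \<sigma>) \<omega>) +
        (fun_times_form r (pairing r \<sigma> (contract X \<omega>)) + 0))"
      by (intro alternating_upto_linear Suc.IH ip p sign_uminus sign_mem alternating_upto_zero) simp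
    then show "alternating_upto C n (contract X (pairing r \<sigma> \<omega>))"
      by (simp add: contract_pairing fun_times_form_simps)
  next
    fix X assume "X \<notin> VF"
    then show "contract X (pairing r \<sigma> \<omega>) = 0"
      using p by (simp add: contract_pairing alternatingD(2) pairing_zero_left
        pairing_zero_right fun_times_form_simps)
  next
    fix X Y assume "X \<in> VF" "Y \<in> VF"
    then show "contract (X + Y) (pairing r \<sigma> \<omega>) =
        contract X (pairing r \<sigma> \<omega>) + contract Y (pairing r \<sigma> \<omega>)"
      by (simp only: contract_pairing alternatingD(4)[OF p(1)] alternatingD(4)[OF p(2)])
         (rule ext, simp add: form_apply fun_times_form_def pairing_add_left
           pairing_add_right ip p algebra_simps)
  next
    fix X f assume Xf: "X \<in> VF" "f \<in> C"
    have *: "pairing (- r) (fun_times_form f (contract X \<sigma>)) \<omega> =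
        fun_times_form f (pairing (- r) (contract X \<sigma>) \<omega>)"
      "pairing r \<sigma> (fun_times_form f (contract X \<omega>)) =
        fun_times_form f (pairing r \<sigma> (contract X \<omega>))"
      by (rule ext, simp add: pairing_smult_left pairing_smult_right ip p Xf(2),
          simp add: fun_times_form_def)+
    show "contract (\<lambda>g. f * X g) (pairing r \<sigma> \<omega>) =
        fun_times_form f (contract X (pairing r \<sigma> \<omega>))"
      by (simp only: contract_pairing alternatingD(5)[OF p(1) Xf] alternatingD(5)[OF p(2) Xf] *)
         (rule ext, simp add: form_apply fun_times_form_def algebra_simps)
  next
    fix X Y
    have swap: "contract X (contract Y \<sigma>) = - contract Y (contract X \<sigma>)"
      "contract X (contract Y \<omega>) = - contract Y (contract X \<omega>)"
      by (rule alternatingD(6)[OF p(1)] alternatingD(6)[OF p(2)])+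
    show "contract X (contract Y (pairing r \<sigma> \<omega>)) =
        - contract Y (contract X (pairing r \<sigma> \<omega>))"
      by (simp only: contract_pairing contract_linear swap)
         (rule ext, simp add: form_apply fun_times_form_def pairing_uminus_left
           pairing_uminus_right alternating_contract ip p algebra_simps)
  qed
qed

lemma alternating_pairing:
  "alt \<sigma> \<Longrightarrow> alt \<omega> \<Longrightarrow> r = 1 \<or> r = - 1 \<Longrightarrow> alt (pairing r \<sigma> \<omega>)"
  by (simp add: alternating_def[of C "pairing r \<sigma> \<omega>"] alternating_upto_pairing)

text \<open>
  A form lives in finitely many degrees; this bounds those of the primitive.
\<close>

lemma pairing_bounded:
  assumes "\<And>Xs. length Xs \<ge> a \<Longrightarrow> \<sigma> Xs = 0" "\<And>Xs. length Xs \<ge> b \<Longrightarrow> \<omega> Xs = 0" "alt \<omega>" "length Xs \<ge> a + b"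
  shows "pairing r \<sigma> \<omega> Xs = 0"
  using assms
proof (induction Xs arbitrary: a b r \<sigma> \<omega>)
  case (Cons X Xs)
  show ?case
  proof (cases "a = 0 \<or> b = 0")
    case True
    then have "\<sigma> = 0 \<or> \<omega> = 0"
      using Cons.prems(1,2) by (auto simp: fun_eq_iff[of _ "0 :: 'm form"] form_apply(4))
    then show ?thesis
      by (elim disjE) (simp_all only: pairing_zero_left[OF Cons.prems(3)]
          pairing_zero_right form_apply(4)[of "X # Xs"])
  next
    case False
    then obtain a' b' where ab: "a = Suc a'" "b = Suc b'"
      by (metis not0_implies_Suc)
    have "pairing (- r) (contract X \<sigma>) \<omega> Xs = 0"
      by (rule Cons.IH[of a' _ b]) (use Cons.prems ab in \<open>simp_all add: contract_apply\<close>)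
    moreover have "pairing r \<sigma> (contract X \<omega>) Xs = 0"
      by (rule Cons.IH[of a _ b', OF _ _ alternating_contract[OF Cons.prems(3)]])
         (use Cons.prems ab in \<open>simp_all add: contract_apply\<close>)
    ultimately show ?thesis by simp
  qed
qed simp

lemma pairing_cong:
  assumes "\<And>Ys. set Ys \<subseteq> VF \<Longrightarrow> \<omega> Ys = \<omega>' Ys" "alt \<sigma>" "set Xs \<subseteq> VF"
  shows "pairing r \<sigma> \<omega> Xs = pairing r \<sigma> \<omega>' Xs"
  using assms
proof (induction Xs arbitrary: r \<sigma> \<omega> \<omega>')
  case Nil
  then show ?case
    by (simp add: sharp_vector_field forms_deg_homogeneous_part)
next
  case (Cons X Xs)
  have "pairing (- r) (contract X \<sigma>) \<omega> Xs = pairing (- r) (contract X \<sigma>) \<omega>' Xs"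
    by (rule Cons.IH[OF _ alternating_contract[OF Cons.prems(2)]]) (use Cons.prems in simp_all)
  moreover have "pairing r \<sigma> (contract X \<omega>) Xs = pairing r \<sigma> (contract X \<omega>') Xs"
    by (rule Cons.IH) (use Cons.prems in \<open>simp_all add: contract_apply\<close>)
  ultimately show ?case by simp
qed

lemma pairing_zero_form: "pairing r \<sigma> (zero_form f) = 0"
proof
  show "pairing r \<sigma> (zero_form f) Xs = 0 Xs" for Xs
  proof (induction Xs arbitrary: r \<sigma>)
    case Nil
    show ?case by (simp add: zero_form_def form_apply(4))
  next
    case (Cons X Xs)
    then show ?case
      by (simp add: contract_zero_form pairing_zero_right form_apply(4))
  qed
qed

text \<open>
  There is only one slot to contract, so the bivector field meets \<open>dg\<close> and one slot of \<open>\<sigma>\<close>.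
\<close>

lemma pairing_differential:
  assumes "alt \<sigma>" "g \<in> C" "r = 1 \<or> r = - 1"
  shows "pairing r \<sigma> (differential g) = - contract (hamiltonian g) \<sigma>"
proof -
  have "pairing r \<sigma> (differential g) Xs = - \<sigma> (hamiltonian g # Xs)" for Xs
    using assms(1)
  proof (induction Xs arbitrary: r \<sigma>)
    case Nil
    note h = forms_deg_homogeneous_part[OF Nil, of 1]
    have "pairing r \<sigma> (differential g) [] = \<pi> (homogeneous_part 1 \<sigma>) (differential g)"
      using assms(2) sharp_vector_field[OF h] by (simp add: differential_apply) (simp add: sharp_def)
    also have "\<dots> = - homogeneous_part 1 \<sigma> [hamiltonian g]"
      using bivector_antisym[OF h forms_deg_differential[OF assms(2)]]
        bivector_differential[OF assms(2) h] by simp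
    finally show ?case by (simp add: homogeneous_part_def)
  next
    case (Cons X Xs)
    have "pairing r \<sigma> (contract X (differential g)) Xs = 0"
      using pairing_zero_form[of r \<sigma> "X g"] pairing_zero_right[of r \<sigma>]
      by (simp add: contract_differential[OF assms(2)] form_apply(4))
    moreover have "pairing (- r) (contract X \<sigma>) (differential g) Xs = - \<sigma> (X # hamiltonian g # Xs)"
      using Cons.IH[OF alternating_contract[OF Cons.prems], of "- r" X] by (simp only: contract_apply[of X \<sigma> "_ # _"])
    ultimately show ?case
      using alternating_swap[OF Cons.prems, of X "hamiltonian g" Xs] by simp
  qed
  then show ?thesis
    by (intro ext[of "pairing r \<sigma> (differential g)"]) (simp add: form_apply contract_apply)
qed

text \<open>
  Insertion of a vector-valued form of degree \<open>k - 1\<close> is a derivation of degree \<open>k - 2\<close>, whence the sign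
  \<open>(-1)\<^sup>k\<close> when the left factor is odd.  At the empty list the rule compares \<open>s\<close> with that sign; they differ
  only for \<open>s = -1\<close> and \<open>r = 1\<close>, and then \<open>\<alpha>\<close> has no component of degree 0.
\<close>

lemma pairing_swedge:
  assumes "has_parity s \<alpha>" "s = 1 \<or> s = - 1" "r = 1 \<or> r = - 1"
  shows "pairing r \<sigma> (swedge s \<alpha> \<beta>) Xs =
    swedge (s * r) (pairing r \<sigma> \<alpha>) \<beta> Xs +
    (if s = 1 then 1 else r) * swedge s \<alpha> (pairing r \<sigma> \<beta>) Xs"
  using assms
proof (induction Xs arbitrary: s r \<sigma> \<alpha> \<beta>)
  case Nil
  have neq: "(1 :: 'm \<Rightarrow> real) \<noteq> - 1"
    by (simp add: fun_eq_iff fun_apply)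
  \<comment> \<open>an odd form has no component of degree 0\<close>
  have "\<alpha> [] = 0" if "s = - 1"
    using Nil(1) that neq by (auto simp: has_parity_def)
  then show ?case
    using Nil(2,3) by (auto simp: contract_apply)
next
  case (Cons X Xs)
  note p = Cons.prems
  have neq: "(1 :: 'm \<Rightarrow> real) \<noteq> - 1" "- 1 \<noteq> (1 :: 'm \<Rightarrow> real)"
    by (simp_all add: fun_eq_iff fun_apply)
  have 1: "pairing (- r) (contract X \<sigma>) (swedge s \<alpha> \<beta>) Xs =
      swedge (s * (- r)) (pairing (- r) (contract X \<sigma>) \<alpha>) \<beta> Xs +
      (if s = 1 then 1 else - r) * swedge s \<alpha> (pairing (- r) (contract X \<sigma>) \<beta>) Xs"
    by (rule Cons.IH[OF p(1,2) sign_uminus[OF p(3)]])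
  have 2: "pairing r \<sigma> (swedge (- s) (contract X \<alpha>) \<beta>) Xs =
      swedge ((- s) * r) (pairing r \<sigma> (contract X \<alpha>)) \<beta> Xs +
      (if - s = 1 then 1 else r) * swedge (- s) (contract X \<alpha>) (pairing r \<sigma> \<beta>) Xs"
    by (rule Cons.IH[OF has_parity_contract[OF p(1)] sign_uminus[OF p(2)] p(3)])
  have 3: "pairing r \<sigma> (swedge s \<alpha> (contract X \<beta>)) Xs =
      swedge (s * r) (pairing r \<sigma> \<alpha>) (contract X \<beta>) Xs +
      (if s = 1 then 1 else r) * swedge s \<alpha> (pairing r \<sigma> (contract X \<beta>)) Xs"
    by (rule Cons.IH[OF p])
  show ?case
    unfolding pairing.simps swedge.simps contract_swedge pairing_add_right
      pairing_smult_right 1 2 3 contract_pairing swedge_add swedge_uminus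
      swedge_fun_times_form
    using p(2,3) by (elim disjE) (simp_all add: neq algebra_simps)
qed

end

section \<open>The Koszul bracket of closed forms\<close>

lemma scale_form_eq: "scale_form a \<omega> = fun_times_form (\<lambda>_. a) \<omega>"
  by (simp add: scale_form_def fun_times_form_def times_fun_def)

lemma minus_one_powi: "(\<lambda>_. (- 1) powi (int k - 1)) = (- ((- 1) ^ k) :: 'm \<Rightarrow> real)"
proof
  fix p :: 'm
  have "(- 1 :: real) powi (int k - 1) = - ((- 1) ^ k)"
    by (simp add: power_int_diff)
  then show "(- 1) powi (int k - 1) = (- ((- 1) ^ k) :: 'm \<Rightarrow> real) p"
    by (simp add: fun_apply minus_one_power_apply)
qed

lemma minus_one_powi': "(- 1 :: real) powi (- (int k - 1)) = (- 1) powi (int k - 1)"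
  by (cases "even k") (simp_all add: power_int_diff)

context poisson_algebra
begin

context
  fixes \<sigma> :: "'m form" and r :: "'m \<Rightarrow> real"
  assumes \<sigma>: "alt \<sigma>" and r: "r = 1 \<or> r = - 1"
begin

text \<open>
  The graded commutator \<open>[d, P]\<close> of \<open>P = pairing r \<sigma>\<close>.  As \<open>P\<close> has the parity \<open>r\<close>, the second term carries
  the sign \<open>- r\<close>.
\<close>

definition pairing_commutator :: "'m form \<Rightarrow> 'm form" where
  "pairing_commutator \<omega> =
     ext_d C (pairing r \<sigma> \<omega>) + fun_times_form (- r) (pairing r \<sigma> (ext_d C \<omega>))"

lemma pairing_commutator_apply:
  "pairing_commutator \<omega> Xs = ext_d C (pairing r \<sigma> \<omega>) Xs - r * pairing r \<sigma> (ext_d C \<omega>) Xs"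
  by (simp add: pairing_commutator_def form_apply(1)) (simp add: fun_times_form_def)

text \<open>
  The commutator of two derivations is a derivation: the mixed terms, in which \<open>d\<close> and \<open>P\<close> act on
  different factors, cancel.
\<close>

lemma pairing_commutator_swedge:
  assumes \<alpha>: "alt \<alpha>" and \<beta>: "alt \<beta>" and s: "s = 1 \<or> s = - 1" "has_parity s \<alpha>" and Xs: "set Xs \<subseteq> VF"
  shows "pairing_commutator (swedge s \<alpha> \<beta>) Xs = swedge (- (s * r)) (pairing_commutator \<alpha>) \<beta> Xs +
    (if s = 1 then 1 else - r) * swedge s \<alpha> (pairing_commutator \<beta>) Xs"
proof -
  define e where "e = (if s = 1 then 1 else r)"
  define e' where "e' = (if - s = 1 then 1 else r)"
  let ?P = "pairing r \<sigma>"
  have e: "e = 1 \<or> e = - 1" and sr: "s * r = 1 \<or> s * r = - 1"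
    using r s(1) by (auto simp: e_def)
  have neq: "(1 :: 'm \<Rightarrow> real) \<noteq> - 1" "- 1 \<noteq> (1 :: 'm \<Rightarrow> real)"
    by (simp_all add: fun_eq_iff fun_apply)
  note P = alternating_pairing[OF \<sigma> _ r]
  have Pw: "?P (swedge s \<alpha> \<beta>) = swedge (s * r) (?P \<alpha>) \<beta> + fun_times_form e (swedge s \<alpha> (?P \<beta>))"
    by (rule ext, simp only: form_apply(1) pairing_swedge[OF s(2,1) r] e_def)
       (simp add: fun_times_form_def)
  have "ext_d C (?P (swedge s \<alpha> \<beta>)) Xs =
      ext_d C (swedge (s * r) (?P \<alpha>) \<beta>) Xs + e * ext_d C (swedge s \<alpha> (?P \<beta>)) Xs"
    unfolding Pw
    by (subst ext_d_add)
       (simp_all add: alternating_swedge alternating_fun_times_form sign_mem e sr s P \<alpha> \<beta> ext_d_sign)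
  also have "\<dots> = (swedge (- (s * r)) (ext_d C (?P \<alpha>)) \<beta> Xs + (s * r) * swedge (s * r) (?P \<alpha>) (ext_d C \<beta>) Xs)
      + e * (swedge (- s) (ext_d C \<alpha>) (?P \<beta>) Xs + s * swedge s \<alpha> (ext_d C (?P \<beta>)) Xs)"
    by (simp only: ext_d_swedge[OF P[OF \<alpha>] \<beta> sr Xs] ext_d_swedge[OF \<alpha> P[OF \<beta>] s(1) Xs])
  finally have 1: "ext_d C (?P (swedge s \<alpha> \<beta>)) Xs = \<dots>" .
  have "?P (ext_d C (swedge s \<alpha> \<beta>)) Xs =
      ?P (swedge (- s) (ext_d C \<alpha>) \<beta> + fun_times_form s (swedge s \<alpha> (ext_d C \<beta>))) Xs"
  proof (rule pairing_cong[OF _ \<sigma> Xs])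
    fix Ys assume "set Ys \<subseteq> VF"
    then show "ext_d C (swedge s \<alpha> \<beta>) Ys = (swedge (- s) (ext_d C \<alpha>) \<beta> + fun_times_form s (swedge s \<alpha> (ext_d C \<beta>))) Ys"
      by (simp add: ext_d_swedge[OF \<alpha> \<beta> s(1)] form_apply(1)) (simp add: fun_times_form_def)
  qed
  also have "\<dots> = ?P (swedge (- s) (ext_d C \<alpha>) \<beta>) Xs + s * ?P (swedge s \<alpha> (ext_d C \<beta>)) Xs"
    by (simp only: pairing_add_right pairing_smult_right)
  also have "\<dots> = (swedge (- s * r) (?P (ext_d C \<alpha>)) \<beta> Xs + e' * swedge (- s) (ext_d C \<alpha>) (?P \<beta>) Xs)
      + s * (swedge (s * r) (?P \<alpha>) (ext_d C \<beta>) Xs + e * swedge s \<alpha> (?P (ext_d C \<beta>)) Xs)"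
    by (simp only: pairing_swedge[OF s(2,1) r]
        pairing_swedge[OF has_parity_ext_d[OF \<alpha> s(2)] sign_uminus[OF s(1)] r] e_def e'_def)
  finally have 2: "?P (ext_d C (swedge s \<alpha> \<beta>)) Xs = \<dots>" .
  show ?thesis
    unfolding pairing_commutator_apply[of "swedge s \<alpha> \<beta>"] 1 2
    unfolding pairing_commutator_def swedge_add swedge_fun_times_form e_def e'_def
    using r s(1) by (elim disjE) (simp_all add: neq algebra_simps)
qed

lemma derivation_like_pairing_commutator: "derivation_like (- r) pairing_commutator"
  unfolding derivation_like_def
proof (intro conjI allI ballI impI)
  fix k \<omega> \<eta> and Xs :: "'m vfield list"
  assume "\<omega> \<in> forms_deg C k" "\<eta> \<in> forms_deg C k"
  then have a: "alt \<omega>" "alt \<eta>" by (auto dest: forms_degD)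
  have "pairing r \<sigma> (\<omega> + \<eta>) = pairing r \<sigma> \<omega> + pairing r \<sigma> \<eta>"
    "ext_d C (\<omega> + \<eta>) = ext_d C \<omega> + ext_d C \<eta>"
    by (rule ext, simp add: pairing_add_right ext_d_add a form_apply)+
  then show "pairing_commutator (\<omega> + \<eta>) Xs = pairing_commutator \<omega> Xs + pairing_commutator \<eta> Xs"
    by (simp add: pairing_commutator_apply ext_d_add alternating_pairing \<sigma> a r
        pairing_add_right algebra_simps)
next
  fix k \<omega> f and Xs :: "'m vfield list"
  assume a: "\<omega> \<in> forms_deg C k" "f \<in> C" "set Xs \<subseteq> VF"
  show "pairing_commutator (fun_times_form f \<omega>) Xs =
      swedge (- r) (pairing_commutator (zero_form f)) \<omega> Xs + f * pairing_commutator \<omega> Xs"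
    using pairing_commutator_swedge[OF alternating_zero_form[OF a(2)] forms_degD(1)[OF a(1)] _
        has_parity_zero_form a(3)]
    by (simp add: swedge_zero_form) (simp add: fun_times_form_def)
next
  fix k \<omega> f and Xs :: "'m vfield list"
  assume a: "\<omega> \<in> forms_deg C k" "f \<in> C" "set Xs \<subseteq> VF"
  have neq: "(1 :: 'm \<Rightarrow> real) \<noteq> - 1" "- 1 \<noteq> (1 :: 'm \<Rightarrow> real)"
    by (simp_all add: fun_eq_iff fun_apply)
  show "pairing_commutator (swedge (- 1) (differential f) \<omega>) Xs =
      swedge (- (- r)) (pairing_commutator (differential f)) \<omega> Xs +
      - r * swedge (- 1) (differential f) (pairing_commutator \<omega>) Xs"
    using pairing_commutator_swedge[OF alternating_differential[OF a(2)] forms_degD(1)[OF a(1)] _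
        has_parity_ext_d[OF alternating_zero_form[OF a(2)] has_parity_zero_form] a(3)]
    by (simp add: neq)
qed

lemma pairing_commutator_zero_form:
  assumes "f \<in> C"
  shows "pairing_commutator (zero_form f) Xs = r * \<sigma> (hamiltonian f # Xs)"
  by (simp add: pairing_commutator_apply pairing_zero_form ext_d_zero
      pairing_differential[OF \<sigma> assms r] form_apply(3) form_apply(4)[of Xs]) (simp add: contract_apply)

lemma pairing_commutator_differential:
  assumes "f \<in> C"
  shows "pairing_commutator (differential f) Xs = - ext_d C (contract (hamiltonian f) \<sigma>) Xs"
  by (simp add: pairing_commutator_apply ext_d_differential assms pairing_zero_right
      pairing_differential[OF \<sigma> assms r] ext_d_uminus alternating_contract \<sigma> form_apply(4)[of Xs])

end

context
  fixes B :: "'m form \<Rightarrow> 'm form \<Rightarrow> 'm form"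
  assumes B: "koszul_bracket C \<pi> B"
begin

lemma bracket_add_left:
  "\<omega> \<in> forms C \<Longrightarrow> \<omega>' \<in> forms C \<Longrightarrow> \<eta> \<in> forms C \<Longrightarrow> B (\<omega> + \<omega>') \<eta> = B \<omega> \<eta> + B \<omega>' \<eta>"
  using B[unfolded koszul_bracket_def, THEN conjunct2, THEN conjunct1] by blast

lemma bracket_add_right:
  "\<omega> \<in> forms C \<Longrightarrow> \<omega>' \<in> forms C \<Longrightarrow> \<eta> \<in> forms C \<Longrightarrow> B \<eta> (\<omega> + \<omega>') = B \<eta> \<omega> + B \<eta> \<omega>'"
  using B[unfolded koszul_bracket_def, THEN conjunct2, THEN conjunct1] by blast

lemma bracket_deg:
  "\<omega> \<in> forms_deg C k \<Longrightarrow> \<eta> \<in> forms_deg C l \<Longrightarrow> k + l \<ge> 1 \<Longrightarrow> B \<omega> \<eta> \<in> forms_deg C (k + l - 1)"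
  using B[unfolded koszul_bracket_def] by blast

lemma bracket_functions: "f \<in> C \<Longrightarrow> g \<in> C \<Longrightarrow> B (zero_form f) (zero_form g) = 0"
  using B[unfolded koszul_bracket_def] by blast

lemma bracket_one_form_function:
  "\<alpha> \<in> forms_deg C 1 \<Longrightarrow> f \<in> C \<Longrightarrow> B \<alpha> (zero_form f) = lie_derivative C (sharp C \<pi> \<alpha>) (zero_form f)"
  using B[unfolded koszul_bracket_def] by blast

lemma bracket_one_forms:
  "\<alpha> \<in> forms_deg C 1 \<Longrightarrow> \<beta> \<in> forms_deg C 1 \<Longrightarrow>
    B \<alpha> \<beta> = - ext_d C (zero_form (\<pi> \<alpha> \<beta>))
          + lie_derivative C (sharp C \<pi> \<alpha>) \<beta> - lie_derivative C (sharp C \<pi> \<beta>) \<alpha>"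
  using B[unfolded koszul_bracket_def] by blast

lemma bracket_wedge:
  "\<omega>1 \<in> forms_deg C k1 \<Longrightarrow> \<omega>2 \<in> forms_deg C k2 \<Longrightarrow> \<omega>3 \<in> forms_deg C k3 \<Longrightarrow>
    B \<omega>1 (wedge \<omega>2 \<omega>3) = wedge (B \<omega>1 \<omega>2) \<omega>3
          + scale_form ((-1) powi (shifted_deg k1 * (shifted_deg k2 + 1))) (wedge \<omega>2 (B \<omega>1 \<omega>3))"
  using B[unfolded koszul_bracket_def] by blast

lemma bracket_antisym:
  "\<omega>1 \<in> forms_deg C k1 \<Longrightarrow> \<omega>2 \<in> forms_deg C k2 \<Longrightarrow>
    B \<omega>1 \<omega>2 = - scale_form ((-1) powi (shifted_deg k1 * shifted_deg k2)) (B \<omega>2 \<omega>1)"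
  using B[unfolded koszul_bracket_def] by blast

text \<open>
  For a form of degree \<open>k\<close> the shifted degree is \<open>k - 1\<close>, so the parity is \<open>- (-1)\<^sup>k\<close>.  For \<open>k = 0\<close> the
  bracket of two functions has no degree at all, but it vanishes.
\<close>

lemma derivation_like_bracket:
  assumes \<sigma>: "\<sigma> \<in> forms_deg C k"
  shows "derivation_like (- ((- 1) ^ k)) (B \<sigma>)"
  unfolding derivation_like_def
proof (intro conjI allI ballI impI)
  fix l \<omega> \<eta> and Xs :: "'m vfield list"
  assume "\<omega> \<in> forms_deg C l" "\<eta> \<in> forms_deg C l"
  then show "B \<sigma> (\<omega> + \<eta>) Xs = B \<sigma> \<omega> Xs + B \<sigma> \<eta> Xs"
    using bracket_add_right forms_degD(3) \<sigma> by (metis form_apply(1))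
next
  fix l \<omega> f and Xs :: "'m vfield list"
  assume a: "\<omega> \<in> forms_deg C l" "f \<in> C" "set Xs \<subseteq> VF"
  have "has_parity (- ((- 1) ^ k)) (B \<sigma> (zero_form f))"
  proof (cases k)
    case 0
    then have "B \<sigma> (zero_form f) = 0"
      using forms_deg_0_eq[of \<sigma>] \<sigma> bracket_functions[OF _ a(2)] by metis
    then show ?thesis by (simp add: has_parity_def form_apply(4))
  next
    case (Suc m)
    then show ?thesis
      using bracket_deg[OF \<sigma> forms_deg_zero_form[OF a(2)]] forms_deg_has_parity by fastforce
  qed
  then have "wedge (B \<sigma> (zero_form f)) \<omega> = swedge (- ((- 1) ^ k)) (B \<sigma> (zero_form f)) \<omega>"
    by (rule wedge_eq_swedge)
  then have "B \<sigma> (fun_times_form f \<omega>) = swedge (- ((- 1) ^ k)) (B \<sigma> (zero_form f)) \<omega> + fun_times_form f (B \<sigma> \<omega>)"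
    using bracket_wedge[OF \<sigma> forms_deg_zero_form[OF a(2)] a(1)]
    by (simp add: wedge_forms_deg[OF forms_deg_zero_form[OF a(2)]] swedge_zero_form shifted_deg_def scale_form_def)
  then show "B \<sigma> (fun_times_form f \<omega>) Xs =
      swedge (- ((- 1) ^ k)) (B \<sigma> (zero_form f)) \<omega> Xs + f * B \<sigma> \<omega> Xs"
    by (simp only: form_apply(1) fun_times_form_def)
next
  fix l \<omega> f and Xs :: "'m vfield list"
  assume a: "\<omega> \<in> forms_deg C l" "f \<in> C" "set Xs \<subseteq> VF"
  note d = forms_deg_differential[OF a(2)]
  have "B \<sigma> (differential f) \<in> forms_deg C k"
    using bracket_deg[OF \<sigma> d] by simp
  then have w: "wedge (B \<sigma> (differential f)) \<omega> = swedge ((- 1) ^ k) (B \<sigma> (differential f)) \<omega>"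
    by (rule wedge_forms_deg)
  have "B \<sigma> (swedge (- 1) (differential f) \<omega>) = swedge ((- 1) ^ k) (B \<sigma> (differential f)) \<omega> +
      fun_times_form (- ((- 1) ^ k)) (swedge (- 1) (differential f) (B \<sigma> \<omega>))"
    using bracket_wedge[OF \<sigma> d a(1)]
    by (simp add: w wedge_forms_deg[OF d] shifted_deg_def scale_form_eq minus_one_powi del: One_nat_def)
  then show "B \<sigma> (swedge (- 1) (differential f) \<omega>) Xs =
      swedge (- (- ((- 1) ^ k))) (B \<sigma> (differential f)) \<omega> Xs +
      - ((- 1) ^ k) * swedge (- 1) (differential f) (B \<sigma> \<omega>) Xs"
    by (simp add: form_apply(1)) (simp add: fun_times_form_def)
qed

lemma bracket_function_differential:
  assumes "f \<in> C" "g \<in> C"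
  shows "B (zero_form f) (differential g) = zero_form (hamiltonian f g)"
proof -
  have "B (zero_form f) (differential g) = - B (differential g) (zero_form f)"
    using bracket_antisym[OF forms_deg_zero_form[OF assms(1)] forms_deg_differential[OF assms(2)]]
    by (simp add: shifted_deg_def scale_form_def)
  also have "B (differential g) (zero_form f) = zero_form (hamiltonian g f)"
    using assms by (simp add: bracket_one_form_function forms_deg_differential lie_derivative_zero_form
        sharp_vector_field del: One_nat_def)
  also have "hamiltonian g f = - hamiltonian f g"
    using bivector_antisym[OF forms_deg_differential[OF assms(1)] forms_deg_differential[OF assms(2)]] assms
    by (simp add: sharp_def)
  finally show ?thesis
    by (simp add: fun_eq_iff[of "_ :: 'm form"] form_apply zero_form_def)
qed

text \<open>
  Both sides are derivations of degree \<open>-1\<close>, and both map \<open>dg\<close> to \<open>\<pi>(df, dg)\<close>.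
\<close>

lemma bracket_function:
  assumes "f \<in> C" "\<omega> \<in> forms_deg C k" "set Xs \<subseteq> VF"
  shows "B (zero_form f) \<omega> Xs = contract (hamiltonian f) \<omega> Xs"
proof -
  note h = sharp_vector_field[OF forms_deg_differential[OF assms(1)]]
  have "derivation_like (- 1) (B (zero_form f))"
    using derivation_like_bracket[OF forms_deg_zero_form[OF assms(1)]] by simp
  from derivation_like_unique[OF this derivation_like_contract[OF h] _ _ assms(2,3)]
  show ?thesis
    by (simp add: bracket_functions contract_zero_form assms(1) bracket_function_differential
        contract_differential h)
qed

text \<open>
  Both sides are derivations of degree 0.  On \<open>dg\<close> the formula for 1-forms has three terms, of which
  \<open>- d \<pi>(df, dg)\<close> and \<open>- L\<^bsub>X\<^sub>g\<^esub> df = - d (X\<^sub>g f)\<close> cancel.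
\<close>

lemma bracket_differential:
  assumes f: "f \<in> C" "\<omega> \<in> forms_deg C k" "set Xs \<subseteq> VF"
  shows "B (differential f) \<omega> Xs = lie_derivative C (hamiltonian f) \<omega> Xs"
proof -
  note d = forms_deg_differential[OF assms(1)]
  note h = sharp_vector_field[OF d]
  have "derivation_like 1 (B (differential f))"
    using derivation_like_bracket[OF d] by simp
  note u = derivation_like_unique[OF this derivation_like_lie_derivative[OF h] _ _ assms(2,3)]
  show ?thesis
  proof (rule u)
    fix g and Xs :: "'m vfield list" assume g: "g \<in> C" and Xs: "set Xs \<subseteq> VF"
    show "B (differential f) (zero_form g) Xs = lie_derivative C (hamiltonian f) (zero_form g) Xs"
      by (simp only: bracket_one_form_function[OF d g])
    note dg = forms_deg_differential[OF g]
    note hg = sharp_vector_field[OF dg]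
    have "lie_derivative C (hamiltonian g) (differential f) =
        - differential (\<pi> (differential f) (differential g))"
    proof
      fix Ys
      have "lie_derivative C (hamiltonian g) (differential f) Ys = differential (hamiltonian g f) Ys"
        using ext_d_Cons[OF alternating_differential[OF f(1)] hg, of Ys]
        by (simp add: ext_d_differential f(1) contract_differential hg form_apply(4)[of "_ # _"])
      also have "zero_form (hamiltonian g f) = - zero_form (\<pi> (differential f) (differential g))"
        using bivector_antisym[OF d dg] f(1)
        by (simp add: sharp_def fun_eq_iff[of "_ :: 'm form"] form_apply zero_form_def)
      finally show "lie_derivative C (hamiltonian g) (differential f) Ys =
          (- differential (\<pi> (differential f) (differential g))) Ys"
        using bivector_mem[OF d dg] by (simp add: ext_d_uminus alternating_zero_form
            form_apply(3)[of "differential _" Ys])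
    qed
    then show "B (differential f) (differential g) Xs = lie_derivative C (hamiltonian f) (differential g) Xs"
      by (simp add: bracket_one_forms[OF d dg])
  qed
qed

text \<open>
  The heart of the proof.  By antisymmetry \<open>{\<sigma>, f} = r \<iota>\<^bsub>X\<^sub>f\<^esub> \<sigma>\<close> and \<open>{\<sigma>, df} = - L\<^bsub>X\<^sub>f\<^esub> \<sigma>\<close>, and since
  \<open>\<sigma>\<close> is closed the latter is \<open>- d \<iota>\<^bsub>X\<^sub>f\<^esub> \<sigma>\<close>.  These are also the values of \<open>[d, P]\<close>, so the derivations
  \<open>{\<sigma>, \<cdot>}\<close> and \<open>[d, P]\<close> coincide; on a closed form \<open>[d, P]\<close> reduces to \<open>d P\<close>.
\<close>

theorem bracket_closed_homogeneous:
  assumes \<sigma>: "\<sigma> \<in> forms_deg C k" "ext_d C \<sigma> = 0" and \<omega>: "\<omega> \<in> forms_deg C l" "ext_d C \<omega> = 0"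
  shows "B \<sigma> \<omega> = ext_d C (pairing ((- 1) ^ k) \<sigma> \<omega>)"
proof
  fix Xs :: "'m vfield list"
  define r where "r = ((- 1) ^ k :: 'm \<Rightarrow> real)"
  have r: "r = 1 \<or> r = - 1"
    by (cases "even k") (simp_all add: r_def)
  note a = forms_degD(1)[OF \<sigma>(1)]
  show "B \<sigma> \<omega> Xs = ext_d C (pairing ((- 1) ^ k) \<sigma> \<omega>) Xs"
  proof (cases "set Xs \<subseteq> VF")
    case True
    have D: "derivation_like (- r) (B \<sigma>)"
      using derivation_like_bracket[OF \<sigma>(1)] by (simp add: r_def)
    have "B \<sigma> \<omega> Xs = pairing_commutator \<sigma> r \<omega> Xs"
    proof (rule derivation_like_unique[OF D derivation_like_pairing_commutator[OF a r] _ _ \<omega>(1) True])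
      fix f and Ys :: "'m vfield list" assume f: "f \<in> C" and Ys: "set Ys \<subseteq> VF"
      have "B \<sigma> (zero_form f) = fun_times_form r (B (zero_form f) \<sigma>)"
        using bracket_antisym[OF \<sigma>(1) forms_deg_zero_form[OF f]]
        by (simp add: shifted_deg_def minus_one_powi' del: minus_diff_eq)
           (simp add: scale_form_eq minus_one_powi r_def fun_eq_iff[of "_ :: 'm form"] form_apply fun_times_form_def)
      then show "B \<sigma> (zero_form f) Ys = pairing_commutator \<sigma> r (zero_form f) Ys"
        by (simp add: pairing_commutator_zero_form[OF a r f] fun_times_form_def bracket_function[OF f \<sigma>(1) Ys])
           (simp add: contract_apply)
      note df = forms_deg_differential[OF f]
      note h = sharp_vector_field[OF df]
      have "B \<sigma> (differential f) = - B (differential f) \<sigma>"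
        using bracket_antisym[OF \<sigma>(1) df] by (simp add: shifted_deg_def scale_form_def)
      \<comment> \<open>closedness of \<open>\<sigma>\<close> makes the Lie derivative exact\<close>
      moreover have "lie_derivative C (hamiltonian f) \<sigma> Ys = ext_d C (contract (hamiltonian f) \<sigma>) Ys"
        using ext_d_Cons[OF a h, of Ys] by (simp add: \<sigma>(2) form_apply(4)[of "_ # _"])
      ultimately show "B \<sigma> (differential f) Ys = pairing_commutator \<sigma> r (differential f) Ys"
        by (simp add: pairing_commutator_differential[OF a r f] form_apply(3) bracket_differential[OF f \<sigma>(1) Ys])
    qed
    also have "\<dots> = ext_d C (pairing r \<sigma> \<omega>) Xs"
      by (simp add: pairing_commutator_apply[OF a r] \<omega>(2) pairing_zero_right form_apply(4)[of Xs])
    finally show ?thesis by (simp only: r_def)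
  next
    case False
    have "B \<sigma> \<omega> \<in> forms C"
      using B[unfolded koszul_bracket_def, THEN conjunct1] forms_degD(3)[OF \<sigma>(1)] forms_degD(3)[OF \<omega>(1)]
      by blast
    then show ?thesis
      using False by (simp add: ext_d_off alternating_off forms_alternating)
  qed
qed

lemma bracket_closed_homogeneous_exact:
  assumes "\<sigma> \<in> forms_deg C k" "ext_d C \<sigma> = 0" "\<omega> \<in> forms_deg C l" "ext_d C \<omega> = 0"
  shows "exact_form C (B \<sigma> \<omega>)"
proof -
  have "pairing ((- 1) ^ k) \<sigma> \<omega> \<in> forms C"
  proof (rule alternating_forms)
    have "(- 1) ^ k = (1 :: 'm \<Rightarrow> real) \<or> (- 1) ^ k = (- 1 :: 'm \<Rightarrow> real)"
      by (cases "even k") simp_all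
    then show "alt (pairing ((- 1) ^ k) \<sigma> \<omega>)"
      using assms forms_degD(1) by (intro alternating_pairing) auto
    fix Xs :: "'m vfield list" assume "length Xs > Suc k + Suc l"
    then show "pairing ((- 1) ^ k) \<sigma> \<omega> Xs = 0"
      using assms forms_degD(1,2) by (intro pairing_bounded[of "Suc k" _ "Suc l"]) auto
  qed
  then show ?thesis
    using bracket_closed_homogeneous[OF assms] unfolding exact_form_def by blast
qed

theorem bracket_closed_exact:
  assumes "closed_form C \<omega>1" "closed_form C \<omega>2"
  shows "exact_form C (B \<omega>1 \<omega>2)"
proof -
  obtain M where M: "\<omega>1 = (\<Sum>k<(M::nat). homogeneous_part k \<omega>1)"
    and 1: "\<And>k. homogeneous_part k \<omega>1 \<in> forms_deg C k" "\<And>k. ext_d C (homogeneous_part k \<omega>1) = 0"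
    using closed_form_decompose[OF assms(1)] by blast
  obtain N where N: "\<omega>2 = (\<Sum>k<(N::nat). homogeneous_part k \<omega>2)"
    and 2: "\<And>k. homogeneous_part k \<omega>2 \<in> forms_deg C k" "\<And>k. ext_d C (homogeneous_part k \<omega>2) = 0"
    using closed_form_decompose[OF assms(2)] by blast
  have zero: "0 \<in> forms C"
    using forms_deg_zero forms_degD(3) by blast
  have right: "exact_form C (B (homogeneous_part k \<omega>1) (\<Sum>k<n. homogeneous_part k \<omega>2))" for k n
  proof (induction n)
    case 0
    have "B (homogeneous_part k \<omega>1) 0 = 0"
      using bracket_add_right[OF zero zero forms_degD(3)[OF 1(1)], of k] by simp
    then show ?case by (simp add: exact_form_zero)
  next
    case (Suc n)
    have "(\<Sum>k<n. homogeneous_part k \<omega>2) \<in> forms C"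
      by (rule forms_sum[of _ _ "\<lambda>k. k"]) (simp_all add: 2)
    then have "B (homogeneous_part k \<omega>1) (\<Sum>k<Suc n. homogeneous_part k \<omega>2) =
        B (homogeneous_part k \<omega>1) (\<Sum>k<n. homogeneous_part k \<omega>2) +
        B (homogeneous_part k \<omega>1) (homogeneous_part n \<omega>2)"
      using bracket_add_right[OF _ forms_degD(3)[OF 2(1)] forms_degD(3)[OF 1(1)]] by simp
    then show ?case
      using exact_form_add[OF Suc.IH bracket_closed_homogeneous_exact[OF 1 2]] by simp
  qed
  have "exact_form C (B (\<Sum>k<m. homogeneous_part k \<omega>1) \<omega>2)" for m
  proof (induction m)
    case 0
    have "\<omega>2 \<in> forms C" using assms by (simp add: closed_form_def)
    then have "B 0 \<omega>2 = 0"
      using bracket_add_left[OF zero zero, of \<omega>2] by simp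
    then show ?case by (simp add: exact_form_zero)
  next
    case (Suc m)
    have "(\<Sum>k<m. homogeneous_part k \<omega>1) \<in> forms C"
      by (rule forms_sum[of _ _ "\<lambda>k. k"]) (simp_all add: 1)
    moreover have "\<omega>2 \<in> forms C" using assms by (simp add: closed_form_def)
    ultimately have "B (\<Sum>k<Suc m. homogeneous_part k \<omega>1) \<omega>2 =
        B (\<Sum>k<m. homogeneous_part k \<omega>1) \<omega>2 + B (homogeneous_part m \<omega>1) \<omega>2"
      using bracket_add_left[OF _ forms_degD(3)[OF 1(1)]] by simp
    moreover have "exact_form C (B (homogeneous_part m \<omega>1) \<omega>2)"
      using right[of m N] N by simp
    ultimately show ?case
      using exact_form_add[OF Suc.IH] by simp
  qed
  then show ?thesis using M by metis
qed

end

end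

section \<open>Calculus on open subsets of coordinate space\<close>

definition coordinate_space :: "nat \<Rightarrow> (nat \<Rightarrow> real) set" where
  "coordinate_space n = {x. \<forall>i\<ge>n. x i = 0}"

text \<open>
  Cubes are the neighbourhoods that suit partial derivatives: one coordinate can be changed without leaving
  them.
\<close>

definition cube :: "nat \<Rightarrow> (nat \<Rightarrow> real) \<Rightarrow> real \<Rightarrow> (nat \<Rightarrow> real) set" where
  "cube n a r = {x \<in> coordinate_space n. \<forall>i<n. \<bar>x i - a i\<bar> < r}"

lemma Euclidean_space_eq: "Euclidean_space n = top_of_set (coordinate_space n)"
  by (simp add: Euclidean_space_def coordinate_space_def euclidean_product_topology)

abbreviation open_in_space :: "nat \<Rightarrow> (nat \<Rightarrow> real) set \<Rightarrow> bool" where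
  "open_in_space n V \<equiv> openin (top_of_set (coordinate_space n)) V"

lemma open_in_space_subset: "open_in_space n V \<Longrightarrow> V \<subseteq> coordinate_space n"
  by (rule openin_imp_subset)

lemma open_in_space_cube: "open_in_space n (cube n a r)"
proof -
  have "open {x :: nat \<Rightarrow> real. \<bar>x i - a i\<bar> < r}" for i
    by (intro open_Collect_less continuous_intros continuous_on_product_coordinates)
  then have "open (\<Inter>i\<in>{..<n}. {x :: nat \<Rightarrow> real. \<bar>x i - a i\<bar> < r})"
    by (intro open_INT) auto
  moreover have "cube n a r = coordinate_space n \<inter> (\<Inter>i\<in>{..<n}. {x. \<bar>x i - a i\<bar> < r})"
    by (auto simp: cube_def)
  ultimately show ?thesis
    by (auto simp: openin_open)
qed

lemma mem_cube_center: "a \<in> coordinate_space n \<Longrightarrow> r > 0 \<Longrightarrow> a \<in> cube n a r"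
  by (simp add: cube_def)

lemma open_in_space_contains_cube:
  assumes "open_in_space n V" "a \<in> V"
  obtains r where "r > 0" "cube n a r \<subseteq> V"
proof -
  obtain T where T: "open T" "V = coordinate_space n \<inter> T"
    using assms(1) by (auto simp: openin_open)
  have T': "openin (product_topology (\<lambda>i. euclidean) UNIV) T" "a \<in> T"
    using T assms(2) by (auto simp: open_fun_def)
  obtain U where U: "a \<in> Pi\<^sub>E UNIV U" "\<And>i. open (U i)" "Pi\<^sub>E UNIV U \<subseteq> T"
    using product_topology_open_contains_basis[OF T'] by auto
  have "\<exists>e>0. \<forall>t. \<bar>t - a i\<bar> < e \<longrightarrow> t \<in> U i" for i
  proof -
    have "open (U i)" "a i \<in> U i"
      using U(1) U(2)[of i] by (auto simp: PiE_iff)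
    then show ?thesis
      unfolding open_dist by (metis dist_real_def)
  qed
  then obtain e where e: "\<And>i. e i > 0" "\<And>i t. \<bar>t - a i\<bar> < e i \<Longrightarrow> t \<in> U i"
    by metis
  define r where "r = Min (insert 1 (e ` {..<n}))"
  have r: "r > 0" "\<And>i. i < n \<Longrightarrow> r \<le> e i"
    by (auto simp: r_def e(1))
  have "cube n a r \<subseteq> V"
  proof
    fix x assume x: "x \<in> cube n a r"
    have "x i \<in> U i" for i
    proof (cases "i < n")
      case True
      then show ?thesis
        using x r(2)[of i] by (intro e(2)) (force simp: cube_def)
    next
      case False
      then have "x i = a i"
        using x assms(2) T(2) by (simp add: cube_def coordinate_space_def)
      then show ?thesis using U(1) by (auto simp: PiE_iff)
    qed
    then have "x \<in> T" using U(3) by auto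
    then show "x \<in> V" using T(2) x by (simp add: cube_def)
  qed
  then show ?thesis using that r(1) by blast
qed

lemma continuous_on_cube:
  fixes G :: "(nat \<Rightarrow> real) \<Rightarrow> real"
  assumes "continuous_on V G" "open_in_space n V" "a \<in> V" "e > 0"
  obtains r where "r > 0" "cube n a r \<subseteq> V" "\<And>x. x \<in> cube n a r \<Longrightarrow> \<bar>G x - G a\<bar> < e"
proof -
  have "openin (top_of_set V) (V \<inter> G -` ball (G a) e)"
    using assms(1) by (rule continuous_openin_preimage_gen) simp
  then have o: "open_in_space n (V \<inter> G -` ball (G a) e)"
    using assms(2) by (rule openin_trans)
  have "a \<in> V \<inter> G -` ball (G a) e"
    using assms(3,4) by simp
  then obtain r where "r > 0" "cube n a r \<subseteq> V \<inter> G -` ball (G a) e"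
    using open_in_space_contains_cube[OF o] by blast
  moreover from this have "\<bar>G x - G a\<bar> < e" if "x \<in> cube n a r" for x
    using that by (force simp: dist_real_def)
  ultimately show ?thesis
    using that[of r] by blast
qed

lemma fun_upd_mem_cube:
  assumes "x \<in> cube n a r" "i < n" "\<bar>t - a i\<bar> < r"
  shows "x(i := t) \<in> cube n a r"
  using assms by (auto simp: cube_def coordinate_space_def)

lemma eventually_fun_upd_mem:
  assumes "open_in_space n V" "x \<in> V" "i < n"
  shows "eventually (\<lambda>t. x(i := t) \<in> V) (nhds (x i))"
proof -
  obtain r where r: "r > 0" "cube n x r \<subseteq> V"
    using open_in_space_contains_cube[OF assms(1,2)] .
  have x: "x \<in> cube n x r"
    using assms(1,2) r(1) by (intro mem_cube_center) (auto dest: open_in_space_subset)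
  have "eventually (\<lambda>t. dist t (x i) < r) (nhds (x i))"
    using r(1) by (auto simp: eventually_nhds_metric)
  then show ?thesis
    by eventually_elim (use r(2) fun_upd_mem_cube[OF x assms(3)] in \<open>auto simp: dist_real_def\<close>)
qed

lemma has_real_derivative_eventually_cong:
  fixes f g :: "real \<Rightarrow> real"
  assumes "(f has_field_derivative D) (at x)" "eventually (\<lambda>t. f t = g t) (nhds x)"
  shows "(g has_field_derivative D) (at x)"
  using assms(1) DERIV_cong_ev[OF refl assms(2) refl] by simp

lemma partial_deriv_eqI:
  assumes "((\<lambda>t. F (x(i := t))) has_field_derivative D) (at (x i))"
  shows "partial_deriv i F x = D"
  using assms by (simp add: partial_deriv_def DERIV_imp_deriv)

lemma C_k_on_continuous: "C_k_on n k V F \<Longrightarrow> continuous_on V F"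
  by (cases k) simp_all

lemma C_k_on_partial_deriv: "C_k_on n (Suc k) V F \<Longrightarrow> i < n \<Longrightarrow> C_k_on n k V (partial_deriv i F)"
  by simp

lemma C_k_on_has_partial_deriv:
  "C_k_on n (Suc k) V F \<Longrightarrow> i < n \<Longrightarrow> x \<in> V \<Longrightarrow>
    ((\<lambda>t. F (x(i := t))) has_field_derivative partial_deriv i F x) (at (x i))"
  by (simp add: partial_deriv_def DERIV_deriv_iff_real_differentiable)

lemma C_k_on_Suc_imp: "C_k_on n (Suc k) V F \<Longrightarrow> C_k_on n k V F"
proof (induction k arbitrary: F)
  case (Suc k)
  then show ?case
    by (auto simp only: C_k_on.simps)
qed simp

lemma C_k_on_subset: "C_k_on n k V F \<Longrightarrow> W \<subseteq> V \<Longrightarrow> C_k_on n k W F"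
  by (induction k arbitrary: F) (auto intro: continuous_on_subset)

lemma C_k_on_SucI:
  assumes "continuous_on V F"
    and "\<And>i x. i < n \<Longrightarrow> x \<in> V \<Longrightarrow> ((\<lambda>t. F (x(i := t))) has_field_derivative D i x) (at (x i))"
    and "\<And>i. i < n \<Longrightarrow> C_k_on n k V (partial_deriv i F)"
  shows "C_k_on n (Suc k) V F"
  using assms by (auto simp: real_differentiable_def)

text \<open>
  A partial derivative at a point of \<open>V\<close> depends only on values in \<open>V\<close>, because \<open>V\<close> is open.
\<close>

lemma C_k_on_cong:
  assumes V: "open_in_space n V" and eq: "\<And>x. x \<in> V \<Longrightarrow> F x = G x" and F: "C_k_on n k V F"
  shows "C_k_on n k V G"
  using eq F
proof (induction k arbitrary: F G)
  case 0
  then show ?case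
    using continuous_on_cong[of V V F G] by simp
next
  case (Suc k)
  have ev: "eventually (\<lambda>t. F (x(i := t)) = G (x(i := t))) (nhds (x i))" if "x \<in> V" "i < n" for x i
    using eventually_fun_upd_mem[OF V that] by eventually_elim (rule Suc.prems(1))
  have der: "((\<lambda>t. G (x(i := t))) has_field_derivative partial_deriv i F x) (at (x i))"
    if "i < n" "x \<in> V" for i x
    using C_k_on_has_partial_deriv[OF Suc.prems(2) that] DERIV_cong_ev[OF refl ev[OF that(2,1)] refl]
    by blast
  show ?case
  proof (rule C_k_on_SucI)
    show "continuous_on V G"
      using C_k_on_continuous[OF Suc.prems(2)] Suc.prems(1) continuous_on_cong[of V V F G] by simp
    show "C_k_on n k V (partial_deriv i G)" if "i < n" for i
      by (rule Suc.IH[of "partial_deriv i F"])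
         (use that Suc.prems(2) partial_deriv_eqI[OF der[OF that], symmetric] in auto)
  qed (rule der)
qed

lemma C_k_on_local:
  assumes V: "open_in_space n V"
    and loc: "\<And>x. x \<in> V \<Longrightarrow> \<exists>W. open_in_space n W \<and> x \<in> W \<and> C_k_on n k W F"
  shows "C_k_on n k V F"
  using loc
proof (induction k arbitrary: F)
  case 0
  have "continuous (at x within V) F" if x: "x \<in> V" for x
  proof -
    obtain W where W: "open_in_space n W" "x \<in> W" "continuous_on W F"
      using 0 x by auto
    obtain T where T: "open T" "W = coordinate_space n \<inter> T"
      using W(1) by (auto simp: openin_open)
    have "at x within V = at x within (V \<inter> W)"
      using T W(2) open_in_space_subset[OF V] by (intro at_within_nhd[of x T]) auto
    moreover have "continuous (at x within (V \<inter> W)) F"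
      using W(2,3) x by (metis IntI continuous_on_eq_continuous_within continuous_on_subset inf_le2)
    ultimately show ?thesis by simp
  qed
  then show ?case
    by (simp add: continuous_on_eq_continuous_within)
next
  case (Suc k)
  have "C_k_on n 0 V F"
  proof -
    have "\<exists>W. open_in_space n W \<and> x \<in> W \<and> C_k_on n k W F" if "x \<in> V" for x
      using Suc.prems[OF that] C_k_on_Suc_imp by blast
    then have "C_k_on n k V F" by (rule Suc.IH)
    then show ?thesis using C_k_on_continuous by auto
  qed
  then have "continuous_on V F" by simp
  then show ?case
  proof (rule C_k_on_SucI)
    fix i assume i: "i < n"
    show "((\<lambda>t. F (x(i := t))) has_field_derivative partial_deriv i F x) (at (x i))" if "x \<in> V" for x
      using Suc.prems[OF that] C_k_on_has_partial_deriv[OF _ i] by blast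
    show "C_k_on n k V (partial_deriv i F)"
      using Suc.prems C_k_on_partial_deriv[OF _ i] by (intro Suc.IH) blast
  qed
qed

lemma C_k_on_const: "C_k_on n k V (\<lambda>_. c)"
proof (induction k arbitrary: c)
  case (Suc k)
  have "partial_deriv i (\<lambda>_. c) = (\<lambda>_. 0)" for i
    by (simp add: partial_deriv_def fun_eq_iff)
  then show ?case using Suc by simp
qed simp

lemma C_k_on_coordinate: "C_k_on n k V (\<lambda>x. x i)"
proof (cases k)
  case (Suc k)
  have d: "((\<lambda>t. (x(j := t)) i) has_field_derivative (if i = j then 1 else 0)) (at (x j))" for x :: "nat \<Rightarrow> real" and j
    by simp
  have c: "continuous_on V (\<lambda>x. x i)"
    by (rule continuous_on_subset[OF continuous_on_product_coordinates]) simp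
  have "partial_deriv j (\<lambda>x. x i) = (\<lambda>_. if i = j then 1 else 0)" for j
    by (rule ext) (rule partial_deriv_eqI[OF d])
  then show ?thesis
    unfolding Suc by (intro C_k_on_SucI[OF c d]) (simp add: C_k_on_const)
qed (simp add: continuous_on_subset[OF continuous_on_product_coordinates])

lemma C_k_on_add:
  assumes V: "open_in_space n V" and F: "C_k_on n k V F" and G: "C_k_on n k V G"
  shows "C_k_on n k V (\<lambda>x. F x + G x)"
  using F G
proof (induction k arbitrary: F G)
  case (Suc k)
  have d: "((\<lambda>t. F (x(i := t)) + G (x(i := t))) has_field_derivative partial_deriv i F x + partial_deriv i G x) (at (x i))"
    if "i < n" "x \<in> V" for i x
    using Suc.prems that by (intro DERIV_add C_k_on_has_partial_deriv)
  show ?case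
  proof (rule C_k_on_SucI[OF _ d])
    show "continuous_on V (\<lambda>x. F x + G x)"
      using Suc.prems by (intro continuous_intros C_k_on_continuous)
    show "C_k_on n k V (partial_deriv i (\<lambda>x. F x + G x))" if "i < n" for i
      by (rule C_k_on_cong[OF V partial_deriv_eqI[OF d[OF that], symmetric] Suc.IH])
         (use Suc.prems that in simp_all)
  qed
qed (simp add: continuous_intros)

lemma C_k_on_mult:
  assumes V: "open_in_space n V" and F: "C_k_on n k V F" and G: "C_k_on n k V G"
  shows "C_k_on n k V (\<lambda>x. F x * G x)"
  using F G
proof (induction k arbitrary: F G)
  case (Suc k)
  have d: "((\<lambda>t. F (x(i := t)) * G (x(i := t))) has_field_derivative partial_deriv i F x * G x + partial_deriv i G x * F x) (at (x i))"
    if "i < n" "x \<in> V" for i x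
  proof -
    have "((\<lambda>t. F (x(i := t)) * G (x(i := t))) has_field_derivative
        partial_deriv i F x * G (x(i := x i)) + partial_deriv i G x * F (x(i := x i))) (at (x i))"
      by (rule DERIV_mult[OF C_k_on_has_partial_deriv[OF Suc.prems(1) that] C_k_on_has_partial_deriv[OF Suc.prems(2) that]])
    then show ?thesis by (simp only: fun_upd_triv)
  qed
  show ?case
  proof (rule C_k_on_SucI[OF _ d])
    show "continuous_on V (\<lambda>x. F x * G x)"
      using Suc.prems by (intro continuous_intros C_k_on_continuous)
    show "C_k_on n k V (partial_deriv i (\<lambda>x. F x * G x))" if i: "i < n" for i
    proof (rule C_k_on_cong[OF V])
      show "C_k_on n k V (\<lambda>x. partial_deriv i F x * G x + partial_deriv i G x * F x)"
        by (intro C_k_on_add V Suc.IH C_k_on_partial_deriv[OF Suc.prems(1) i] C_k_on_partial_deriv[OF Suc.prems(2) i]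
            C_k_on_Suc_imp[OF Suc.prems(1)] C_k_on_Suc_imp[OF Suc.prems(2)])
    qed (rule partial_deriv_eqI[OF d[OF i], symmetric])
  qed
qed (simp add: continuous_intros)

lemma C_k_on_sum:
  assumes V: "open_in_space n V" and "\<And>i. i \<in> I \<Longrightarrow> C_k_on n k V (F i)"
  shows "C_k_on n k V (\<lambda>x. \<Sum>i\<in>I. F i x)"
  using assms(2)
  by (induction I rule: infinite_finite_induct) (simp_all add: C_k_on_const C_k_on_add V)

lemma C_k_on_prod:
  assumes V: "open_in_space n V" and "\<And>i. i \<in> I \<Longrightarrow> C_k_on n k V (F i)"
  shows "C_k_on n k V (\<lambda>x. \<Prod>i\<in>I. F i x)"
  using assms(2)
  by (induction I rule: infinite_finite_induct) (simp_all add: C_k_on_const C_k_on_mult V)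

text \<open>
  The chain rule, for which partial differentiability with continuous partial derivatives has to be turned
  into total differentiability.  The coordinates of \<open>c(t)\<close> are switched on one after the other; each step
  changes a single coordinate and is controlled by the mean value theorem.
\<close>

lemma C_1_on_has_derivative_along_curve:
  fixes c :: "real \<Rightarrow> nat \<Rightarrow> real"
  assumes V: "open_in_space n V" and F: "C_k_on n 1 V F" and c0: "c t0 \<in> V"
    and cn: "eventually (\<lambda>t. c t \<in> coordinate_space n) (nhds t0)"
    and c: "\<And>i. i < n \<Longrightarrow> ((\<lambda>t. c t i) has_field_derivative c' i) (at t0)"
  shows "((\<lambda>t. F (c t)) has_field_derivative (\<Sum>i<n. partial_deriv i F (c t0) * c' i)) (at t0)"
proof -
  define z where "z = c t0"
  have z: "z \<in> coordinate_space n" "z \<in> V"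
    using open_in_space_subset[OF V] c0 by (auto simp: z_def)
  \<comment> \<open>the curve with only its first \<open>m\<close> coordinates moving\<close>
  define d where "d m t = (\<lambda>i. if i < m then c t i else z i)" for m t
  have "((\<lambda>t. F (d m t)) has_field_derivative (\<Sum>i<m. partial_deriv i F z * c' i)) (at t0)" if "m \<le> n" for m
    using that
  proof (induction m)
    case 0
    show ?case by (simp add: d_def)
  next
    case (Suc m)
    then have m: "m < n" by simp
    define \<phi> where "\<phi> t = F (d (Suc m) t) - F (d m t)" for t
    have near: "eventually (\<lambda>t. \<forall>i\<in>{..<n}. \<bar>c t i - z i\<bar> < e) (nhds t0)" if "e > 0" for e
    proof (rule eventually_ball_finite)
      show "\<forall>i\<in>{..<n}. eventually (\<lambda>t. \<bar>c t i - z i\<bar> < e) (nhds t0)"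
      proof
        fix i assume "i \<in> {..<n}"
        then have "isCont (\<lambda>t. c t i) t0" using c DERIV_isCont by blast
        then have "((\<lambda>t. c t i) \<longlongrightarrow> z i) (nhds t0)"
          unfolding z_def isCont_def by (rule tendsto_at_iff_tendsto_nhds[THEN iffD1])
        then show "eventually (\<lambda>t. \<bar>c t i - z i\<bar> < e) (nhds t0)"
          using that by (auto dest!: tendstoD simp: dist_real_def)
      qed
    qed simp
    have "((\<lambda>t. (\<phi> t - \<phi> t0) / (t - t0)) \<longlongrightarrow> partial_deriv m F z * c' m) (at t0)"
    proof -
      have phi0: "\<phi> t0 = 0"
      proof -
        have "d j t0 = z" for j
          by (auto simp: d_def z_def)
        then show ?thesis by (simp add: \<phi>_def)
      qed
      obtain R where R: "R > 0" "cube n z R \<subseteq> V"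
        using open_in_space_contains_cube[OF V z(2)] .
      \<comment> \<open>\<open>\<xi>\<close> is an intermediate point as provided by the mean value theorem\<close>
      define good where "good t \<xi> \<longleftrightarrow> \<bar>\<xi> - z m\<bar> \<le> \<bar>c t m - z m\<bar> \<and>
        \<phi> t = partial_deriv m F ((d m t)(m := \<xi>)) * (c t m - z m)" for t \<xi>
      have "eventually (\<lambda>t. \<exists>\<xi>. good t \<xi>) (nhds t0)"
        using near[OF R(1)]
      proof eventually_elim
        case (elim t)
        let ?y = "d m t"
        let ?f = "\<lambda>u. F (?y(m := u))"
        have y: "?y \<in> cube n z R"
          using elim z(1) m R(1) by (auto simp: cube_def d_def coordinate_space_def)
        have up: "?y(m := u) \<in> V" if "\<bar>u - z m\<bar> < R" for u
          using fun_upd_mem_cube[OF y m that] R(2) by blast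
        have der: "DERIV ?f u :> partial_deriv m F (?y(m := u))" if "\<bar>u - z m\<bar> < R" for u
          using C_k_on_has_partial_deriv[of n 0 V F m "?y(m := u)"] F m up[OF that] by simp
        have phi: "\<phi> t = ?f (c t m) - ?f (z m)"
        proof -
          have "d (Suc m) t = ?y(m := c t m)" "?y(m := z m) = ?y"
            by (auto simp: d_def)
          then show ?thesis by (simp add: \<phi>_def)
        qed
        have lt: "\<bar>c t m - z m\<bar> < R"
          using elim m by simp
        consider "c t m = z m" | "z m < c t m" | "c t m < z m" by linarith
        then show ?case
        proof cases
          case 1
          then show ?thesis using phi by (intro exI[of _ "z m"]) (simp add: good_def)
        next
          case 2
          have "\<exists>\<xi>>z m. \<xi> < c t m \<and> ?f (c t m) - ?f (z m) = (c t m - z m) * partial_deriv m F (?y(m := \<xi>))"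
            using lt 2 by (intro MVT2 der) auto
          then obtain \<xi> where "z m < \<xi>" "\<xi> < c t m"
            "?f (c t m) - ?f (z m) = (c t m - z m) * partial_deriv m F (?y(m := \<xi>))" by blast
          then show ?thesis using phi by (intro exI[of _ \<xi>]) (simp add: good_def)
        next
          case 3
          have "\<exists>\<xi>>c t m. \<xi> < z m \<and> ?f (z m) - ?f (c t m) = (z m - c t m) * partial_deriv m F (?y(m := \<xi>))"
            using lt 3 by (intro MVT2 der) auto
          then obtain \<xi> where "c t m < \<xi>" "\<xi> < z m"
            "?f (z m) - ?f (c t m) = (z m - c t m) * partial_deriv m F (?y(m := \<xi>))" by blast
          then show ?thesis using phi by (intro exI[of _ \<xi>]) (simp add: good_def algebra_simps)
        qed
      qed
      then have good: "eventually (\<lambda>t. good t (SOME \<xi>. good t \<xi>)) (nhds t0)"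
        by eventually_elim (rule someI_ex)
      define h where "h t = partial_deriv m F ((d m t)(m := SOME \<xi>. good t \<xi>))" for t
      have "(h \<longlongrightarrow> partial_deriv m F z) (nhds t0)"
      proof (rule tendstoI)
        fix e :: real assume "e > 0"
        have "continuous_on V (partial_deriv m F)"
          using F m by simp
        then obtain r where r: "r > 0" "cube n z r \<subseteq> V"
          "\<And>x. x \<in> cube n z r \<Longrightarrow> \<bar>partial_deriv m F x - partial_deriv m F z\<bar> < e"
          using continuous_on_cube[OF _ V z(2) \<open>e > 0\<close>] by blast
        show "eventually (\<lambda>t. dist (h t) (partial_deriv m F z) < e) (nhds t0)"
          using near[OF r(1)] good
        proof eventually_elim
          case (elim t)
          have "d m t \<in> cube n z r"
            using elim(1) z(1) m r(1) by (auto simp: cube_def d_def coordinate_space_def)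
          moreover have "\<bar>(SOME \<xi>. good t \<xi>) - z m\<bar> < r"
          proof -
            have "\<bar>(SOME \<xi>. good t \<xi>) - z m\<bar> \<le> \<bar>c t m - z m\<bar>"
              using elim(2) good_def[of t "SOME \<xi>. good t \<xi>"] by blast
            also have "\<dots> < r"
              using elim(1) m by simp
            finally show ?thesis .
          qed
          ultimately show ?case
            unfolding h_def dist_real_def by (intro r(3) fun_upd_mem_cube[OF _ m])
        qed
      qed
      then have "(h \<longlongrightarrow> partial_deriv m F z) (at t0)"
        by (rule tendsto_mono[OF at_within_le_nhds])
      moreover have "((\<lambda>t. (c t m - z m) / (t - t0)) \<longlongrightarrow> c' m) (at t0)"
        using c[OF m] by (simp add: has_field_derivative_iff z_def)
      ultimately have "((\<lambda>t. h t * ((c t m - z m) / (t - t0))) \<longlongrightarrow> partial_deriv m F z * c' m) (at t0)"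
        by (rule tendsto_mult)
      moreover have "eventually (\<lambda>t. h t * ((c t m - z m) / (t - t0)) = (\<phi> t - \<phi> t0) / (t - t0)) (nhds t0)"
        using good
      proof eventually_elim
        case (elim t)
        then have "\<phi> t = h t * (c t m - z m)"
          using good_def[of t "SOME \<xi>. good t \<xi>"] h_def[of t] by metis
        then show ?case by (simp add: phi0)
      qed
      then have "eventually (\<lambda>t. h t * ((c t m - z m) / (t - t0)) = (\<phi> t - \<phi> t0) / (t - t0)) (at t0)"
        unfolding eventually_nhds_conv_at by blast
      ultimately show ?thesis
        by (rule Lim_transform_eventually)
    qed
    then have "(\<phi> has_field_derivative partial_deriv m F z * c' m) (at t0)"
      by (simp add: has_field_derivative_iff)
    then have "((\<lambda>t. F (d m t) + \<phi> t) has_field_derivative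
        (\<Sum>i<m. partial_deriv i F z * c' i) + partial_deriv m F z * c' m) (at t0)"
      using Suc by (intro DERIV_add) auto
    then show ?case by (simp add: \<phi>_def)
  qed
  from this[OF order_refl]
  have "((\<lambda>t. F (d n t)) has_field_derivative (\<Sum>i<n. partial_deriv i F (c t0) * c' i)) (at t0)"
    by (simp add: z_def)
  moreover have "eventually (\<lambda>t. F (d n t) = F (c t)) (nhds t0)"
    using cn
  proof eventually_elim
    case (elim t)
    then have "d n t = c t"
      using z(1) by (auto simp: d_def coordinate_space_def)
    then show ?case by simp
  qed
  ultimately show ?thesis
    by (rule has_real_derivative_eventually_cong)
qed

lemma C_k_on_compose:
  assumes V: "open_in_space n V" and W: "open_in_space n W"
    and F: "C_k_on n k W F" and G: "\<And>i. i < n \<Longrightarrow> C_k_on n k V (\<lambda>x. G x i)" and GV: "G ` V \<subseteq> W"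
  shows "C_k_on n k V (\<lambda>x. F (G x))"
  using F G
proof (induction k arbitrary: F)
  case k: 0
  have contG: "continuous_on V G"
  proof (rule continuous_on_coordinatewise_then_product)
    fix i show "continuous_on V (\<lambda>x. G x i)"
    proof (cases "i < n")
      case False
      then have "G x i = 0" if "x \<in> V" for x
        using open_in_space_subset[OF W] GV that by (auto simp: coordinate_space_def image_subset_iff)
      then show ?thesis
        using continuous_on_cong[of V V "\<lambda>x. G x i" "\<lambda>_. 0"] by simp
    qed (use k C_k_on_continuous in auto)
  qed
  then show ?case
    using continuous_on_compose2[OF C_k_on_continuous[OF k(1)] contG GV] by simp
next
  case (Suc k)
  have le: "\<And>i. i < n \<Longrightarrow> C_k_on n k V (\<lambda>x. G x i)"
    using Suc.prems(2) C_k_on_Suc_imp by blast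
  have F1: "C_k_on n 1 W F"
    using Suc.prems(1) C_k_on_continuous by auto
  have d: "((\<lambda>t. F (G (x(i := t)))) has_field_derivative
      (\<Sum>j<n. partial_deriv j F (G x) * partial_deriv i (\<lambda>x. G x j) x)) (at (x i))" if i: "i < n" and x: "x \<in> V" for i x
  proof -
    have "((\<lambda>t. F (G (x(i := t)))) has_field_derivative
      (\<Sum>j<n. partial_deriv j F (G (x(i := x i))) * partial_deriv i (\<lambda>x. G x j) x)) (at (x i))"
    proof (rule C_1_on_has_derivative_along_curve[OF W F1])
      show "G (x(i := x i)) \<in> W" using GV x by auto
      show "eventually (\<lambda>t. G (x(i := t)) \<in> coordinate_space n) (nhds (x i))"
        using eventually_fun_upd_mem[OF V x i]
        by eventually_elim (use GV open_in_space_subset[OF W] in blast)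
      show "((\<lambda>t. G (x(i := t)) j) has_field_derivative partial_deriv i (\<lambda>x. G x j) x) (at (x i))" if "j < n" for j
        using C_k_on_has_partial_deriv[OF Suc.prems(2)[OF that] i x] .
    qed
    then show ?thesis by simp
  qed
  show ?case
  proof (rule C_k_on_SucI[OF _ d])
    show "continuous_on V (\<lambda>x. F (G x))"
      using Suc.IH[OF C_k_on_Suc_imp[OF Suc.prems(1)] le] C_k_on_continuous by blast
    fix i assume i: "i < n"
    show "C_k_on n k V (partial_deriv i (\<lambda>x. F (G x)))"
    proof (rule C_k_on_cong[OF V])
      show "C_k_on n k V (\<lambda>x. \<Sum>j<n. partial_deriv j F (G x) * partial_deriv i (\<lambda>x. G x j) x)"
        by (intro C_k_on_sum V C_k_on_mult Suc.IH[OF C_k_on_partial_deriv[OF Suc.prems(1)] le]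
            C_k_on_partial_deriv[OF Suc.prems(2) i]) auto
    qed (rule partial_deriv_eqI[OF d[OF i], symmetric])
  qed
qed

section \<open>A bump function and Hadamard's lemma\<close>

text \<open>
  The family that contains \<open>exp (- 1 / t)\<close> (for \<open>m = 0\<close>) and is closed under differentiation up to linear
  combinations, so that smoothness follows by induction over the order for all \<open>m\<close> at once.
\<close>

definition flat :: "nat \<Rightarrow> real \<Rightarrow> real" where
  "flat m t = (if t > 0 then (1 / t) ^ m * exp (- (1 / t)) else 0)"

lemma flat_tendsto_0: "(flat m \<longlongrightarrow> 0) (at 0)"
proof -
  have "((\<lambda>t. (1 / t) ^ m / exp (1 / t)) \<longlongrightarrow> (0 :: real)) (at_right 0)"
    using filterlim_compose[OF tendsto_power_div_exp_0[of m] filterlim_inverse_at_top_right]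
    by (simp add: inverse_eq_divide)
  moreover have "eventually (\<lambda>t. (1 / t) ^ m / exp (1 / t) = flat m t) (at_right 0)"
    by (auto simp: eventually_at_right_field flat_def exp_minus divide_inverse intro!: exI[of _ 1])
  ultimately have "(flat m \<longlongrightarrow> 0) (at_right 0)"
    by (rule Lim_transform_eventually)
  moreover have "(flat m \<longlongrightarrow> 0) (at_left 0)"
  proof (rule Lim_transform_eventually[OF tendsto_const])
    show "eventually (\<lambda>t. 0 = flat m t) (at_left 0)"
      by (auto simp: eventually_at_left_field flat_def intro!: exI[of _ "- 1"])
  qed
  ultimately show ?thesis
    by (simp add: filterlim_at_split)
qed

text \<open>
  At \<open>0\<close> the difference quotient of \<open>flat m\<close> is \<open>flat (m + 1)\<close>.
\<close>

lemma flat_has_derivative: "(flat m has_field_derivative flat (m + 2) t - m * flat (m + 1) t) (at t)"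
proof -
  consider "t > 0" | "t < 0" | "t = 0" by linarith
  then show ?thesis
  proof cases
    case 1
    have "((\<lambda>t. (1 / t) ^ m * exp (- (1 / t))) has_field_derivative flat (m + 2) t - m * flat (m + 1) t) (at t)"
    proof -
      have d: "((\<lambda>t. 1 / t) has_field_derivative - ((1 / t)\<^sup>2)) (at t)"
        using 1 by (auto intro!: derivative_eq_intros simp: power2_eq_square)
      have "((\<lambda>t. (1 / t) ^ m * exp (- (1 / t))) has_field_derivative
          real m * (- ((1 / t)\<^sup>2) * (1 / t) ^ (m - Suc 0)) * exp (- (1 / t)) +
          exp (- (1 / t)) * (- (- ((1 / t)\<^sup>2))) * (1 / t) ^ m) (at t)"
        by (rule DERIV_mult[OF DERIV_power[OF d] DERIV_fun_exp[OF DERIV_minus[OF d]]])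
      also have "real m * (- ((1 / t)\<^sup>2) * (1 / t) ^ (m - Suc 0)) * exp (- (1 / t)) +
          exp (- (1 / t)) * (- (- ((1 / t)\<^sup>2))) * (1 / t) ^ m = flat (m + 2) t - m * flat (m + 1) t"
        using 1 by (cases m) (simp_all add: flat_def power2_eq_square algebra_simps)
      finally show ?thesis .
    qed
    moreover have "eventually (\<lambda>u. (1 / u) ^ m * exp (- (1 / u)) = flat m u) (nhds t)"
      using eventually_nhds_in_open[of "{0<..}" t] 1 by (auto elim!: eventually_mono simp: flat_def)
    ultimately show ?thesis
      by (rule has_real_derivative_eventually_cong)
  next
    case 2
    have "((\<lambda>_. 0) has_field_derivative flat (m + 2) t - m * flat (m + 1) t) (at t)"
      using 2 by (simp add: flat_def)
    moreover have "eventually (\<lambda>u. 0 = flat m u) (nhds t)"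
      using eventually_nhds_in_open[of "{..<0}" t] 2 by (auto elim!: eventually_mono simp: flat_def)
    ultimately show ?thesis
      by (rule has_real_derivative_eventually_cong)
  next
    case 3
    have "(\<lambda>u. (flat m u - flat m 0) / (u - 0)) = flat (m + 1)"
      by (auto simp: flat_def fun_eq_iff)
    then show ?thesis
      using flat_tendsto_0[of "m + 1"] by (simp add: has_field_derivative_iff 3) (simp add: flat_def)
  qed
qed

lemma C_k_on_flat:
  assumes V: "open_in_space n V"
  shows "C_k_on n k V (\<lambda>x. flat m (a + s * x i))"
proof (induction k arbitrary: m)
  case 0
  have "continuous_on UNIV (flat m)"
    by (rule DERIV_continuous_on) (rule has_field_derivative_at_within, rule flat_has_derivative)
  moreover have "continuous_on V (\<lambda>x. a + s * x i)"
    by (intro continuous_intros continuous_on_subset[OF continuous_on_product_coordinates]) simp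
  ultimately have "continuous_on V (\<lambda>x. flat m (a + s * x i))"
    by (rule continuous_on_compose2) simp
  then show ?case by simp
next
  case (Suc k)
  define D where "D j = (\<lambda>x :: nat \<Rightarrow> real. if j = i
      then s * (flat (m + 2) (a + s * x i) + (- real m) * flat (m + 1) (a + s * x i)) else 0)" for j
  have d: "((\<lambda>t. flat m (a + s * (x(j := t)) i)) has_field_derivative D j x) (at (x j))" for j x
  proof (cases "j = i")
    case True
    have "((\<lambda>t. flat m (a + s * t)) has_field_derivative (flat (m + 2) (a + s * x i) - m * flat (m + 1) (a + s * x i)) * s) (at (x i))"
      by (rule DERIV_chain2[OF flat_has_derivative]) (auto intro!: derivative_eq_intros)
    then show ?thesis
      using True by (simp add: D_def algebra_simps)
  qed (simp add: D_def)
  have pd: "partial_deriv j (\<lambda>x. flat m (a + s * x i)) = D j" for j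
    by (rule ext) (rule partial_deriv_eqI[OF d])
  have "C_k_on n k V (\<lambda>x. s * (flat (m + 2) (a + s * x i) + (- real m) * flat (m + 1) (a + s * x i)))"
    by (intro C_k_on_mult C_k_on_add C_k_on_const V Suc.IH)
  then have "C_k_on n k V (D j)" for j
    by (cases "j = i") (simp_all add: D_def C_k_on_const)
  moreover have "continuous_on V (\<lambda>x. flat m (a + s * x i))"
    using Suc.IH C_k_on_continuous by blast
  ultimately show ?case
    by (intro C_k_on_SucI[OF _ d]) (simp_all add: pd)
qed

text \<open>
  Positive in the interior of the cube of radius \<open>r\<close> about \<open>a\<close> and zero elsewhere.  The factors \<open>1\<close> and
  \<open>-1\<close> match the affine arguments in \<open>C_k_on_flat\<close>.
\<close>

definition bump :: "nat \<Rightarrow> (nat \<Rightarrow> real) \<Rightarrow> real \<Rightarrow> (nat \<Rightarrow> real) \<Rightarrow> real" where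
  "bump n a r x = (\<Prod>i<n. flat 0 (r - a i + 1 * x i) * flat 0 (r + a i + (- 1) * x i))"

lemma smooth_on_bump: "open_in_space n V \<Longrightarrow> smooth_on n V (bump n a r)"
  unfolding smooth_on_def bump_def by (intro allI C_k_on_prod C_k_on_mult C_k_on_flat)

lemma bump_eq_0: "i < n \<Longrightarrow> \<bar>x i - a i\<bar> \<ge> r \<Longrightarrow> bump n a r x = 0"
  unfolding bump_def by (rule prod_zero) (auto simp: flat_def intro!: bexI[of _ i])

lemma bump_center: "r > 0 \<Longrightarrow> bump n a r a > 0"
  unfolding bump_def by (rule prod_pos) (simp add: flat_def)

definition segment_point :: "(nat \<Rightarrow> real) \<Rightarrow> real \<Rightarrow> (nat \<Rightarrow> real) \<Rightarrow> nat \<Rightarrow> real" where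
  "segment_point q s x = (\<lambda>i. q i + s * (x i - q i))"

lemma segment_point_mem_cube:
  assumes "q \<in> cube n a r" "x \<in> cube n a r" "0 \<le> s" "s \<le> 1"
  shows "segment_point q s x \<in> cube n a r"
proof -
  have "\<bar>q i + s * (x i - q i) - a i\<bar> < r" if "i < n" for i
  proof -
    have "q i + s * (x i - q i) - a i = (1 - s) * (q i - a i) + s * (x i - a i)"
      by (simp add: algebra_simps)
    also have "\<bar>\<dots>\<bar> \<le> (1 - s) * \<bar>q i - a i\<bar> + s * \<bar>x i - a i\<bar>"
      using assms(3,4) by (intro order_trans[OF abs_triangle_ineq]) (simp add: abs_mult)
    also have "\<dots> < r"
      using assms that by (intro convex_bound_lt) (auto simp: cube_def)
    finally show ?thesis .
  qed
  then show ?thesis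
    using assms(1,2) by (auto simp: cube_def segment_point_def coordinate_space_def)
qed

lemma continuous_on_segment_integrand:
  assumes H: "continuous_on (cube n a r) H" and q: "q \<in> cube n a r"
  shows "continuous_on (cube n a r \<times> cbox 0 1) (\<lambda>(x, s). s ^ m * H (segment_point q s x))"
proof -
  have "continuous_on (cube n a r \<times> cbox 0 1) (\<lambda>z. segment_point q (snd z) (fst z))"
    unfolding segment_point_def
    by (intro continuous_on_coordinatewise_then_product continuous_intros
        continuous_on_product_then_coordinatewise[OF continuous_on_fst[OF continuous_on_id]])
  then have "continuous_on (cube n a r \<times> cbox 0 1) (\<lambda>z. H (segment_point q (snd z) (fst z)))"
    by (rule continuous_on_compose2[OF H]) (auto intro!: segment_point_mem_cube q)
  then show ?thesis
    unfolding split_beta by (intro continuous_intros)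
qed

text \<open>
  Differentiation in \<open>x\<close> under the integral produces a further factor \<open>s\<close> from the point
  \<open>q + s (x - q)\<close>; the weight \<open>s\<^sup>m\<close> makes the statement stable under this.
\<close>

lemma C_k_on_segment_integral:
  assumes H: "C_k_on n k (cube n a r) H" and q: "q \<in> cube n a r"
  shows "C_k_on n k (cube n a r) (\<lambda>x. integral (cbox 0 1) (\<lambda>s. s ^ m * H (segment_point q s x)))"
  using H
proof (induction k arbitrary: H m)
  case 0
  then show ?case
    using integral_continuous_on_param[OF continuous_on_segment_integrand[OF _ q]] by simp
next
  case (Suc k)
  let ?V = "cube n a r"
  have c: "continuous_on ?V (\<lambda>x. integral (cbox 0 1) (\<lambda>s. s ^ m * H (segment_point q s x)))"
    using integral_continuous_on_param[OF continuous_on_segment_integrand[OF C_k_on_continuous[OF Suc.prems] q]] .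
  have d: "((\<lambda>t. integral (cbox 0 1) (\<lambda>s. s ^ m * H (segment_point q s (x(i := t))))) has_field_derivative
      integral (cbox 0 1) (\<lambda>s. s ^ Suc m * partial_deriv i H (segment_point q s x))) (at (x i))"
    if i: "i < n" and x: "x \<in> ?V" for i x
  proof -
    define U where "U = {t. \<bar>t - a i\<bar> < r}"
    have U: "open U" "convex U" "x i \<in> U"
    proof -
      have "U = {a i - r<..<a i + r}" by (auto simp: U_def)
      then show "open U" "convex U" by simp_all
      show "x i \<in> U" using x i by (simp add: U_def cube_def)
    qed
    have xU: "x(i := t) \<in> ?V" if "t \<in> U" for t
      using fun_upd_mem_cube[OF x i] that by (simp add: U_def)
    have cH: "continuous_on ?V H" "continuous_on ?V (partial_deriv i H)"
      using C_k_on_continuous[OF Suc.prems] C_k_on_continuous[OF C_k_on_partial_deriv[OF Suc.prems i]] .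
    have "((\<lambda>t. integral (cbox 0 1) (\<lambda>s. s ^ m * H (segment_point q s (x(i := t))))) has_field_derivative
        integral (cbox 0 1) (\<lambda>s. s ^ Suc m * partial_deriv i H (segment_point q s (x(i := x i))))) (at (x i) within U)"
    proof (rule leibniz_rule_field_derivative)
      fix t s :: real assume t: "t \<in> U" and s: "s \<in> cbox 0 1"
      let ?y = "segment_point q s (x(i := t))"
      have y: "?y \<in> ?V"
        using s by (intro segment_point_mem_cube q xU t) auto
      have e: "segment_point q s (x(i := u)) = ?y(i := q i + s * (u - q i))" for u
        by (auto simp: segment_point_def)
      have "((\<lambda>u. H (?y(i := u))) has_field_derivative partial_deriv i H ?y) (at (q i + s * (t - q i)))"
      proof -
        have "?y i = q i + s * (t - q i)" by (simp add: segment_point_def)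
        then show ?thesis using C_k_on_has_partial_deriv[OF Suc.prems i y] by (simp only:)
      qed
      then have "((\<lambda>u. H (?y(i := q i + s * (u - q i)))) has_field_derivative partial_deriv i H ?y * s) (at t)"
        by (rule DERIV_chain2) (auto intro!: derivative_eq_intros)
      then have "((\<lambda>u. s ^ m * H (?y(i := q i + s * (u - q i)))) has_field_derivative s ^ m * (partial_deriv i H ?y * s)) (at t)"
        by (rule DERIV_cmult)
      moreover have "(\<lambda>u. s ^ m * H (segment_point q s (x(i := u)))) = (\<lambda>u. s ^ m * H (?y(i := q i + s * (u - q i))))"
        by (rule ext) (rule arg_cong[OF e])
      moreover have "s ^ m * (partial_deriv i H ?y * s) = s ^ Suc m * partial_deriv i H ?y"
        by simp
      ultimately have "((\<lambda>u. s ^ m * H (segment_point q s (x(i := u)))) has_field_derivative s ^ Suc m * partial_deriv i H ?y) (at t)"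
        by (simp only:)
      then show "((\<lambda>u. s ^ m * H (segment_point q s (x(i := u)))) has_field_derivative s ^ Suc m * partial_deriv i H ?y) (at t within U)"
        by (rule has_field_derivative_at_within)
    next
      have up: "continuous_on (U \<times> cbox 0 1) (\<lambda>z. (x(i := fst z), snd z))"
      proof (rule continuous_on_Pair)
        show "continuous_on (U \<times> cbox 0 1) (\<lambda>z. x(i := fst z))"
        proof (rule continuous_on_coordinatewise_then_product)
          show "continuous_on (U \<times> cbox 0 1) (\<lambda>z. (x(i := fst z)) j)" for j
            by (cases "j = i") (simp_all add: continuous_on_fst[OF continuous_on_id])
        qed
      qed (rule continuous_on_snd[OF continuous_on_id])
      have "continuous_on (U \<times> cbox 0 1) ((\<lambda>(x, s). s ^ Suc m * partial_deriv i H (segment_point q s x)) \<circ> (\<lambda>z. (x(i := fst z), snd z)))"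
        by (rule continuous_on_compose[OF up])
           (rule continuous_on_subset[OF continuous_on_segment_integrand[OF cH(2) q]], auto intro: xU)
      then show "continuous_on (U \<times> cbox 0 1) (\<lambda>(t, s). s ^ Suc m * partial_deriv i H (segment_point q s (x(i := t))))"
        by (simp add: o_def split_beta)
      fix t assume t: "t \<in> U"
      have "continuous_on (cbox 0 1) ((\<lambda>(x, s). s ^ m * H (segment_point q s x)) \<circ> Pair (x(i := t)))"
        by (rule continuous_on_compose[OF continuous_on_Pair[OF continuous_on_const continuous_on_id, simplified]])
           (rule continuous_on_subset[OF continuous_on_segment_integrand[OF cH(1) q]], auto intro: xU t)
      then show "(\<lambda>s. s ^ m * H (segment_point q s (x(i := t)))) integrable_on cbox 0 1"
        by (intro integrable_continuous) (simp add: o_def)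
    qed (use U in auto)
    then show ?thesis
      using at_within_open[OF U(3,1)] by simp
  qed
  show ?case
  proof (rule C_k_on_SucI[OF c d])
    show "C_k_on n k ?V (partial_deriv i (\<lambda>x. integral (cbox 0 1) (\<lambda>s. s ^ m * H (segment_point q s x))))"
      if i: "i < n" for i
      by (rule C_k_on_cong[OF open_in_space_cube partial_deriv_eqI[OF d[OF i], symmetric]
            Suc.IH[OF C_k_on_partial_deriv[OF Suc.prems i]]])
  qed
qed

text \<open>
  Integrate the derivative of \<open>F\<close> along the segment from \<open>q\<close> to \<open>x\<close>, with
  \<open>g\<^sub>i(x) = \<integral>\<^sub>0\<^sup>1 (\<partial>\<^sub>i F)(q + s (x - q)) ds\<close>.
\<close>

lemma Hadamard:
  assumes F: "smooth_on n (cube n a r) F" and q: "q \<in> cube n a r"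
  obtains g where "\<And>i. i < n \<Longrightarrow> smooth_on n (cube n a r) (g i)"
    and "\<And>x. x \<in> cube n a r \<Longrightarrow> F x - F q = (\<Sum>i<n. (x i - q i) * g i x)"
    and "\<And>i. i < n \<Longrightarrow> g i q = partial_deriv i F q"
proof
  let ?V = "cube n a r"
  define g where "g i x = integral (cbox 0 1) (\<lambda>s. s ^ 0 * partial_deriv i F (segment_point q s x))" for i x
  have F': "C_k_on n k ?V F" for k
    using F by (simp add: smooth_on_def)
  note pF = C_k_on_partial_deriv[OF F']
  show "smooth_on n ?V (g i)" if i: "i < n" for i
    unfolding smooth_on_def g_def by (intro allI C_k_on_segment_integral pF i q)
  show "g i q = partial_deriv i F q" for i
    by (simp add: g_def segment_point_def)
  show "F x - F q = (\<Sum>i<n. (x i - q i) * g i x)" if x: "x \<in> ?V" for x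
  proof -
    have mem: "segment_point q s x \<in> ?V" if "s \<in> {0..1}" for s
      using that by (intro segment_point_mem_cube q x) auto
    have "((\<lambda>s. \<Sum>i<n. partial_deriv i F (segment_point q s x) * (x i - q i)) has_integral
        F (segment_point q 1 x) - F (segment_point q 0 x)) {0..1}"
    proof (rule fundamental_theorem_of_calculus)
      fix s :: real assume s: "s \<in> {0..1}"
      have "((\<lambda>s. F (segment_point q s x)) has_field_derivative
          (\<Sum>i<n. partial_deriv i F (segment_point q s x) * (x i - q i))) (at s)"
      proof (rule C_1_on_has_derivative_along_curve[where c = "\<lambda>s. segment_point q s x",
            OF open_in_space_cube F' mem[OF s]])
        show "eventually (\<lambda>s. segment_point q s x \<in> coordinate_space n) (nhds s)"
          using q x by (intro always_eventually) (auto simp: cube_def segment_point_def coordinate_space_def)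
        show "((\<lambda>s. segment_point q s x i) has_field_derivative x i - q i) (at s)" for i
          unfolding segment_point_def by (auto intro!: derivative_eq_intros)
      qed
      then show "((\<lambda>s. F (segment_point q s x)) has_vector_derivative
          (\<Sum>i<n. partial_deriv i F (segment_point q s x) * (x i - q i))) (at s within {0..1})"
        by (simp add: has_real_derivative_iff_has_vector_derivative has_vector_derivative_at_within)
    qed simp
    then have "F x - F q = integral {0..1} (\<lambda>s. \<Sum>i<n. partial_deriv i F (segment_point q s x) * (x i - q i))"
      by (simp add: integral_unique segment_point_def)
    also have "\<dots> = (\<Sum>i<n. integral {0..1} (\<lambda>s. partial_deriv i F (segment_point q s x) * (x i - q i)))"
    proof (rule integral_sum)
      fix i assume "i \<in> {..<n}"
      then have c: "continuous_on ?V (partial_deriv i F)"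
        using C_k_on_continuous[OF pF] by blast
      have "continuous_on {0..1} (\<lambda>s. segment_point q s x)"
        unfolding segment_point_def by (intro continuous_on_coordinatewise_then_product continuous_intros)
      then have "continuous_on {0..1} (\<lambda>s. partial_deriv i F (segment_point q s x))"
        by (rule continuous_on_compose2[OF c]) (auto intro: mem)
      then show "(\<lambda>s. partial_deriv i F (segment_point q s x) * (x i - q i)) integrable_on {0..1}"
        by (intro integrable_continuous_interval continuous_intros)
    qed simp
    also have "\<dots> = (\<Sum>i<n. (x i - q i) * g i x)"
      by (simp add: g_def mult.commute)
    finally show ?thesis .
  qed
qed

lemma smooth_on_intros:
  assumes "open_in_space n V"
  shows "smooth_on n V (\<lambda>_. c)" "smooth_on n V (\<lambda>x. x i)"
    and "smooth_on n V F \<Longrightarrow> smooth_on n V G \<Longrightarrow> smooth_on n V (\<lambda>x. F x + G x)"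
    and "smooth_on n V F \<Longrightarrow> smooth_on n V G \<Longrightarrow> smooth_on n V (\<lambda>x. F x * G x)"
    and "i < n \<Longrightarrow> smooth_on n V F \<Longrightarrow> smooth_on n V (partial_deriv i F)"
proof -
  show "smooth_on n V (\<lambda>_. c)" "smooth_on n V (\<lambda>x. x i)"
    by (simp_all add: smooth_on_def C_k_on_const C_k_on_coordinate)
  show "smooth_on n V (\<lambda>x. F x + G x)" "smooth_on n V (\<lambda>x. F x * G x)" if "smooth_on n V F" "smooth_on n V G"
    using that C_k_on_add[OF assms, of _ F G] C_k_on_mult[OF assms, of _ F G] by (simp_all add: smooth_on_def)
  show "smooth_on n V (partial_deriv i F)" if "i < n" "smooth_on n V F"
    unfolding smooth_on_def
  proof
    fix k
    have "C_k_on n (Suc k) V F" using that(2) unfolding smooth_on_def by blast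
    then show "C_k_on n k V (partial_deriv i F)" using that(1) by (rule C_k_on_partial_deriv)
  qed
qed

lemma smooth_on_subset: "smooth_on n V F \<Longrightarrow> W \<subseteq> V \<Longrightarrow> smooth_on n W F"
  unfolding smooth_on_def using C_k_on_subset by blast

lemma smooth_on_cong:
  "open_in_space n V \<Longrightarrow> (\<And>x. x \<in> V \<Longrightarrow> F x = G x) \<Longrightarrow> smooth_on n V F \<Longrightarrow> smooth_on n V G"
  unfolding smooth_on_def using C_k_on_cong[of n V F G] by blast

lemma smooth_on_local:
  assumes "open_in_space n V"
    and "\<And>x. x \<in> V \<Longrightarrow> \<exists>W. open_in_space n W \<and> x \<in> W \<and> smooth_on n W F"
  shows "smooth_on n V F"
  unfolding smooth_on_def
proof
  fix k show "C_k_on n k V F"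
    by (rule C_k_on_local[OF assms(1)]) (use assms(2) in \<open>auto simp: smooth_on_def\<close>)
qed

lemma smooth_on_compose:
  assumes "open_in_space n V" "open_in_space n W" "smooth_on n W F"
    and "\<And>i. i < n \<Longrightarrow> smooth_on n V (\<lambda>x. G x i)" "G ` V \<subseteq> W"
  shows "smooth_on n V (\<lambda>x. F (G x))"
  unfolding smooth_on_def
proof
  fix k show "C_k_on n k V (\<lambda>x. F (G x))"
    by (rule C_k_on_compose[OF assms(1,2) _ _ assms(5)]) (use assms(3,4) in \<open>simp_all add: smooth_on_def\<close>)
qed

section \<open>Frames for the smooth functions of a manifold\<close>

locale manifold =
  fixes n :: nat and A :: "'m::{t2_space, second_countable_topology} chart set"
  assumes manifold: "smooth_manifold n A"
begin

abbreviation "C \<equiv> smooth_functions n A"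

context
  fixes U \<phi> assumes chart: "(U, \<phi>) \<in> A"
begin

lemma chart_facts:
  "open U" "open_in_space n (\<phi> ` U)" "homeomorphism U (\<phi> ` U) \<phi> (the_inv_into U \<phi>)"
proof -
  have "is_chart n (U, \<phi>)"
    using manifold chart by (auto simp: smooth_manifold_def)
  then show "open U" "open_in_space n (\<phi> ` U)" "homeomorphism U (\<phi> ` U) \<phi> (the_inv_into U \<phi>)"
    by (auto simp: is_chart_def Euclidean_space_eq)
qed

lemma inv_chart: "p \<in> U \<Longrightarrow> the_inv_into U \<phi> (\<phi> p) = p"
  using chart_facts(3) by (simp add: homeomorphism_def)

lemma chart_inv: "x \<in> \<phi> ` U \<Longrightarrow> \<phi> (the_inv_into U \<phi> x) = x" "x \<in> \<phi> ` U \<Longrightarrow> the_inv_into U \<phi> x \<in> U"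
  using chart_facts(3) unfolding homeomorphism_def by blast+

lemma chart_image_open:
  assumes "open W"
  shows "open_in_space n (\<phi> ` (U \<inter> W))"
proof -
  have "openin (top_of_set U) (U \<inter> W)"
    using assms by (simp add: openin_open_Int)
  then have "openin (top_of_set (\<phi> ` U)) (\<phi> ` (U \<inter> W))"
    by (rule homeomorphism_imp_open_map[OF chart_facts(3)])
  then show ?thesis
    using chart_facts(2) by (rule openin_trans)
qed

lemma chart_preimage_open:
  assumes "open_in_space n V" "V \<subseteq> \<phi> ` U"
  shows "open {p \<in> U. \<phi> p \<in> V}"
proof -
  have "openin (top_of_set (\<phi> ` U)) V"
    using assms open_in_space_subset[OF chart_facts(2)] by (meson openin_subset_trans)
  moreover have "continuous_on U \<phi>"
    using chart_facts(3) by (simp add: homeomorphism_def)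
  ultimately have "openin (top_of_set U) (U \<inter> \<phi> -` V)"
    by (intro continuous_openin_preimage) auto
  then have "open (U \<inter> \<phi> -` V)"
    using chart_facts(1) openin_open_trans by blast
  moreover have "U \<inter> \<phi> -` V = {p \<in> U. \<phi> p \<in> V}" by auto
  ultimately show ?thesis by simp
qed

lemma smooth_functions_chart:
  "f \<in> C \<Longrightarrow> smooth_on n (\<phi> ` U) (\<lambda>x. f (the_inv_into U \<phi> x))"
  using chart by (auto simp: smooth_functions_def o_def)

end

lemma smooth_functionsI:
  "(\<And>U \<phi>. (U, \<phi>) \<in> A \<Longrightarrow> smooth_on n (\<phi> ` U) (\<lambda>x. f (the_inv_into U \<phi> x))) \<Longrightarrow> f \<in> C"
  by (auto simp: smooth_functions_def o_def)

lemma function_algebra_smooth_functions: "function_algebra C"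
proof
  show "(\<lambda>_. a) \<in> C" for a
    by (rule smooth_functionsI) (rule smooth_on_intros(1)[OF chart_facts(2)])
  fix f g assume f: "f \<in> C" and g: "g \<in> C"
  show "f + g \<in> C"
  proof (rule smooth_functionsI)
    fix U \<phi> assume U: "(U, \<phi>) \<in> A"
    show "smooth_on n (\<phi> ` U) (\<lambda>x. (f + g) (the_inv_into U \<phi> x))"
      using smooth_on_intros(3)[OF chart_facts(2)[OF U] smooth_functions_chart[OF U f] smooth_functions_chart[OF U g]]
      by (simp only: fun_apply)
  qed
  show "f * g \<in> C"
  proof (rule smooth_functionsI)
    fix U \<phi> assume U: "(U, \<phi>) \<in> A"
    show "smooth_on n (\<phi> ` U) (\<lambda>x. (f * g) (the_inv_into U \<phi> x))"
      using smooth_on_intros(4)[OF chart_facts(2)[OF U] smooth_functions_chart[OF U f] smooth_functions_chart[OF U g]]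
      by (simp only: fun_apply)
  qed
qed

context
  fixes U \<phi> a r R
  assumes chart: "(U, \<phi>) \<in> A" and a: "a \<in> coordinate_space n" and r: "0 < r" "r < R"
    and cube: "cube n a R \<subseteq> \<phi> ` U"
begin

text \<open>
  A function given in a chart, extended by zero to the whole manifold.
\<close>

definition lift :: "((nat \<Rightarrow> real) \<Rightarrow> real) \<Rightarrow> 'm \<Rightarrow> real" where
  "lift S p = (if p \<in> U \<and> \<phi> p \<in> cube n a R then S (\<phi> p) else 0)"

text \<open>
  The closed cube is compact, so its preimage is compact and, in a Hausdorff space, closed.  This is what
  makes extension by zero smooth.
\<close>

lemma closed_support: "closed {p \<in> U. \<phi> p \<in> coordinate_space n \<and> (\<forall>i<n. \<bar>\<phi> p i - a i\<bar> \<le> r)}"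
proof -
  let ?K = "{x \<in> coordinate_space n. \<forall>i<n. \<bar>x i - a i\<bar> \<le> r}"
  have K: "?K \<subseteq> \<phi> ` U"
    using cube r by (force simp: cube_def)
  have "compactin (product_topology (\<lambda>i. euclidean) UNIV)
      (Pi\<^sub>E UNIV (\<lambda>i. if i < n then {a i - r..a i + r} else {0}))"
    by (simp add: compactin_PiE)
  moreover have "Pi\<^sub>E UNIV (\<lambda>i. if i < n then {a i - r..a i + r} else {0}) = ?K"
  proof -
    have "x i \<in> (if i < n then {a i - r..a i + r} else {0}) \<longleftrightarrow>
        (i < n \<longrightarrow> \<bar>x i - a i\<bar> \<le> r) \<and> (n \<le> i \<longrightarrow> x i = 0)" for x :: "nat \<Rightarrow> real" and i
      by (cases "i < n") (simp_all add: abs_le_iff, linarith)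
    then show ?thesis
      unfolding PiE_UNIV_domain Pi_def coordinate_space_def by blast
  qed
  ultimately have "compact ?K"
    by (simp add: euclidean_product_topology)
  moreover have "continuous_on ?K (the_inv_into U \<phi>)"
    using chart_facts(3)[OF chart] K by (meson continuous_on_subset homeomorphism_def)
  ultimately have "compact (the_inv_into U \<phi> ` ?K)"
    by (intro compact_continuous_image)
  moreover have "the_inv_into U \<phi> ` ?K = {p \<in> U. \<phi> p \<in> ?K}"
  proof (intro equalityI subsetI)
    fix p assume "p \<in> the_inv_into U \<phi> ` ?K"
    then obtain x where x: "x \<in> ?K" "p = the_inv_into U \<phi> x" by blast
    then have "x \<in> \<phi> ` U" using K by blast
    then show "p \<in> {p \<in> U. \<phi> p \<in> ?K}"
      using x chart_inv[OF chart, of x] by simp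
  next
    fix p assume p: "p \<in> {p \<in> U. \<phi> p \<in> ?K}"
    then have "p = the_inv_into U \<phi> (\<phi> p)"
      using inv_chart[OF chart, of p] by simp
    then show "p \<in> the_inv_into U \<phi> ` ?K"
      using p by blast
  qed
  ultimately show ?thesis
    by (simp add: compact_imp_closed)
qed

lemma lift_smooth:
  assumes S: "smooth_on n (cube n a R) S" and S0: "\<And>x i. i < n \<Longrightarrow> \<bar>x i - a i\<bar> \<ge> r \<Longrightarrow> S x = 0"
  shows "lift S \<in> C"
proof (rule smooth_functionsI)
  fix V \<psi> assume V: "(V, \<psi>) \<in> A"
  let ?W = "{p \<in> U. \<phi> p \<in> cube n a R}"
  let ?K = "{p \<in> U. \<phi> p \<in> coordinate_space n \<and> (\<forall>i<n. \<bar>\<phi> p i - a i\<bar> \<le> r)}"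
  have W: "open ?W"
    by (rule chart_preimage_open[OF chart open_in_space_cube cube])
  show "smooth_on n (\<psi> ` V) (\<lambda>x. lift S (the_inv_into V \<psi> x))"
  proof (rule smooth_on_local[OF chart_facts(2)[OF V]])
    fix x assume x: "x \<in> \<psi> ` V"
    define p where "p = the_inv_into V \<psi> x"
    have p: "p \<in> V" "\<psi> p = x"
      using chart_inv[OF V x] by (simp_all add: p_def)
    show "\<exists>N. open_in_space n N \<and> x \<in> N \<and> smooth_on n N (\<lambda>x. lift S (the_inv_into V \<psi> x))"
    proof (cases "p \<in> ?W")
      case True
      let ?N = "\<psi> ` (V \<inter> ?W)"
      have N: "open_in_space n ?N"
        by (rule chart_image_open[OF V W])
      have inv: "the_inv_into V \<psi> y \<in> ?W" if "y \<in> ?N" for y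
        using that inv_chart[OF V] by auto
      have "smooth_on n ?N (\<lambda>y. S (\<phi> (the_inv_into V \<psi> y)))"
      proof (rule smooth_on_compose[OF N open_in_space_cube S])
        fix i assume i: "i < n"
        have "smooth_on n (\<psi> ` (V \<inter> U)) (\<lambda>y. \<phi> (the_inv_into V \<psi> y) i)"
        proof -
          have "\<forall>(U, \<phi>)\<in>A. \<forall>(V, \<psi>)\<in>A. \<forall>i<n. smooth_on n (\<phi> ` (U \<inter> V)) (\<lambda>x. \<psi> (the_inv_into U \<phi> x) i)"
            using manifold unfolding smooth_manifold_def by blast
          from bspec[OF bspec[OF this V, unfolded split_conv] chart, unfolded split_conv] i
          show ?thesis by blast
        qed
        then show "smooth_on n ?N (\<lambda>y. \<phi> (the_inv_into V \<psi> y) i)"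
          by (rule smooth_on_subset) auto
      next
        show "(\<lambda>y. \<phi> (the_inv_into V \<psi> y)) ` ?N \<subseteq> cube n a R"
          using inv by blast
      qed
      then have "smooth_on n ?N (\<lambda>y. lift S (the_inv_into V \<psi> y))"
        by (rule smooth_on_cong[OF N, rotated]) (use inv in \<open>auto simp: lift_def\<close>)
      moreover have "x \<in> ?N"
        using p True by blast
      ultimately show ?thesis using N by blast
    next
      case False
      let ?N = "\<psi> ` (V \<inter> - ?K)"
      have N: "open_in_space n ?N"
        using closed_support by (intro chart_image_open[OF V]) (simp add: open_Compl)
      have "?K \<subseteq> ?W"
        using r by (fastforce simp: cube_def)
      then have "x \<in> ?N"
        using p False by blast
      moreover have "lift S (the_inv_into V \<psi> y) = 0" if y: "y \<in> ?N" for y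
      proof -
        obtain q where q: "q \<in> V" "q \<notin> ?K" "y = \<psi> q"
          using y by blast
        then have "lift S q = 0"
          using S0 by (auto simp: lift_def cube_def not_le intro: less_imp_le)
        then show ?thesis
          using q inv_chart[OF V] by simp
      qed
      then have "smooth_on n ?N (\<lambda>y. lift S (the_inv_into V \<psi> y))"
        by (intro smooth_on_cong[OF N _ smooth_on_intros(1)[OF N, of 0]]) simp
      ultimately show ?thesis using N by blast
    qed
  qed
qed

text \<open>
  The vector field \<open>S \<partial>\<^sub>i\<close> of the chart, extended by zero.
\<close>

definition localized_partial :: "((nat \<Rightarrow> real) \<Rightarrow> real) \<Rightarrow> nat \<Rightarrow> 'm vfield" where
  "localized_partial S i f =
     (if f \<in> C then lift (\<lambda>x. S x * partial_deriv i (\<lambda>x. f (the_inv_into U \<phi> x)) x) else 0)"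

lemma chart_has_partial_deriv:
  assumes "f \<in> C" "i < n" "x \<in> cube n a R"
  shows "((\<lambda>t. f (the_inv_into U \<phi> (x(i := t)))) has_field_derivative
    partial_deriv i (\<lambda>x. f (the_inv_into U \<phi> x)) x) (at (x i))"
proof -
  have "C_k_on n (Suc 0) (\<phi> ` U) (\<lambda>x. f (the_inv_into U \<phi> x))"
    using smooth_functions_chart[OF chart assms(1)] unfolding smooth_on_def by blast
  then show ?thesis
    using C_k_on_has_partial_deriv[OF _ assms(2)] assms(3) cube by blast
qed

lemma vector_field_localized_partial:
  assumes S: "smooth_on n (cube n a R) S" and S0: "\<And>x i. i < n \<Longrightarrow> \<bar>x i - a i\<bar> \<ge> r \<Longrightarrow> S x = 0"
    and i: "i < n"
  shows "localized_partial S i \<in> vector_fields C"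
proof -
  interpret function_algebra C by (rule function_algebra_smooth_functions)
  let ?d = "\<lambda>f. partial_deriv i (\<lambda>x. f (the_inv_into U \<phi> x))"
  note D = chart_has_partial_deriv[OF _ i]
  show ?thesis
  proof (rule vector_fieldI)
    show "localized_partial S i f \<in> C" if "f \<in> C" for f
    proof -
      have "smooth_on n (cube n a R) (\<lambda>x. f (the_inv_into U \<phi> x))"
        using smooth_functions_chart[OF chart that] cube by (rule smooth_on_subset)
      then show ?thesis
        using that S S0 i
        by (simp add: localized_partial_def lift_smooth smooth_on_intros open_in_space_cube)
    qed
    show "localized_partial S i (f + g) = localized_partial S i f + localized_partial S i g" if fg: "f \<in> C" "g \<in> C" for f g
    proof -
      have "?d (f + g) x = ?d f x + ?d g x" if "x \<in> cube n a R" for x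
        by (rule partial_deriv_eqI) (simp only: fun_apply, intro DERIV_add D fg that)
      then show ?thesis
        using fg by (auto simp: localized_partial_def lift_def fun_eq_iff fun_apply add_mem algebra_simps)
    qed
    show "localized_partial S i (\<lambda>p. b * f p) = (\<lambda>p. b * localized_partial S i f p)" if f: "f \<in> C" for b f
    proof -
      have "?d (\<lambda>p. b * f p) x = b * ?d f x" if "x \<in> cube n a R" for x
        by (rule partial_deriv_eqI) (intro DERIV_cmult D f that)
      then show ?thesis
        using f by (auto simp: localized_partial_def lift_def fun_eq_iff scale_mem)
    qed
    show "localized_partial S i (f * g) = localized_partial S i f * g + f * localized_partial S i g" if fg: "f \<in> C" "g \<in> C" for f g
    proof -
      have "?d (f * g) x = ?d f x * g (the_inv_into U \<phi> x) + ?d g x * f (the_inv_into U \<phi> x)"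
        if x: "x \<in> cube n a R" for x
      proof (rule partial_deriv_eqI)
        have "((\<lambda>t. f (the_inv_into U \<phi> (x(i := t))) * g (the_inv_into U \<phi> (x(i := t)))) has_field_derivative
            ?d f x * g (the_inv_into U \<phi> (x(i := x i))) + ?d g x * f (the_inv_into U \<phi> (x(i := x i)))) (at (x i))"
          by (intro DERIV_mult D fg x)
        then show "((\<lambda>t. (f * g) (the_inv_into U \<phi> (x(i := t)))) has_field_derivative
            ?d f x * g (the_inv_into U \<phi> x) + ?d g x * f (the_inv_into U \<phi> x)) (at (x i))"
          by (simp only: fun_apply fun_upd_triv)
      qed
      then show ?thesis
        using fg inv_chart[OF chart]
        by (auto simp: localized_partial_def lift_def fun_eq_iff fun_apply mult_mem algebra_simps)
    qed
    show "localized_partial S i f = 0" if "f \<notin> C" for f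
      using that by (simp add: localized_partial_def)
  qed
qed

text \<open>
  Let \<open>b\<close> be the bump function.  At a point \<open>z\<close> of the cube, Hadamard's lemma gives
  \<open>b\<^sup>2 (f - f(z)) = \<Sum>\<^sub>i (b x\<^sub>i - z\<^sub>i b) (b g\<^sub>i)\<close>, an identity between globally defined functions.  Applying a
  derivation \<open>X\<close> and evaluating at \<open>z\<close>, where the first factors vanish and \<open>g\<^sub>i(z) = \<partial>\<^sub>i f(z)\<close>, yields
  \<open>b\<^sup>2 X f = \<Sum>\<^sub>i (X(b x\<^sub>i) - z\<^sub>i X b) b \<partial>\<^sub>i f\<close> at \<open>z\<close>.  The term with \<open>X b\<close> is absorbed by adding the
  function \<open>b\<close> to the frame, with the vector field \<open>- \<Sum>\<^sub>i b x\<^sub>i \<partial>\<^sub>i\<close>.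
\<close>

lemma frame_in_chart:
  "\<exists>\<rho>\<in>C. (\<forall>p\<in>U. \<phi> p = a \<longrightarrow> \<rho> p \<noteq> 0) \<and> (\<exists>N x E. (\<forall>i<N. x i \<in> C \<and> E i \<in> vector_fields C) \<and>
    (\<forall>X\<in>vector_fields C. \<forall>f\<in>C. \<rho> * X f = (\<Sum>i<(N::nat). X (x i) * E i f)))"
proof -
  interpret function_algebra C by (rule function_algebra_smooth_functions)
  let ?V = "cube n a R"
  let ?b = "bump n a r"
  define \<rho> where "\<rho> = lift ?b"
  define y where "y i = lift (\<lambda>x. ?b x * x i)" for i
  define E where "E i = localized_partial ?b i" for i
  define E' where "E' = - (\<Sum>i<n. localized_partial (\<lambda>x. ?b x * x i) i)"
  have b: "smooth_on n ?V ?b" "\<And>x i. i < n \<Longrightarrow> \<bar>x i - a i\<bar> \<ge> r \<Longrightarrow> ?b x = 0"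
    using smooth_on_bump[OF open_in_space_cube] bump_eq_0 by blast+
  have bx: "smooth_on n ?V (\<lambda>x. ?b x * x i)" for i
    by (intro smooth_on_intros b open_in_space_cube)
  have \<rho>: "\<rho> \<in> C" unfolding \<rho>_def by (intro lift_smooth b)
  have y: "y i \<in> C" for i unfolding y_def by (rule lift_smooth[OF bx]) (simp add: b)
  have E: "E i \<in> VF" if "i < n" for i
    unfolding E_def by (intro vector_field_localized_partial b that)
  have E'': "localized_partial (\<lambda>x. ?b x * x i) i \<in> VF" if "i < n" for i
    by (rule vector_field_localized_partial[OF bx _ that]) (simp add: b)
  have E': "E' \<in> VF"
  proof -
    have "(\<Sum>i\<in>I. localized_partial (\<lambda>x. ?b x * x i) i) \<in> VF" if "I \<subseteq> {..<n}" for I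
      using that by (induction I rule: infinite_finite_induct) (simp_all add: VF_zero VF_add E'')
    then show ?thesis unfolding E'_def by (intro VF_uminus) simp
  qed
  have main: "\<rho> * \<rho> * X f = (\<Sum>i<n. X (y i) * E i f) + X \<rho> * E' f" if X: "X \<in> VF" and f: "f \<in> C" for X f
  proof
    fix q
    show "(\<rho> * \<rho> * X f) q = ((\<Sum>i<n. X (y i) * E i f) + X \<rho> * E' f) q"
    proof (cases "q \<in> U \<and> \<phi> q \<in> ?V")
      case False
      then have "\<rho> q = 0" "E i f q = 0" "localized_partial (\<lambda>x. ?b x * x i) i f q = 0" for i
        using f by (auto simp: \<rho>_def E_def localized_partial_def lift_def)
      then show ?thesis
        by (simp add: fun_apply sum_fun_apply E'_def sum_vfield_apply)
    next
      case True
      define F where "F x = f (the_inv_into U \<phi> x)" for x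
      define z where "z = \<phi> q"
      have q: "q \<in> U" "z \<in> ?V" using True by (simp_all add: z_def)
      have fq: "F z = f q" using inv_chart[OF chart q(1)] by (simp add: F_def z_def)
      have "smooth_on n ?V F"
        using smooth_on_subset[OF smooth_functions_chart[OF chart f] cube] by (simp add: F_def[abs_def])
      then obtain g where g: "\<And>i. i < n \<Longrightarrow> smooth_on n ?V (g i)"
        and Fg: "\<And>x. x \<in> ?V \<Longrightarrow> F x - F z = (\<Sum>i<n. (x i - z i) * g i x)"
        and gz: "\<And>i. i < n \<Longrightarrow> g i z = partial_deriv i F z"
        using Hadamard[of n a R F z] q(2) by blast
      define G where "G i = lift (\<lambda>x. ?b x * g i x)" for i
      have G: "G i \<in> C" if "i < n" for i
        unfolding G_def by (rule lift_smooth) (simp_all add: smooth_on_intros open_in_space_cube b g that)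
      define h where "h i = (\<lambda>p. y i p + (- z i) * \<rho> p)" for i
      have h: "h i \<in> C" for i
        using add_mem[OF y scale_mem[OF \<rho>, of "- z i"]] by (simp add: h_def plus_fun_def)
      have hX: "X (h i) = X (y i) + (\<lambda>p. (- z i) * X \<rho> p)" for i
        using vector_field_add[OF X y scale_mem[OF \<rho>, of "- z i"], of i] vector_field_scale[OF X \<rho>, of "- z i"]
        by (simp add: h_def plus_fun_def[of "y i"])
      have hq: "h i q = 0" for i
        using q by (simp add: h_def y_def \<rho>_def lift_def z_def)
      have Gq: "G i q = E i f q" if "i < n" for i
        using q f gz[OF that] by (simp add: G_def E_def localized_partial_def lift_def F_def[abs_def] z_def)
      have E'q: "E' f q = - (\<Sum>i<n. z i * E i f q)"
        using q f by (simp add: E'_def E_def localized_partial_def lift_def fun_apply sum_fun_apply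
            sum_vfield_apply z_def mult_ac)
      \<comment> \<open>\<open>u = f - f(q)\<close>, written with a constant multiple of \<open>1\<close> to match the constants of the algebra\<close>
      define u where "u = (\<lambda>p. f p + - f q * 1)"
      have u: "u \<in> C" "X u = X f"
        using add_mem[OF f const_mem[of "- f q"]] vector_field_add[OF X f const_mem[of "- f q"]]
          vector_field_const[OF X, of "- f q"]
        by (simp_all add: u_def plus_fun_def[of f])
      have split: "\<rho> * (\<rho> * u) = (\<Sum>i<n. h i * G i)"
      proof
        fix p
        show "(\<rho> * (\<rho> * u)) p = (\<Sum>i<n. h i * G i) p"
        proof (cases "p \<in> U \<and> \<phi> p \<in> ?V")
          case True
          have "u p = F (\<phi> p) - F z"
            using True inv_chart[OF chart, of p] by (simp add: u_def fq) (simp add: F_def)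
          then have "u p = (\<Sum>i<n. (\<phi> p i - z i) * g i (\<phi> p))"
            using Fg True by simp
          then show ?thesis
            using True by (simp add: fun_apply sum_fun_apply \<rho>_def h_def y_def G_def lift_def sum_distrib_left algebra_simps)
        next
          case False
          then have "lift S p = 0" for S
            by (auto simp: lift_def)
          then show ?thesis
            by (simp add: fun_apply sum_fun_apply \<rho>_def h_def y_def)
        qed
      qed
      have Xsum: "X (\<Sum>i<m. h i * G i) = (\<Sum>i<m. X (h i) * G i + h i * X (G i))" if "m \<le> n" for m
        using that
      proof (induction m)
        case (Suc m)
        have "(\<Sum>i<m. h i * G i) \<in> C"
          using Suc by (intro sum_mem mult_mem h G) auto
        then show ?case
          using Suc G[of m] h[of m] by (simp add: vector_field_add X mult_mem vector_field_mult)
      qed (simp add: vector_field_zero X)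
      have "u q = 0" by (simp add: u_def)
      then have "X (\<rho> * (\<rho> * u)) q = \<rho> q * \<rho> q * X f q"
        by (simp add: vector_field_mult X \<rho> u mult_mem) (simp add: fun_apply)
      moreover have "X (\<rho> * (\<rho> * u)) q = (\<Sum>i<n. X (h i) q * E i f q)"
        unfolding split Xsum[OF order_refl] by (simp add: sum_fun_apply fun_apply hq Gq)
      ultimately show ?thesis
        by (simp add: fun_apply sum_fun_apply hX E'q sum.distrib sum_distrib_left algebra_simps sum_subtractf)
    qed
  qed
  \<comment> \<open>the frame has \<open>n + 1\<close> members, the last one being \<open>\<rho>\<close> with \<open>E'\<close>\<close>
  define x where "x i = (if i < n then y i else \<rho>)" for i
  define E2 where "E2 i = (if i < n then E i else E')" for i
  have "\<rho> p * \<rho> p \<noteq> 0" if "p \<in> U" "\<phi> p = a" for p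
    using that bump_center[OF r(1), of n a] a r by (simp add: \<rho>_def lift_def mem_cube_center)
  moreover have "\<forall>i<Suc n. x i \<in> C \<and> E2 i \<in> VF"
    by (simp add: x_def E2_def \<rho> y E E')
  moreover have "\<rho> * \<rho> * X f = (\<Sum>i<Suc n. X (x i) * E2 i f)" if "X \<in> VF" "f \<in> C" for X f
    using main[OF that] by (simp add: x_def E2_def)
  ultimately have "(\<forall>p\<in>U. \<phi> p = a \<longrightarrow> (\<rho> * \<rho>) p \<noteq> 0) \<and>
      (\<forall>i<Suc n. x i \<in> C \<and> E2 i \<in> VF) \<and>
      (\<forall>X\<in>VF. \<forall>f\<in>C. \<rho> * \<rho> * X f = (\<Sum>i<Suc n. X (x i) * E2 i f))"
    by (simp only: times_fun_apply) blast
  then show ?thesis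
    using mult_mem[OF \<rho> \<rho>] by blast
qed

end

lemma framed_smooth_functions: "framed_function_algebra C"
proof -
  interpret function_algebra C by (rule function_algebra_smooth_functions)
  show ?thesis
  proof
    fix p
    obtain U \<phi> where c: "(U, \<phi>) \<in> A" "p \<in> U"
    proof -
      have "p \<in> (\<Union>(U, \<phi>)\<in>A. U)"
        using manifold by (simp add: smooth_manifold_def)
      then show thesis using that by auto
    qed
    then have p: "\<phi> p \<in> \<phi> ` U" by simp
    obtain R where R: "R > 0" "cube n (\<phi> p) R \<subseteq> \<phi> ` U"
      using open_in_space_contains_cube[OF chart_facts(2)[OF c(1)] p] .
    have "\<phi> p \<in> coordinate_space n"
      using open_in_space_subset[OF chart_facts(2)[OF c(1)]] p by blast
    \<comment> \<open>the bump lives on half the cube, so that its support is closed in the chart\<close>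
    from frame_in_chart[OF c(1) this _ _ R(2), of "R / 2"] R(1) c(2)
    show "\<exists>\<rho>\<in>C. \<rho> p \<noteq> 0 \<and> (\<exists>N x E. (\<forall>i<N. x i \<in> C \<and> E i \<in> vector_fields C) \<and>
      (\<forall>X\<in>vector_fields C. \<forall>f\<in>C. \<rho> * X f = (\<Sum>i<(N::nat). X (x i) * E i f)))"
      by auto
  qed
qed

end

theorem lemma5:
  fixes n :: nat
    and A :: "'m::{t2_space, second_countable_topology} chart set"
    and \<pi> :: "'m form \<Rightarrow> 'm form \<Rightarrow> 'm \<Rightarrow> real"
    and B :: "'m form \<Rightarrow> 'm form \<Rightarrow> 'm form"
    and \<omega>1 \<omega>2 :: "'m form"
  assumes "smooth_manifold n A"
    and "poisson_structure (smooth_functions n A) \<pi>"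
    and "koszul_bracket (smooth_functions n A) \<pi> B"
    and "closed_form (smooth_functions n A) \<omega>1"
    and "closed_form (smooth_functions n A) \<omega>2"
  shows "exact_form (smooth_functions n A) (B \<omega>1 \<omega>2)"
proof -
  interpret manifold n A
    by unfold_locales (rule assms(1))
  interpret framed_function_algebra "smooth_functions n A"
    by (rule framed_smooth_functions)
  interpret poisson_algebra "smooth_functions n A" \<pi>
    by unfold_locales (use assms(2) in \<open>simp add: poisson_structure_def\<close>)
  show ?thesis
    by (rule bracket_closed_exact[OF assms(3-5)])
qed

end
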